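(* There exist a countable $\Pi^0_1$ set $P\subseteq\mathbb{N}^{\mathbb{N}}$ and a point $Z\in P$ such that $Z$ is not an arithmetical singleton.
   Context: $\mathbb{N}=\{0,1,2,\ldots\}$; points are elements of the Baire space $\mathbb{N}^{\mathbb{N}}$. For $n\ge 1$, a set $P\subseteq\mathbb{N}^{\mathbb{N}}$ is $\Pi^0_n$ (lightface) if $P=\{X\mid\forall i_1\,\exists i_2\cdots Q i_n\,R(X,i_1,\ldots,i_n)\}$, with $n$ alternating number quantifiers beginning with $\forall$, for some recursive predicate $R\subseteq\mathbb{N}^{\mathbb{N}}\times\mathbb{N}^n$ (decided by a Turing machine with oracle $X$ that halts for all $X$ and all inputs). A set is arithmetical if it is $\Pi^0_n$ for some $n$. An arithmetical singleton is a point $X\in\mathbb{N}^{\mathbb{N}}$ such that the one-element set $\{X\}$ is arithmetical. *)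

theory Defs
  imports Main "HOL-Library.Countable_Set"
begin

text \<open>
  Oracle Turing machines: deterministic machines with a finite transition table, a fixed number of
  one-way infinite work tapes, and one read-only oracle tape. States and tape symbols are natural
  numbers, of which a machine mentions only finitely many; symbol 0 is the blank. A transition
  depends on the state, the symbol scanned on the oracle tape and the list of symbols scanned on the
  work tapes; it gives the new state, the move of the oracle head, and for each work tape the symbol
  to write and the head move. The machine halts when no transition applies. A left move in cell 0
  leaves the head where it is.
\<close>

datatype move = Left | Stay | Right

record oracle_tm =
  num_tapes :: nat
  start_state :: nat
  accept_state :: nat
  transition :: "nat \<times> nat \<times> nat list \<rightharpoonup> nat \<times> move \<times> (nat \<times> move) list"

definition wf_oracle_tm :: "oracle_tm \<Rightarrow> bool" where
  "wf_oracle_tm M \<longleftrightarrow>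
     finite (dom (transition M)) \<and>
     (\<forall>(q, d, acts) \<in> ran (transition M). length acts = num_tapes M)"

record config =
  state :: nat
  oracle_pos :: nat
  work_tapes :: "((nat \<Rightarrow> nat) \<times> nat) list" \<comment> \<open>contents and head position of each tape\<close>

fun move_head :: "move \<Rightarrow> nat \<Rightarrow> nat" where
  "move_head Left p = p - 1"
| "move_head Stay p = p"
| "move_head Right p = p + 1"

fun scan :: "(nat \<Rightarrow> nat) \<times> nat \<Rightarrow> nat" where
  "scan (t, p) = t p"

fun act_on_tape :: "nat \<times> move \<Rightarrow> (nat \<Rightarrow> nat) \<times> nat \<Rightarrow> (nat \<Rightarrow> nat) \<times> nat" where
  "act_on_tape (a, d) (t, p) = (t(p := a), move_head d p)"

text \<open>
  The oracle tape for the point \<open>X\<close> reads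
  \<open>2 1\<dots>1 0 1\<dots>1 0 1\<dots>1 0 \<dots>\<close>, where 2 marks the left end and the successive blocks of ones have
  lengths \<open>X 0\<close>, \<open>X 1\<close>, \<open>X 2\<close>, \<dots>; so the \<open>m\<close>-th block is closed by a 0 in
  cell \<open>(X 0 + 1) + \<dots> + (X m + 1)\<close>.
\<close>

definition oracle_tape :: "(nat \<Rightarrow> nat) \<Rightarrow> nat \<Rightarrow> nat" where
  "oracle_tape X p =
     (if p = 0 then 2 else if \<exists>m. p = (\<Sum>j\<le>m. (X j + 1)) then 0 else 1)"

definition step :: "oracle_tm \<Rightarrow> (nat \<Rightarrow> nat) \<Rightarrow> config \<Rightarrow> config option" where
  "step M X c =
     (case transition M (state c, oracle_tape X (oracle_pos c), map scan (work_tapes c)) of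
        None \<Rightarrow> None
      | Some (q, d, acts) \<Rightarrow>
          Some \<lparr>state = q, oracle_pos = move_head d (oracle_pos c),
                work_tapes = map2 act_on_tape acts (work_tapes c)\<rparr>)"

text \<open>
  The inputs are written in unary, each on a work tape of its own; the remaining work tapes are
  blank, and all heads start in cell 0.
\<close>

definition unary :: "nat \<Rightarrow> nat \<Rightarrow> nat" where
  "unary i p = (if p < i then 1 else 0)"

definition init_config :: "oracle_tm \<Rightarrow> nat list \<Rightarrow> config" where
  "init_config M is =
     \<lparr>state = start_state M, oracle_pos = 0,
      work_tapes =
        map (\<lambda>j. (if j < length is then unary (is ! j) else (\<lambda>_. 0), 0)) [0..<num_tapes M]\<rparr>"

definition halts_at :: "oracle_tm \<Rightarrow> (nat \<Rightarrow> nat) \<Rightarrow> nat list \<Rightarrow> config \<Rightarrow> bool" where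
  "halts_at M X is c \<longleftrightarrow>
     (\<lambda>c c'. step M X c = Some c')\<^sup>*\<^sup>* (init_config M is) c \<and> step M X c = None"

text \<open>
  \<open>R X is\<close> with \<open>length is = n\<close> represents a subset of the product of Baire space with the
  \<open>n\<close>-tuples of natural numbers; values of \<open>R\<close> at lists of other lengths are irrelevant. One
  machine must work for all oracles.
\<close>

definition recursive_pred :: "nat \<Rightarrow> ((nat \<Rightarrow> nat) \<Rightarrow> nat list \<Rightarrow> bool) \<Rightarrow> bool" where
  "recursive_pred n R \<longleftrightarrow>
     (\<exists>M. wf_oracle_tm M \<and> n \<le> num_tapes M \<and>
        (\<forall>X is. length is = n \<longrightarrow>
           (\<exists>c. halts_at M X is c \<and> (state c = accept_state M \<longleftrightarrow> R X is))))"

text \<open>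
  \<open>forall_exists n A\<close> is \<open>\<forall>i\<^sub>1. \<exists>i\<^sub>2. \<forall>i\<^sub>3. \<dots> A [i\<^sub>1, \<dots>, i\<^sub>n]\<close>, with \<open>n\<close> alternating quantifiers;
  \<open>exists_forall n A\<close> begins with \<open>\<exists>\<close> instead.
\<close>

fun forall_exists :: "nat \<Rightarrow> (nat list \<Rightarrow> bool) \<Rightarrow> bool"
  and exists_forall :: "nat \<Rightarrow> (nat list \<Rightarrow> bool) \<Rightarrow> bool" where
  "forall_exists 0 A \<longleftrightarrow> A []"
| "forall_exists (Suc n) A \<longleftrightarrow> (\<forall>i. exists_forall n (\<lambda>is. A (i # is)))"
| "exists_forall 0 A \<longleftrightarrow> A []"
| "exists_forall (Suc n) A \<longleftrightarrow> (\<exists>i. forall_exists n (\<lambda>is. A (i # is)))"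

definition Pi0 :: "nat \<Rightarrow> (nat \<Rightarrow> nat) set \<Rightarrow> bool" where
  "Pi0 n P \<longleftrightarrow> n \<ge> 1 \<and> (\<exists>R. recursive_pred n R \<and> P = {X. forall_exists n (R X)})"

definition arithmetical :: "(nat \<Rightarrow> nat) set \<Rightarrow> bool" where
  "arithmetical P \<longleftrightarrow> (\<exists>n\<ge>1. Pi0 n P)"

definition arithmetical_singleton :: "(nat \<Rightarrow> nat) \<Rightarrow> bool" where
  "arithmetical_singleton X \<longleftrightarrow> arithmetical {X}"

end

theory Submission
  imports Defs Complex_Main "HOL-Library.Nat_Bijection" "HOL-Library.Sublist"
begin

text \<open>
  A point \<open>A\<close> is built from a point \<open>A'\<close> one level up by a Friedberg jump inversion: the values of
  \<open>A'\<close> are interleaved with finite strings which, whenever possible, force the next \<open>\<Sigma>\<close> statement.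
  Hence the \<open>\<Sigma>\<close> statements about \<open>A\<close> are decided by finite parts of \<open>A'\<close>, and iterating, the
  statements about \<open>A = A\<^sub>0\<close> with \<open>n\<close> quantifiers are decided by finite parts of \<open>A\<^sub>n\<close>. That \<open>A\<close> comes
  from a point \<open>A'\<close> is a \<open>\<Pi>\<^sup>0\<^sub>2\<close> condition; it becomes \<open>\<Pi>\<^sup>0\<^sub>1\<close> because the second components of the
  entries of \<open>A\<close> are required to be least witnesses for it. These witnesses are computable from the first
  components, so they cost nothing in the forcing. The tower of all levels \<open>A\<^sub>0, A\<^sub>1, \<dots>\<close> is verified by
  the same \<open>\<Pi>\<^sup>0\<^sub>1\<close> condition at each level, relative to the decision table of that level, so no
  fixed point of indices is needed: the condition is defined by recursion on finite strings.

  Each level carries one bit. Level \<open>m\<close> with bit 1 stops the tower. This leaves countably many points: one point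
  \<open>Z\<close> with all bits 0, and one point \<open>Z\<^sub>m\<close> for every \<open>m\<close>. Since \<open>Z\<close> and \<open>Z\<^sub>m\<close> agree on a long
  part of level \<open>n\<close> when \<open>m\<close> is large, every arithmetical set containing \<open>Z\<close> contains some \<open>Z\<^sub>m\<close>.
\<close>

section \<open>Legitimate strings and the next decision table\<close>

text \<open>The table one level up is only a limit of approximations computed from the table below,
  and one test has to serve all levels. So the test takes the table as an argument, and entry k of a
  string is checked against the approximation at a stage h that is written in the string itself.
  This makes the recursion well founded: the hits consulted have codes below h, and both h and the
  code of the string passed to the next level are below the code of the string under test.

  Checking at one stage could accept a string that only a wrong approximation supports. The demand h
  \<ge> k repairs this: along an infinite sequence every finite part is tested again at arbitrarily
  late stages, when the approximation has settled on it.

  A search for hits ranges over strings of pairs, while a stem copies first components only. Nothing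
  is lost, because minimality of h beyond k makes the second components a function of the first
  ones; a forcing string copied into the stem of a point is therefore an initial part of that
  point.\<close>

lemma prod_encode_mono: "x \<le> x' \<Longrightarrow> y \<le> y' \<Longrightarrow> prod_encode (x, y) \<le> prod_encode (x', y')"
proof -
  assume a: "x \<le> x'" "y \<le> y'"
  have "mono triangle" by (rule mono_iff_le_Suc[THEN iffD2]) simp
  then have "triangle (x + y) \<le> triangle (x' + y')" using a by (simp add: monoD)
  then show ?thesis using a by (simp add: prod_encode_def)
qed

lemma fst_prod_decode_le: "fst (prod_decode z) \<le> z"
  by (metis le_prod_encode_1 prod.collapse prod_decode_inverse)

lemma snd_prod_decode_le: "snd (prod_decode z) \<le> z"
  by (metis le_prod_encode_2 prod.collapse prod_decode_inverse)

text \<open>Subsequences, not just prefixes, are needed since the values inside a stem are separated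
  by the forcing strings.\<close>

lemma list_encode_subseq: "subseq xs ys \<Longrightarrow> list_encode xs \<le> list_encode ys"
proof (induction rule: list_emb.induct)
  case (list_emb_Cons xs ys y)
  then show ?case using le_prod_encode_2[of "list_encode ys" y] by simp
qed (auto intro: prod_encode_mono)

lemma list_encode_all2: "list_all2 (\<le>) xs ys \<Longrightarrow> list_encode xs \<le> list_encode ys"
  by (induction rule: list_all2_induct) (auto intro: prod_encode_mono)

lemma nth_less_list_encode: "i < length xs \<Longrightarrow> xs ! i < list_encode xs"
proof (induction xs arbitrary: i)
  case (Cons x xs)
  have *: "xs ! j \<le> prod_encode (x, list_encode xs)" if "j < length xs" for j
    using Cons.IH[OF that] le_prod_encode_2[of "list_encode xs" x] by linarith
  show ?case
    using Cons.prems * le_prod_encode_1[of x "list_encode xs"] by (cases i) (auto simp: less_Suc_eq_le)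
qed simp

lemma length_le_list_encode: "length xs \<le> list_encode xs"
proof (induction xs)
  case (Cons x xs)
  then show ?case using le_prod_encode_2[of "list_encode xs" x] by simp
qed simp

lemma list_encode_tl_less: "xs \<noteq> [] \<Longrightarrow> list_encode (tl xs) < list_encode xs"
  by (cases xs) (auto simp: less_Suc_eq_le le_prod_encode_2)

text \<open>With the default 0 a finite list can stand for an infinite sequence of values and for a
  decision table.\<close>

definition nth0 :: "nat list \<Rightarrow> nat \<Rightarrow> nat" where
  "nth0 xs i = (if i < length xs then xs ! i else 0)"

definition fsts :: "nat list \<Rightarrow> nat list" where
  "fsts xs = map (\<lambda>z. fst (prod_decode z)) xs"

lemma list_encode_fsts: "list_encode (fsts xs) \<le> list_encode xs"
  by (rule list_encode_all2) (auto simp: fsts_def list_all2_conv_all_nth fst_prod_decode_le)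

lemma length_fsts [simp]: "length (fsts xs) = length xs"
  by (simp add: fsts_def)

text \<open>
  A decision table \<open>D\<close> maps the code of a pair \<open>(\<alpha>, c)\<close> to 1, 0 or 2 if the string \<open>\<alpha>\<close> forces
  \<open>\<phi>\<^sub>c\<close>, forces \<open>\<not> \<phi>\<^sub>c\<close>, or does neither; \<open>\<phi>\<^sub>c\<close> on the next level is \<open>\<exists>i. \<not> \<phi>\<^sub>d\<close> where \<open>d\<close> codes
  the list \<open>i # c\<close>. The entries of \<open>\<alpha>\<close> code pairs; the first components carry the information and the
  second ones are the least witnesses. The search for forcing strings is restricted to a set \<open>S\<close>, which
  is \<open>{..<j}\<close> at stage \<open>j\<close> of an approximation and \<open>UNIV\<close> in the limit. The parameter \<open>L\<close> will be
  \<open>legit\<close>, which is defined from these notions by recursion.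
\<close>

definition hit :: "((nat \<Rightarrow> nat) \<Rightarrow> nat \<Rightarrow> bool) \<Rightarrow> (nat \<Rightarrow> nat) \<Rightarrow> nat list \<Rightarrow> nat \<Rightarrow> nat \<Rightarrow> bool" where
  "hit L D \<rho> c y \<longleftrightarrow>
     snd (prod_decode y) \<noteq> 0 \<and> snd (prod_decode (snd (prod_decode y) - 1)) = c \<and>
     prefix \<rho> (fsts (list_decode (fst (prod_decode y)))) \<and> D y = 0 \<and> L D (fst (prod_decode y))"

definition extend_to_hit :: "((nat \<Rightarrow> nat) \<Rightarrow> nat \<Rightarrow> bool) \<Rightarrow> (nat \<Rightarrow> nat) \<Rightarrow> nat set \<Rightarrow> nat list \<Rightarrow> nat \<Rightarrow> nat list" where
  "extend_to_hit L D S \<rho> c =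
     (if \<exists>y\<in>S. hit L D \<rho> c y
      then fsts (list_decode (fst (prod_decode (LEAST y. y \<in> S \<and> hit L D \<rho> c y)))) else \<rho>)"

text \<open>The \<open>n\<close>-th block consists of the value \<open>a n\<close> and of the string forcing \<open>\<phi>\<^sub>n\<close> on the next level.\<close>

primrec stem :: "((nat \<Rightarrow> nat) \<Rightarrow> nat \<Rightarrow> bool) \<Rightarrow> (nat \<Rightarrow> nat) \<Rightarrow> nat set \<Rightarrow> (nat \<Rightarrow> nat) \<Rightarrow> nat \<Rightarrow> nat list" where
  "stem L D S a 0 = []"
| "stem L D S a (Suc n) = extend_to_hit L D S (stem L D S a n @ [a n]) n"

text \<open>The 0 put in front is the bit of the lower level, which must be 0 if there is a level
  above. Statement c is decided as soon as value number c is known: then either block c runs through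
  a hit, or no extension of the stem hits at all.\<close>

definition next_table :: "((nat \<Rightarrow> nat) \<Rightarrow> nat \<Rightarrow> bool) \<Rightarrow> (nat \<Rightarrow> nat) \<Rightarrow> nat set \<Rightarrow> nat \<Rightarrow> nat" where
  "next_table L D S y =
     (let as = 0 # list_decode (fst (prod_decode y)); c = snd (prod_decode y) in
      if c < length as
      then of_bool (\<exists>z\<in>S. hit L D (stem L D S (nth0 as) c @ [nth0 as c]) c z) else 2)"

text \<open>The first value \<open>a 0\<close> is the bit of the level, the others form a string one level up.\<close>

definition consistent :: "((nat \<Rightarrow> nat) \<Rightarrow> nat \<Rightarrow> bool) \<Rightarrow> (nat \<Rightarrow> nat) \<Rightarrow> nat set \<Rightarrow> nat list \<Rightarrow> bool" where
  "consistent L D S \<gamma> \<longleftrightarrow>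
     (\<exists>z\<le>list_encode \<gamma>. let as = list_decode z in as \<noteq> [] \<and>
        length (stem L D S (nth0 as) (length as - 1)) < length \<gamma> \<and>
        prefix \<gamma> (stem L D S (nth0 as) (length as)) \<and>
        (nth0 as 0 = 0 \<and> L (next_table L D S) (list_encode (tl as)) \<or>
         nth0 as 0 = 1 \<and> (\<forall>i<length as. 0 < i \<longrightarrow> nth0 as i = 0)))"

definition legit_step :: "((nat \<Rightarrow> nat) \<Rightarrow> nat \<Rightarrow> bool) \<Rightarrow> (nat \<Rightarrow> nat) \<Rightarrow> nat \<Rightarrow> bool" where
  "legit_step L D a \<longleftrightarrow>
     (let \<alpha> = list_decode a in \<forall>k<length \<alpha>.
        let \<gamma> = take (Suc k) (fsts \<alpha>); h = snd (prod_decode (nth0 \<alpha> k)) in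
        k \<le> h \<and> consistent L D {..<h} \<gamma> \<and> (\<forall>j<h. k \<le> j \<longrightarrow> \<not> consistent L D {..<j} \<gamma>))"

text \<open>Recursive calls change the table together with the code, and they occur inside the
  higher-order argument \<open>L\<close>; a bound on the depth avoids a recursion on pairs. Every
  call decreases the code, so \<open>Suc a\<close> is enough fuel for \<open>a\<close>.\<close>

primrec legit_fuel :: "nat \<Rightarrow> (nat \<Rightarrow> nat) \<Rightarrow> nat \<Rightarrow> bool" where
  "legit_fuel 0 = (\<lambda>D a. False)"
| "legit_fuel (Suc n) = (\<lambda>D a. legit_step (legit_fuel n) D a)"

definition legit :: "(nat \<Rightarrow> nat) \<Rightarrow> nat \<Rightarrow> bool" where
  "legit D a = legit_fuel (Suc a) D a"

section \<open>Locality of the recursive calls\<close>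

lemma extend_to_hit_cong:
  assumes "\<And>y. y \<in> S \<Longrightarrow> hit L D \<rho> c y = hit L' D' \<rho> c y"
  shows "extend_to_hit L D S \<rho> c = extend_to_hit L' D' S \<rho> c"
proof -
  have 1: "(\<lambda>y. y \<in> S \<and> hit L D \<rho> c y) = (\<lambda>y. y \<in> S \<and> hit L' D' \<rho> c y)"
    using assms by blast
  have 2: "(\<exists>y\<in>S. hit L D \<rho> c y) = (\<exists>y\<in>S. hit L' D' \<rho> c y)"
    using assms by blast
  show ?thesis by (simp only: extend_to_hit_def 1 2)
qed

lemma stem_cong:
  assumes "\<And>\<rho> c y. y \<in> S \<Longrightarrow> hit L D \<rho> c y = hit L' D' \<rho> c y"
    and "\<And>i. i < n \<Longrightarrow> a i = a' i"
  shows "stem L D S a n = stem L' D' S a' n"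
  using assms(2)
proof (induction n)
  case (Suc n)
  then show ?case by simp (rule extend_to_hit_cong, rule assms(1))
qed simp

lemma next_table_cong:
  assumes "\<And>\<rho> c y. y \<in> S \<Longrightarrow> hit L D \<rho> c y = hit L' D' \<rho> c y"
  shows "next_table L D S = next_table L' D' S"
proof
  fix y
  have *: "stem L D S a n = stem L' D' S a n" for a n
    by (rule stem_cong) (rule assms, assumption, rule refl)
  show "next_table L D S y = next_table L' D' S y"
    unfolding next_table_def Let_def * using assms by auto
qed

lemma consistent_cong:
  assumes "\<And>\<rho> c y. y \<in> S \<Longrightarrow> hit L D \<rho> c y = hit L' D' \<rho> c y"
    and "\<And>a. a < list_encode \<gamma> \<Longrightarrow> L (next_table L D S) a = L' (next_table L' D' S) a"
  shows "consistent L D S \<gamma> = consistent L' D' S \<gamma>"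
proof -
  have *: "stem L D S a n = stem L' D' S a n" for a n
    by (rule stem_cong) (rule assms, assumption, rule refl)
  have **: "L (next_table L D S) (list_encode (tl as)) = L' (next_table L' D' S) (list_encode (tl as))"
    if "as \<noteq> []" "list_encode as \<le> list_encode \<gamma>" for as
    using list_encode_tl_less[of as] that by (intro assms(2)) auto
  have "L (next_table L D S) (list_encode (tl (list_decode z))) = L' (next_table L' D' S) (list_encode (tl (list_decode z)))"
    if "list_decode z \<noteq> []" "z \<le> list_encode \<gamma>" for z
    using **[of "list_decode z"] that by simp
  then show ?thesis
    unfolding consistent_def Let_def * by blast
qed

text \<open>There are two kinds of calls: at the same table, for the strings inside hits, and at the
  approximated next table, for the string one level up. One statement covers independence of fuel,
  dependence on a finite part of the table, and the replacement of the calls by table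
  lookup.\<close>

lemma legit_step_cong:
  assumes "\<And>y. y < a \<Longrightarrow> D y = D' y" "\<And>y. y < a \<Longrightarrow> L D y = L' D' y"
    and "\<And>j a'. j \<le> a \<Longrightarrow> a' < a \<Longrightarrow> next_table L D {..<j} = next_table L' D' {..<j} \<Longrightarrow>
       L (next_table L D {..<j}) a' = L' (next_table L' D' {..<j}) a'"
  shows "legit_step L D a = legit_step L' D' a"
proof -
  have hit: "hit L D \<rho> c y = hit L' D' \<rho> c y" if "y \<in> {..<j}" "j \<le> a" for j \<rho> c y
    unfolding hit_def using that assms(1,2)
    by (metis fst_prod_decode_le le_less_trans lessThan_iff order_less_le_trans)
  define \<alpha> where "\<alpha> = list_decode a"
  have a: "a = list_encode \<alpha>" by (simp add: \<alpha>_def)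
  have consistent: "consistent L D {..<j} (take (Suc k) (fsts \<alpha>)) = consistent L' D' {..<j} (take (Suc k) (fsts \<alpha>))"
    if "j \<le> a" for j k
  proof (rule consistent_cong)
    fix a' assume "a' < list_encode (take (Suc k) (fsts \<alpha>))"
    also have "\<dots> \<le> list_encode (fsts \<alpha>)"
      by (rule list_encode_subseq) (simp add: prefix_imp_subseq take_is_prefix)
    also have "\<dots> \<le> a" unfolding a by (rule list_encode_fsts)
    finally show "L (next_table L D {..<j}) a' = L' (next_table L' D' {..<j}) a'"
      using that hit by (intro assms(3) next_table_cong) auto
  qed (use hit that in auto)
  \<comment> \<open>Being an entry component of the coded string keeps every tested stage below
    \<open>a\<close>.\<close>
  have h: "snd (prod_decode (nth0 \<alpha> k)) < a" if "k < length \<alpha>" for k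
    using nth_less_list_encode[OF that] snd_prod_decode_le[of "\<alpha> ! k"] that by (simp add: a nth0_def)
  show ?thesis
    unfolding legit_step_def Let_def \<alpha>_def[symmetric]
  proof (intro all_cong imp_cong refl)
    fix k assume "k < length \<alpha>"
    from h[OF this] show "(k \<le> snd (prod_decode (nth0 \<alpha> k)) \<and>
             consistent L D {..<snd (prod_decode (nth0 \<alpha> k))} (take (Suc k) (fsts \<alpha>)) \<and>
             (\<forall>j<snd (prod_decode (nth0 \<alpha> k)). k \<le> j \<longrightarrow> \<not> consistent L D {..<j} (take (Suc k) (fsts \<alpha>)))) =
         (k \<le> snd (prod_decode (nth0 \<alpha> k)) \<and>
             consistent L' D' {..<snd (prod_decode (nth0 \<alpha> k))} (take (Suc k) (fsts \<alpha>)) \<and>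
             (\<forall>j<snd (prod_decode (nth0 \<alpha> k)). k \<le> j \<longrightarrow> \<not> consistent L' D' {..<j} (take (Suc k) (fsts \<alpha>))))"
      using consistent by auto
  qed
qed

lemma legit_fuel_stable: "a < n \<Longrightarrow> a < m \<Longrightarrow> legit_fuel n D a = legit_fuel m D a"
proof (induction a arbitrary: n m D rule: less_induct)
  case (less a)
  define n' m' where "n' = n - 1" and "m' = m - 1"
  have nm: "n = Suc n'" "m = Suc m'"
    using less.prems by (simp_all add: n'_def m'_def)
  have "legit_step (legit_fuel n') D a = legit_step (legit_fuel m') D a"
  proof (rule legit_step_cong)
    show "legit_fuel n' D y = legit_fuel m' D y" if "y < a" for y
      by (rule less.IH[OF that]) (use that less.prems nm in auto)
    show "legit_fuel n' (next_table (legit_fuel n') D {..<j}) a' = legit_fuel m' (next_table (legit_fuel m') D {..<j}) a'"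
      if "a' < a" "next_table (legit_fuel n') D {..<j} = next_table (legit_fuel m') D {..<j}" for j a'
      unfolding that(2) by (rule less.IH[OF that(1)]) (use that less.prems nm in auto)
  qed simp
  then show ?case by (simp add: nm)
qed

lemma legit_legit_step: "legit D a = legit_step legit D a"
proof -
  have "legit D a = legit_step (legit_fuel a) D a" by (simp add: legit_def)
  also have "\<dots> = legit_step legit D a"
    by (rule legit_step_cong) (auto simp: legit_def simp del: legit_fuel.simps intro!: legit_fuel_stable)
  finally show ?thesis .
qed

text \<open>This use principle yields both the convergence of the approximations and the coding of
  the relevant part of the table by a number.\<close>

lemma legit_cong: "(\<And>y. y < a \<Longrightarrow> D y = D' y) \<Longrightarrow> legit D a = legit D' a"
proof (induction a arbitrary: D D' rule: less_induct)
  case (less a)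
  have "legit_step legit D a = legit_step legit D' a"
  proof (rule legit_step_cong)
    show "legit D y = legit D' y" if "y < a" for y
      by (rule less.IH[OF that]) (use that less.prems in auto)
  qed (use less.prems in simp_all)
  then show ?case by (simp add: legit_legit_step[symmetric])
qed


section \<open>Stems and the values coded in them\<close>

lemma extend_to_hit_cases:
  obtains "\<forall>y\<in>S. \<not> hit L D \<rho> c y" "extend_to_hit L D S \<rho> c = \<rho>"
  | z where "z \<in> S" "hit L D \<rho> c z" "extend_to_hit L D S \<rho> c = fsts (list_decode (fst (prod_decode z)))"
proof (cases "\<exists>y\<in>S. hit L D \<rho> c y")
  case True
  then have "\<exists>y. y \<in> S \<and> hit L D \<rho> c y" by auto
  from LeastI_ex[OF this] show ?thesis using True by (intro that(2)) (auto simp: extend_to_hit_def)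
next
  case False
  then show ?thesis by (intro that(1)) (auto simp: extend_to_hit_def)
qed

lemma prefix_extend_to_hit: "prefix \<rho> (extend_to_hit L D S \<rho> c)"
  by (rule extend_to_hit_cases[where S=S and L=L and D=D and \<rho>=\<rho> and c=c]) (auto simp: hit_def)

lemma prefix_stem_Suc: "prefix (stem L D S a n @ [a n]) (stem L D S a (Suc n))"
  by (simp add: prefix_extend_to_hit)

lemma prefix_stem: "n \<le> m \<Longrightarrow> prefix (stem L D S a n) (stem L D S a m)"
proof (induction m rule: dec_induct)
  case (step m)
  then show ?case
    using prefix_stem_Suc[of L D S a m] by (meson append_prefixD prefix_order.order_trans)
qed simp

text \<open>The position of value n is the length of the stem of the first n blocks, so the values
  can be read off one after the other.\<close>

lemma stem_nth:
  assumes "n < m"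
  shows "length (stem L D S a n) < length (stem L D S a m)" "stem L D S a m ! length (stem L D S a n) = a n"
proof -
  have "prefix (stem L D S a n @ [a n]) (stem L D S a m)"
    using prefix_stem_Suc[of L D S a n] prefix_stem[of "Suc n" m L D S a] assms
    by (meson Suc_leI prefix_order.order_trans)
  then obtain zs where "stem L D S a m = stem L D S a n @ [a n] @ zs" by (auto simp: prefix_def)
  then show "length (stem L D S a n) < length (stem L D S a m)" "stem L D S a m ! length (stem L D S a n) = a n"
    by auto
qed

lemma length_stem: "n \<le> length (stem L D S a n)"
proof (induction n)
  case (Suc n)
  then show ?case using stem_nth(1)[of n "Suc n" L D S a] by simp
qed simp

lemma stem_nth_prefix: "i < length (stem L D S a n) \<Longrightarrow> n \<le> m \<Longrightarrow> stem L D S a m ! i = stem L D S a n ! i"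
  using prefix_stem[of n m L D S a] by (auto simp: prefix_def nth_append)

lemma subseq_stem: "subseq (map a [0..<n]) (stem L D S a n)"
proof (induction n)
  case (Suc n)
  have "subseq (map a [0..<n] @ [a n]) (stem L D S a n @ [a n])"
    using Suc by (simp add: list_emb_append_mono)
  also have "subseq \<dots> (stem L D S a (Suc n))"
    using prefix_stem_Suc by (rule prefix_imp_subseq)
  finally show ?case by simp
qed simp

text \<open>The blocks of \<open>\<gamma>\<close> can be read off inside \<open>\<gamma>\<close>, hence the bound in the definition of \<open>consistent\<close> is harmless.\<close>

lemma list_encode_blocks:
  assumes "0 < m" "length (stem L D S a (m - 1)) < length \<gamma>" "prefix \<gamma> (stem L D S a m)"
  shows "list_encode (map a [0..<m]) \<le> list_encode \<gamma>"
proof -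
  obtain n where m: "m = Suc n" using assms(1) by (cases m) auto
  have "prefix (stem L D S a n @ [a n]) \<gamma>"
    using prefix_stem_Suc[of L D S a n] assms(2,3) by (auto simp: m intro: prefix_length_prefix)
  moreover have "subseq (map a [0..<m]) (stem L D S a n @ [a n])"
    using subseq_stem[of a n L D S] by (simp add: m list_emb_append_mono)
  ultimately show ?thesis
    by (intro list_encode_subseq) (meson prefix_imp_subseq subseq_order.order_trans)
qed

definition admissible :: "(nat \<Rightarrow> nat) \<Rightarrow> (nat \<Rightarrow> nat) \<Rightarrow> nat \<Rightarrow> bool" where
  "admissible D a m \<longleftrightarrow>
     a 0 = 0 \<and> legit D (list_encode (map (\<lambda>i. a (Suc i)) [0..<m])) \<or> a 0 = 1 \<and> (\<forall>i<m. a (Suc i) = 0)"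

lemma nth0_map_upt: "i < m \<Longrightarrow> nth0 (map a [0..<m]) i = a i"
  by (simp add: nth0_def)

text \<open>The coded list with its bound serves decidability and convergence. For arguments about
  points an infinite sequence \<open>a\<close> and the number \<open>m\<close> of the last block met
  by \<open>\<gamma>\<close> are handier.\<close>

lemma consistent_iff:
  "consistent legit D S \<gamma> \<longleftrightarrow>
     (\<exists>a m. length (stem legit D S a m) < length \<gamma> \<and> prefix \<gamma> (stem legit D S a (Suc m)) \<and>
        admissible (next_table legit D S) a m)"
    (is "?l \<longleftrightarrow> ?r")
proof
  assume ?l
  then obtain z where z: "list_decode z \<noteq> []"
    "length (stem legit D S (nth0 (list_decode z)) (length (list_decode z) - 1)) < length \<gamma>"
    "prefix \<gamma> (stem legit D S (nth0 (list_decode z)) (length (list_decode z)))"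
    "nth0 (list_decode z) 0 = 0 \<and> legit (next_table legit D S) (list_encode (tl (list_decode z))) \<or>
         nth0 (list_decode z) 0 = 1 \<and> (\<forall>i<length (list_decode z). 0 < i \<longrightarrow> nth0 (list_decode z) i = 0)"
    unfolding consistent_def Let_def by blast
  define as where "as = list_decode z"
  obtain m where m: "length as = Suc m" using z(1) by (cases as) (auto simp: as_def)
  have "tl as = map (\<lambda>i. nth0 as (Suc i)) [0..<m]"
    by (rule nth_equalityI) (auto simp: m nth_tl nth0_def)
  then have "admissible (next_table legit D S) (nth0 as) m"
    using z(4) unfolding as_def[symmetric] by (auto simp: admissible_def m)
  then show ?r using z(2,3) unfolding as_def[symmetric] m by auto
next
  assume ?r
  then obtain a m where r: "length (stem legit D S a m) < length \<gamma>" "prefix \<gamma> (stem legit D S a (Suc m))"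
    "admissible (next_table legit D S) a m" by blast
  define as where "as = map a [0..<Suc m]"
  have le: "list_encode as \<le> list_encode \<gamma>"
    unfolding as_def by (rule list_encode_blocks) (use r in auto)
  have stem: "stem legit D S (nth0 as) k = stem legit D S a k" if "k \<le> Suc m" for k
    by (rule stem_cong) (use that in \<open>auto simp: as_def nth0_map_upt simp del: upt_Suc\<close>)
  have tl: "tl as = map (\<lambda>i. a (Suc i)) [0..<m]"
    by (rule nth_equalityI) (auto simp: as_def nth_tl simp del: upt_Suc)
  have len: "length as = Suc m" "as \<noteq> []" by (auto simp: as_def)
  have nth: "nth0 as i = a i" if "i < Suc m" for i
    using that by (simp add: as_def nth0_map_upt del: upt_Suc)
  have "nth0 as 0 = 0 \<and> legit (next_table legit D S) (list_encode (tl as)) \<or>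
         nth0 as 0 = 1 \<and> (\<forall>i<length as. 0 < i \<longrightarrow> nth0 as i = 0)"
    using r(3) unfolding admissible_def tl len
    by (auto simp: nth gr0_conv_Suc simp del: One_nat_def)
  then show ?l
    unfolding consistent_def Let_def
    using le r(1,2) len stem[of m] stem[of "Suc m"] by (intro exI[of _ "list_encode as"]) auto
qed

definition first_consistent :: "(nat \<Rightarrow> nat) \<Rightarrow> nat \<Rightarrow> nat list \<Rightarrow> nat \<Rightarrow> bool" where
  "first_consistent D k \<gamma> h \<longleftrightarrow>
     k \<le> h \<and> consistent legit D {..<h} \<gamma> \<and> (\<forall>j<h. k \<le> j \<longrightarrow> \<not> consistent legit D {..<j} \<gamma>)"

lemma legit_iff:
  "legit D (list_encode \<alpha>) \<longleftrightarrow>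
     (\<forall>k<length \<alpha>. first_consistent D k (take (Suc k) (fsts \<alpha>)) (snd (prod_decode (\<alpha> ! k))))"
  by (subst legit_legit_step) (simp add: legit_step_def nth0_def Let_def first_consistent_def)

lemma first_consistent_unique: "first_consistent D k \<gamma> h \<Longrightarrow> first_consistent D k \<gamma> h' \<Longrightarrow> h = h'"
  unfolding first_consistent_def by (meson linorder_neqE_nat)

lemma legit_prefix:
  assumes "prefix \<alpha> \<beta>" "legit D (list_encode \<beta>)"
  shows "legit D (list_encode \<alpha>)"
proof -
  obtain zs where \<beta>: "\<beta> = \<alpha> @ zs" using assms(1) by (auto simp: prefix_def)
  have "take (Suc k) (fsts \<beta>) = take (Suc k) (fsts \<alpha>)" "\<beta> ! k = \<alpha> ! k" if "k < length \<alpha>" for k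
    using that by (auto simp: \<beta> fsts_def nth_append)
  moreover have "length \<alpha> \<le> length \<beta>" by (simp add: \<beta>)
  ultimately show ?thesis
    using assms(2) unfolding legit_iff by (metis order_less_le_trans)
qed

lemma admissible_mono: "m \<le> n \<Longrightarrow> admissible D a n \<Longrightarrow> admissible D a m"
proof -
  assume mn: "m \<le> n" and "admissible D a n"
  moreover have "prefix (map f [0..<m]) (map f [0..<n])" for f :: "nat \<Rightarrow> nat"
    using mn by (metis append_Nil le_Suc_ex map_mono_prefix prefixI upt_add_eq_append zero_le)
  ultimately show ?thesis unfolding admissible_def by (auto intro: legit_prefix)
qed

lemma consistent_prefix:
  assumes "consistent legit D S \<gamma>" "prefix \<delta> \<gamma>" "\<delta> \<noteq> []"
  shows "consistent legit D S \<delta>"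
proof -
  obtain a m where r: "length (stem legit D S a m) < length \<gamma>" "prefix \<gamma> (stem legit D S a (Suc m))"
    "admissible (next_table legit D S) a m" using assms(1) by (auto simp: consistent_iff)
  \<comment> \<open>The last block that meets \<open>\<delta>\<close> has number k - 1.\<close>
  define k where "k = (LEAST k. length \<delta> \<le> length (stem legit D S a k))"
  have "length \<delta> \<le> length (stem legit D S a (Suc m))"
    using assms(2) r(2) by (meson prefix_length_le prefix_order.order_trans)
  then have k: "length \<delta> \<le> length (stem legit D S a k)" "k \<le> Suc m"
    unfolding k_def by (rule LeastI, rule Least_le)
  have "k \<noteq> 0" using k(1) assms(3) by (intro notI) simp
  then obtain k' where k': "k = Suc k'" by (cases k) auto
  have "\<not> length \<delta> \<le> length (stem legit D S a k')"
    using not_less_Least[of k' "\<lambda>k. length \<delta> \<le> length (stem legit D S a k)"] k' by (simp add: k_def)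
  moreover have "prefix \<delta> (stem legit D S a k)"
    using assms(2) r(2) k prefix_stem[of k "Suc m"] by (meson prefix_length_prefix prefix_order.order_trans)
  moreover have "admissible (next_table legit D S) a k'"
    using r(3) k(2) k' by (auto intro: admissible_mono)
  ultimately show ?thesis unfolding consistent_iff using k' by (auto simp: not_le)
qed

section \<open>Convergence of the approximations\<close>

lemma eventually_extend_to_hit: "\<forall>\<^sub>F j in at_top. extend_to_hit legit D {..<j} \<rho> c = extend_to_hit legit D UNIV \<rho> c"
proof (cases "\<exists>y. hit legit D \<rho> c y")
  case True
  define y0 where "y0 = (LEAST y. hit legit D \<rho> c y)"
  have y0: "hit legit D \<rho> c y0" unfolding y0_def using True by (rule LeastI_ex)
  show ?thesis
  proof (rule eventually_at_top_linorderI[of "Suc y0"])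
    fix j assume "Suc y0 \<le> j"
    then have "(LEAST y. y \<in> {..<j} \<and> hit legit D \<rho> c y) = y0"
      using y0 by (intro Least_equality) (auto simp: y0_def intro: Least_le)
    then show "extend_to_hit legit D {..<j} \<rho> c = extend_to_hit legit D UNIV \<rho> c"
      using y0 \<open>Suc y0 \<le> j\<close> by (auto simp: extend_to_hit_def y0_def[symmetric])
  qed
qed (simp add: extend_to_hit_def)

lemma eventually_hit: "\<forall>\<^sub>F j in at_top. (\<exists>y\<in>{..<j}. hit legit D \<rho> c y) = (\<exists>y. hit legit D \<rho> c y)"
proof (cases "\<exists>y. hit legit D \<rho> c y")
  case True
  then obtain y where "hit legit D \<rho> c y" by auto
  then show ?thesis by (intro eventually_at_top_linorderI[of "Suc y"]) auto
qed simp

lemma eventually_stem: "\<forall>\<^sub>F j in at_top. stem legit D {..<j} a n = stem legit D UNIV a n"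
proof (induction n)
  case (Suc n)
  from Suc eventually_extend_to_hit[of D "stem legit D UNIV a n @ [a n]" n] show ?case
    by eventually_elim simp
qed simp

lemma eventually_next_table: "\<forall>\<^sub>F j in at_top. next_table legit D {..<j} y = next_table legit D UNIV y"
proof -
  define as where "as = 0 # list_decode (fst (prod_decode y))"
  define c where "c = snd (prod_decode y)"
  from eventually_stem[of D "nth0 as" c]
    eventually_hit[of D "stem legit D UNIV (nth0 as) c @ [nth0 as c]" c] show ?thesis
    unfolding next_table_def Let_def as_def[symmetric] c_def[symmetric] by eventually_elim simp
qed

text \<open>By \<open>legit_cong\<close> only the finitely many table entries below \<open>a\<close>
  have to settle.\<close>

lemma eventually_legit_next_table:
  "\<forall>\<^sub>F j in at_top. legit (next_table legit D {..<j}) a = legit (next_table legit D UNIV) a"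
proof -
  have "\<forall>\<^sub>F j in at_top. \<forall>y\<in>{..<a}. next_table legit D {..<j} y = next_table legit D UNIV y"
    by (rule eventually_ball_finite) (auto intro: eventually_next_table)
  then show ?thesis by eventually_elim (rule legit_cong, simp)
qed

text \<open>The bound on \<open>z\<close> in \<open>consistent\<close> leaves finitely many
  candidates, so a common stage exists beyond which none of them changes.\<close>

lemma eventually_consistent: "\<forall>\<^sub>F j in at_top. consistent legit D {..<j} \<gamma> = consistent legit D UNIV \<gamma>"
proof -
  define Q where "Q j z \<longleftrightarrow>
      (let as = list_decode z in
       stem legit D {..<j} (nth0 as) (length as - 1) = stem legit D UNIV (nth0 as) (length as - 1) \<and>
       stem legit D {..<j} (nth0 as) (length as) = stem legit D UNIV (nth0 as) (length as) \<and>
       legit (next_table legit D {..<j}) (list_encode (tl as)) = legit (next_table legit D UNIV) (list_encode (tl as)))"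
    for j z
  have "\<forall>\<^sub>F j in at_top. Q j z" for z
    unfolding Q_def Let_def
    by (intro eventually_conj eventually_stem eventually_legit_next_table)
  then have "\<forall>\<^sub>F j in at_top. \<forall>z\<in>{..list_encode \<gamma>}. Q j z"
    by (intro eventually_ball_finite) auto
  then show ?thesis
    by eventually_elim (auto simp: consistent_def Q_def Let_def)
qed

lemma first_consistent_LEAST:
  assumes "consistent legit D UNIV \<gamma>"
  shows "first_consistent D k \<gamma> (LEAST j. k \<le> j \<and> consistent legit D {..<j} \<gamma>)"
proof -
  from eventually_consistent[of D \<gamma>] have "\<forall>\<^sub>F j in at_top. consistent legit D {..<j} \<gamma>"
    using assms by simp
  then obtain N where "\<And>j. N \<le> j \<Longrightarrow> consistent legit D {..<j} \<gamma>"
    by (auto simp: eventually_at_top_linorder)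
  then have "k \<le> max k N \<and> consistent legit D {..<max k N} \<gamma>" by simp
  from LeastI[of "\<lambda>j. k \<le> j \<and> consistent legit D {..<j} \<gamma>", OF this] show ?thesis
    unfolding first_consistent_def by (auto dest: not_less_Least)
qed

section \<open>Points, towers and the forcing argument\<close>

definition heads :: "(nat \<Rightarrow> nat) \<Rightarrow> nat \<Rightarrow> nat list" where
  "heads A n = map (\<lambda>i. fst (prod_decode (A i))) [0..<n]"

text \<open>The infinite paths through the tree of legit strings.\<close>

definition points :: "(nat \<Rightarrow> nat) \<Rightarrow> (nat \<Rightarrow> nat) set" where
  "points D = {A. \<forall>n. legit D (list_encode (map A [0..<n]))}"

abbreviation limit_stem :: "(nat \<Rightarrow> nat) \<Rightarrow> (nat \<Rightarrow> nat) \<Rightarrow> nat \<Rightarrow> nat list" where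
  "limit_stem D \<equiv> stem legit D UNIV"

abbreviation next_level :: "(nat \<Rightarrow> nat) \<Rightarrow> nat \<Rightarrow> nat" where
  "next_level D \<equiv> next_table legit D UNIV"

lemma take_heads: "n \<le> m \<Longrightarrow> take n (heads A m) = heads A n"
  by (simp add: heads_def take_map)

lemma length_heads [simp]: "length (heads A n) = n"
  by (simp add: heads_def)

lemma nth_heads [simp]: "i < n \<Longrightarrow> heads A n ! i = fst (prod_decode (A i))"
  by (simp add: heads_def)

lemma prefix_heads: "n \<le> m \<Longrightarrow> prefix (heads A n) (heads A m)"
  by (metis take_heads take_is_prefix)

lemma legit_map:
  "legit D (list_encode (map A [0..<n])) \<longleftrightarrow>
     (\<forall>k<n. first_consistent D k (heads A (Suc k)) (snd (prod_decode (A k))))"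
proof -
  have "fsts (map A [0..<n]) = heads A n" by (simp add: fsts_def heads_def)
  then show ?thesis unfolding legit_iff by (simp add: take_heads)
qed

lemma points_iff: "A \<in> points D \<longleftrightarrow> (\<forall>k. first_consistent D k (heads A (Suc k)) (snd (prod_decode (A k))))"
  unfolding points_def legit_map by auto

lemma admissible_all:
  "(\<forall>k. admissible D a k) \<longleftrightarrow> a 0 = 0 \<and> (\<lambda>i. a (Suc i)) \<in> points D \<or> a 0 = 1 \<and> (\<forall>i. a (Suc i) = 0)"
proof (cases "a 0 = 0")
  case True
  then show ?thesis by (auto simp: admissible_def points_def)
next
  case False
  then have "(\<forall>k. admissible D a k) \<longleftrightarrow> a 0 = 1 \<and> (\<forall>k. \<forall>i<k. a (Suc i) = 0)"
    by (auto simp: admissible_def)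
  then show ?thesis using False by auto
qed

lemma admissible_cong:
  assumes "\<And>i. i \<le> m \<Longrightarrow> b i = a i"
  shows "admissible D b m = admissible D a m"
proof -
  have 1: "map (\<lambda>i. b (Suc i)) [0..<m] = map (\<lambda>i. a (Suc i)) [0..<m]" using assms by simp
  have 2: "(\<forall>i<m. b (Suc i) = 0) = (\<forall>i<m. a (Suc i) = 0)" using assms by simp
  show ?thesis unfolding admissible_def 1 2 using assms[of 0] by simp
qed

section \<open>Realizing and parsing sequences of values\<close>

text \<open>The Friedberg inversion of \<open>a\<close>. Entry k is taken from the stem of k + 1
  blocks, which has at least k + 1 entries as every block contributes its value.\<close>

definition realize :: "(nat \<Rightarrow> nat) \<Rightarrow> (nat \<Rightarrow> nat) \<Rightarrow> nat \<Rightarrow> nat" where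
  "realize D a k = prod_encode (limit_stem D a (Suc k) ! k,
     LEAST j. k \<le> j \<and> consistent legit D {..<j} (take (Suc k) (limit_stem D a (Suc k))))"

lemma limit_stem_nth: "i < length (limit_stem D a n) \<Longrightarrow> limit_stem D a n ! i = fst (prod_decode (realize D a i))"
proof -
  assume i: "i < length (limit_stem D a n)"
  have i': "i < length (limit_stem D a (Suc i))" using length_stem[of "Suc i" legit D UNIV a] by simp
  have "limit_stem D a n ! i = limit_stem D a (Suc i) ! i"
    using stem_nth_prefix[OF i, of "Suc i"] stem_nth_prefix[OF i', of n] by (cases "n \<le> Suc i") auto
  then show ?thesis by (simp add: realize_def)
qed

lemma heads_realize: "n \<le> m \<Longrightarrow> heads (realize D a) n = take n (limit_stem D a m)"
proof (rule nth_equalityI)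
  assume "n \<le> m"
  then have "n \<le> length (limit_stem D a m)" using length_stem[of m legit D UNIV a] by simp
  then show "length (heads (realize D a) n) = length (take n (limit_stem D a m))" by simp
  show "heads (realize D a) n ! i = take n (limit_stem D a m) ! i" if "i < length (heads (realize D a) n)" for i
    using that \<open>n \<le> length _\<close> limit_stem_nth[of i D a m] by simp
qed

text \<open>This finite dependence is what allows \<open>tower\<close> to be defined by recursion on
  the position.\<close>

lemma realize_cong: "(\<And>i. i \<le> k \<Longrightarrow> a i = a' i) \<Longrightarrow> realize D a k = realize D a' k"
proof -
  assume "\<And>i. i \<le> k \<Longrightarrow> a i = a' i"
  then have "limit_stem D a (Suc k) = limit_stem D a' (Suc k)" by (intro stem_cong) auto
  then show ?thesis by (simp only: realize_def)
qed

lemma realize_first_consistent: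
  assumes "admissible (next_level D) a k"
  shows "first_consistent D k (heads (realize D a) (Suc k)) (snd (prod_decode (realize D a k)))"
proof -
  have "consistent legit D UNIV (limit_stem D a (Suc k))"
    unfolding consistent_iff using stem_nth(1)[of k "Suc k" legit D UNIV a] assms by blast
  moreover have "limit_stem D a (Suc k) \<noteq> []" using length_stem[of "Suc k" legit D UNIV a] by auto
  ultimately have "consistent legit D UNIV (take (Suc k) (limit_stem D a (Suc k)))"
    by (rule_tac consistent_prefix) (auto simp: take_is_prefix)
  from first_consistent_LEAST[OF this, of k] show ?thesis
    by (simp only: heads_realize[of "Suc k" "Suc k"] realize_def prod_encode_inverse snd_conv order_refl)
qed

lemma realize_read: "a n = fst (prod_decode (realize D a (length (limit_stem D a n))))"
  using stem_nth[of n "Suc n" legit D UNIV a] limit_stem_nth[of "length (limit_stem D a n)" D a "Suc n"] by simp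

text \<open>The place where value n stands depends on the earlier values only; hence equal points
  give equal values by induction.\<close>

lemma realize_inj: "realize D a = realize D a' \<Longrightarrow> a = a'"
proof -
  assume eq: "realize D a = realize D a'"
  have "a n = a' n" for n
  proof (induction n rule: less_induct)
    case (less n)
    then have "limit_stem D a n = limit_stem D a' n" by (intro stem_cong) auto
    then show ?case using realize_read[of a n D] realize_read[of a' n D] eq by simp
  qed
  then show ?thesis by blast
qed

text \<open>Here k \<le> h is used: a late entry k carries a stage at which the approximation has
  settled on \<open>heads A n\<close>, and consistency passes from the longer string to this
  prefix.\<close>

lemma points_consistent:
  assumes "A \<in> points D" "0 < n"
  shows "consistent legit D UNIV (heads A n)"
proof -
  obtain N where N: "\<And>j. N \<le> j \<Longrightarrow> consistent legit D {..<j} (heads A n) = consistent legit D UNIV (heads A n)"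
    using eventually_consistent[of D "heads A n"] by (auto simp: eventually_at_top_linorder)
  define k where "k = max n N"
  define h where "h = snd (prod_decode (A k))"
  have "first_consistent D k (heads A (Suc k)) h" using assms(1) by (simp add: points_iff h_def)
  then have h: "k \<le> h" "consistent legit D {..<h} (heads A (Suc k))" by (auto simp: first_consistent_def)
  have "consistent legit D {..<h} (heads A n)"
    by (rule consistent_prefix[OF h(2)]) (use assms(2) in \<open>auto simp: k_def heads_def intro: prefix_heads[unfolded heads_def]\<close>)
  then show ?thesis using N[of h] h(1) by (simp add: k_def)
qed

text \<open>The equation is not circular, since the stem of n blocks involves the values below n
  only; the stems are therefore built first.\<close>

lemma parse_exists: "\<exists>a. \<forall>n. a n = G (length (stem L D S a n))"
proof -
  define rs where "rs = rec_nat [] (\<lambda>n \<sigma>. extend_to_hit L D S (\<sigma> @ [G (length \<sigma>)]) n)"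
  define a where "a n = G (length (rs n))" for n
  have "stem L D S a n = rs n" for n
    by (induction n) (auto simp: rs_def a_def)
  then show ?thesis by (intro exI[of _ a]) (simp add: a_def)
qed

text \<open>The values are parsed from \<open>A\<close>. Each finite part of \<open>A\<close> is
  consistent through some sequence \<open>b\<close> of its own, but \<open>b\<close> must carry the
  parsed values, as both are read at the same positions. So admissibility holds for the parsed
  sequence itself. The second components agree with those of \<open>realize\<close> because least
  witnesses are unique.\<close>

lemma points_realize:
  assumes A: "A \<in> points D"
  obtains a where "A = realize D a" "\<forall>k. admissible (next_level D) a k"
proof -
  obtain a where a: "\<And>n. a n = fst (prod_decode (A (length (limit_stem D a n))))"
    using parse_exists[of "\<lambda>i. fst (prod_decode (A i))"] by blast
  have blocks: "\<exists>m. length (limit_stem D a m) < n \<and> prefix (heads A n) (limit_stem D a (Suc m)) \<and> admissible (next_level D) a m"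
    if n0: "0 < n" for n
  proof -
    obtain b m where b: "length (limit_stem D b m) < n" "prefix (heads A n) (limit_stem D b (Suc m))"
      "admissible (next_level D) b m"
      using points_consistent[OF A n0] by (auto simp: consistent_iff)
    have ab: "b i = a i" if "i \<le> m" for i
      using that
    proof (induction i rule: less_induct)
      case (less i)
      then have s: "limit_stem D b i = limit_stem D a i" by (intro stem_cong) auto
      have "length (limit_stem D b i) \<le> length (limit_stem D b m)"
        using prefix_stem[OF less.prems] prefix_length_le by blast
      then have "length (limit_stem D b i) < n" using b(1) by simp
      then have "limit_stem D b (Suc m) ! length (limit_stem D b i) = fst (prod_decode (A (length (limit_stem D b i))))"
        using b(2) by (auto simp: prefix_def nth_append)
      then show ?case using stem_nth(2)[of i "Suc m" legit D UNIV b] less.prems a[of i] s by simp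
    qed
    have "limit_stem D b m = limit_stem D a m" "limit_stem D b (Suc m) = limit_stem D a (Suc m)"
      by (intro stem_cong; use ab in auto)+
    moreover have "admissible (next_level D) a m"
      using b(3) admissible_cong[of m b a] ab by blast
    ultimately show ?thesis using b by metis
  qed
  have adm: "admissible (next_level D) a k" for k
  proof -
    obtain m where m: "prefix (heads A (Suc (length (limit_stem D a k)))) (limit_stem D a (Suc m))" "admissible (next_level D) a m"
      using blocks[of "Suc (length (limit_stem D a k))"] by auto
    have "length (limit_stem D a k) < length (limit_stem D a (Suc m))"
      using prefix_length_le[OF m(1)] by simp
    then have "k \<le> m"
      using prefix_length_le[OF prefix_stem[of "Suc m" k legit D UNIV a]] by (meson not_less_eq_eq not_le)
    then show ?thesis using m(2) admissible_mono by blast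
  qed
  have G: "fst (prod_decode (A i)) = fst (prod_decode (realize D a i))" for i
  proof -
    obtain m where m: "prefix (heads A (Suc i)) (limit_stem D a (Suc m))" using blocks[of "Suc i"] by auto
    then have "i < length (limit_stem D a (Suc m))" "limit_stem D a (Suc m) ! i = heads A (Suc i) ! i"
      using prefix_length_le[OF m] by (auto simp: prefix_def nth_append simp del: stem.simps)
    then show ?thesis using limit_stem_nth[of i D a "Suc m"] by simp
  qed
  have "A k = realize D a k" for k
  proof -
    have "heads A (Suc k) = heads (realize D a) (Suc k)" unfolding heads_def using G by simp
    then have "snd (prod_decode (A k)) = snd (prod_decode (realize D a k))"
      using A realize_first_consistent[OF adm, of k] by (auto simp: points_iff intro: first_consistent_unique)
    with G[of k] show ?thesis by (metis prod.collapse prod_decode_inverse)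
  qed
  then have "A = realize D a" by blast
  with adm show ?thesis using that by blast
qed

section \<open>Towers of levels\<close>

abbreviation level :: "(nat \<Rightarrow> nat) \<Rightarrow> nat \<Rightarrow> nat \<Rightarrow> nat" where
  "level D n \<equiv> (next_level ^^ n) D"

text \<open>The levels go up forever, but entry k of a level needs only entries below k of the next
  one, and this position is the termination measure. The cutoff l' < k makes it visible without
  changing the value.\<close>

function tower :: "(nat \<Rightarrow> nat) \<Rightarrow> (nat \<Rightarrow> nat) \<Rightarrow> nat \<Rightarrow> nat \<Rightarrow> nat" where
  "tower D x i k = realize (level D i)
     (\<lambda>l. case l of 0 \<Rightarrow> x i | Suc l' \<Rightarrow> if x i = 0 \<and> l' < k then tower D x (Suc i) l' else 0) k"
  by auto
termination by (relation "measure (\<lambda>(D, x, i, k). k)") auto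

declare tower.simps [simp del]

definition bits :: "(nat \<Rightarrow> nat) \<Rightarrow> (nat \<Rightarrow> nat) \<Rightarrow> nat \<Rightarrow> nat \<Rightarrow> nat" where
  "bits D x i l = (case l of 0 \<Rightarrow> x i | Suc l' \<Rightarrow> if x i = 0 then tower D x (Suc i) l' else 0)"

lemma tower_realize: "tower D x i = realize (level D i) (bits D x i)"
  by (subst fun_eq_iff, subst tower.simps, intro allI realize_cong) (auto simp: bits_def split: nat.split)

text \<open>Each level delays by one position, the one taken by its bit: bit i + d cannot be seen on
  level i before entry d.\<close>

lemma tower_local:
  "(\<And>j. i \<le> j \<Longrightarrow> j \<le> i + k \<Longrightarrow> x j = x' j) \<Longrightarrow> tower D x i k = tower D x' i k"
proof (induction k arbitrary: i rule: less_induct)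
  case (less k)
  have "tower D x (Suc i) l = tower D x' (Suc i) l" if "l < k" for l
    by (rule less.IH) (use that less.prems in auto)
  then have "bits D x i l = bits D x' i l" if "l \<le> k" for l
    using less.prems[of i] that by (auto simp: bits_def split: nat.split)
  then show ?case
    unfolding tower_realize by (rule realize_cong)
qed

text \<open>Induction on the length for all levels at once: n + 1 entries on level i need n entries
  on level i + 1.\<close>

lemma tower_points:
  assumes "\<And>i. x i = 0 \<or> x i = 1"
  shows "tower D x i \<in> points (level D i)"
proof -
  have "legit (level D i) (list_encode (map (tower D x i) [0..<n]))" for n
  proof (induction n arbitrary: i)
    case (Suc n)
    have "admissible (next_level (level D i)) (bits D x i) k" if "k \<le> n" for k
      using assms[of i] Suc[of "Suc i"] by (intro admissible_mono[OF that]) (auto simp: admissible_def bits_def)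
    then show ?case unfolding legit_map tower_realize by (auto intro: realize_first_consistent)
  qed (simp add: legit_iff del: list_encode.simps)
  then show ?thesis by (simp add: points_def)
qed

lemma bits_inj: "tower D x i = tower D x' i \<Longrightarrow> bits D x i = bits D x' i"
  unfolding tower_realize by (rule realize_inj)

definition marker :: "nat \<Rightarrow> nat \<Rightarrow> nat" where
  "marker m j = of_bool (j = m)"

text \<open>Injectivity of \<open>realize\<close> carries an equality on level 0 up to level m,
  where the bits differ.\<close>

lemma tower_marker_neq: "tower D (marker m) 0 \<noteq> tower D (\<lambda>_. 0) 0"
proof
  assume "tower D (marker m) 0 = tower D (\<lambda>_. 0) 0"
  then have "tower D (marker m) i = tower D (\<lambda>_. 0) i" if "i \<le> m" for i
    using that
  proof (induction i)
    case (Suc i)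
    then have "bits D (marker m) i (Suc l) = bits D (\<lambda>_. 0) i (Suc l)" for l
      using bits_inj[of D "marker m" i "\<lambda>_. 0"] by simp
    moreover have "marker m i = 0" using Suc.prems by (simp add: marker_def)
    ultimately have "tower D (marker m) (Suc i) l = tower D (\<lambda>_. 0) (Suc i) l" for l
      by (simp add: bits_def)
    then show ?case by blast
  qed simp
  from bits_inj[OF this[of m]] have "bits D (marker m) m 0 = bits D (\<lambda>_. 0) m 0" by simp
  then show False by (simp add: bits_def marker_def)
qed

text \<open>Parsing repeatedly yields points \<open>B n\<close> on all levels as long as the bits
  are 0. These are the levels of a tower, again by induction on the position for all levels at
  once.\<close>

lemma points_tower:
  assumes A: "A \<in> points D"
  shows "A \<in> insert (tower D (\<lambda>_. 0) 0) (range (\<lambda>m. tower D (marker m) 0))"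
proof -
  have "\<exists>a. B \<in> points D' \<longrightarrow> B = realize D' a \<and> (\<forall>k. admissible (next_level D') a k)" for B D'
    by (metis points_realize)
  then obtain pa where pa: "\<And>B D'. B \<in> points D' \<Longrightarrow> B = realize D' (pa B D')"
    "\<And>B D' k. B \<in> points D' \<Longrightarrow> admissible (next_level D') (pa B D') k" by metis
  define B where "B = rec_nat A (\<lambda>n b l. pa b (level D n) (Suc l))"
  have B: "B 0 = A" "\<And>n l. B (Suc n) l = pa (B n) (level D n) (Suc l)" by (auto simp: B_def)
  define \<beta> where "\<beta> n = pa (B n) (level D n) 0" for n
  have Bp: "B n \<in> points (level D n)" if "\<forall>i<n. \<beta> i = 0" for n
    using that
  proof (induction n)
    case (Suc n)
    then have "\<forall>k. admissible (next_level (level D n)) (pa (B n) (level D n)) k" using pa(2) by simp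
    then have "(\<lambda>l. pa (B n) (level D n) (Suc l)) \<in> points (next_level (level D n))"
      using Suc.prems by (auto simp: admissible_all \<beta>_def)
    moreover have "B (Suc n) = (\<lambda>l. pa (B n) (level D n) (Suc l))" using B(2) by auto
    ultimately show ?case by simp
  qed (simp add: B A)
  \<comment> \<open>Above the first nonzero bit \<open>B\<close> is no longer a sequence of points,
    so only that bit may enter \<open>x\<close>.\<close>
  define x where "x = (if \<exists>m. \<beta> m \<noteq> 0 then marker (LEAST m. \<beta> m \<noteq> 0) else (\<lambda>_. 0))"
  have *: "B n k = tower D x n k" if "\<forall>i<n. \<beta> i = 0" for n k
    using that
  proof (induction k arbitrary: n rule: less_induct)
    case (less k)
    have pn: "B n \<in> points (level D n)" by (rule Bp[OF less.prems])
    have cases: "\<beta> n = 0 \<and> x n = 0 \<or> \<beta> n = 1 \<and> x n = 1 \<and> (\<forall>l. pa (B n) (level D n) (Suc l) = 0)"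
    proof (cases "\<beta> n = 0")
      case True
      have "n \<noteq> (LEAST m. \<beta> m \<noteq> 0)" if "\<exists>m. \<beta> m \<noteq> 0"
        using LeastI_ex[OF that] True by metis
      then have "x n = 0" unfolding x_def by (simp add: marker_def)
      then show ?thesis using True by simp
    next
      case False
      then have "(LEAST m. \<beta> m \<noteq> 0) = n"
        using less.prems by (intro Least_equality) (auto simp: not_less[symmetric])
      then have "x n = 1" using False by (auto simp: x_def marker_def)
      moreover have "\<forall>k. admissible (next_level (level D n)) (pa (B n) (level D n)) k" using pa(2)[OF pn] by simp
      ultimately show ?thesis using False unfolding admissible_all \<beta>_def by auto
    qed
    have "pa (B n) (level D n) l = bits D x n l" if "l \<le> k" for l
    proof (cases l)
      case 0
      then show ?thesis using cases by (auto simp: bits_def \<beta>_def)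
    next
      case (Suc l')
      have "B (Suc n) l' = tower D x (Suc n) l'" if "\<beta> n = 0"
        by (rule less.IH) (use \<open>l \<le> k\<close> Suc less.prems that in \<open>auto simp: less_Suc_eq\<close>)
      then show ?thesis using cases Suc by (auto simp: bits_def B(2))
    qed
    then have "realize (level D n) (pa (B n) (level D n)) k = realize (level D n) (bits D x n) k"
      by (intro realize_cong) auto
    then show ?case using pa(1)[OF pn] by (simp add: tower_realize)
  qed
  have "A = tower D x 0" using *[of 0] B(1) by auto
  then show ?thesis by (auto simp: x_def)
qed

lemma countable_points: "countable (points D)"
  by (rule countable_subset[of _ "insert (tower D (\<lambda>_. 0) 0) (range (\<lambda>m. tower D (marker m) 0))"])
    (auto dest: points_tower)

section \<open>Forcing and truth\<close>

text \<open>Genericity of \<open>A\<close> for the statements with truth values \<open>t\<close>: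
  forcing along \<open>A\<close> is sound and complete.\<close>

definition decides :: "(nat \<Rightarrow> nat) \<Rightarrow> (nat \<Rightarrow> nat) \<Rightarrow> (nat \<Rightarrow> bool) \<Rightarrow> bool" where
  "decides D A t \<longleftrightarrow> (\<forall>c.
     (\<forall>k. D (prod_encode (list_encode (map A [0..<k]), c)) \<in> {2, of_bool (t c)}) \<and>
     (\<exists>N. \<forall>k\<ge>N. D (prod_encode (list_encode (map A [0..<k]), c)) \<noteq> 2))"

lemma decidesD:
  assumes "decides D A t"
  shows "D (prod_encode (list_encode (map A [0..<k]), c)) \<in> {2, of_bool (t c)}"
    and "\<exists>N. \<forall>k\<ge>N. D (prod_encode (list_encode (map A [0..<k]), c)) \<noteq> 2"
  using assms unfolding decides_def by blast+

text \<open>A hit above the stem exists iff the statement is true. If there is a hit, block c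
  contains one, which is an initial part of \<open>A\<close>, so soundness of \<open>D\<close>
  applies to it. If the statement is true, a sufficiently long part of \<open>A\<close> is itself a
  hit.\<close>

lemma decides_step:
  assumes dec: "decides D A t" and A: "A \<in> points D" and a: "A = realize D a" "a 0 = 0"
  shows "decides (next_level D) (\<lambda>i. a (Suc i)) (\<lambda>c. \<exists>i. \<not> t (Suc (prod_encode (i, c))))"
proof -
  have hit: "(\<exists>z. hit legit D (limit_stem D a c @ [a c]) c z) \<longleftrightarrow> (\<exists>i. \<not> t (Suc (prod_encode (i, c))))"
    (is "?l \<longleftrightarrow> ?r") for c
  proof
    assume ex: ?l
    then obtain z where z: "hit legit D (limit_stem D a c @ [a c]) c z"
      "limit_stem D a (Suc c) = fsts (list_decode (fst (prod_decode z)))"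
      by (cases rule: extend_to_hit_cases[of UNIV legit D "limit_stem D a c @ [a c]" c]) auto
    define \<alpha> where "\<alpha> = list_decode (fst (prod_decode z))"
    have leg: "legit D (list_encode \<alpha>)" using z(1) by (simp add: hit_def \<alpha>_def)
    have f: "fst (prod_decode (\<alpha> ! i)) = fst (prod_decode (A i))" if "i < length \<alpha>" for i
      using limit_stem_nth[of i D a "Suc c"] z(2) that by (simp add: \<alpha>_def[symmetric] a(1) fsts_def)
    \<comment> \<open>The stem contains the first components of \<open>\<alpha>\<close> only; the
      second ones are least witnesses for the same heads in \<open>\<alpha>\<close> and in
      \<open>A\<close>.\<close>
    have "\<alpha> = map A [0..<length \<alpha>]"
    proof (rule nth_equalityI)
      fix i assume i: "i < length \<alpha>"
      have "take (Suc i) (fsts \<alpha>) = heads A (Suc i)"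
        by (rule nth_equalityI) (use i f in \<open>auto simp: fsts_def\<close>)
      then have "snd (prod_decode (\<alpha> ! i)) = snd (prod_decode (A i))"
        using leg A i unfolding legit_iff points_iff by (metis first_consistent_unique)
      then have "\<alpha> ! i = A i" using f[OF i] by (metis prod.collapse prod_decode_inverse)
      then show "\<alpha> ! i = map A [0..<length \<alpha>] ! i" using i by simp
    qed simp
    moreover define i where "i = fst (prod_decode (snd (prod_decode z) - 1))"
    have nz: "snd (prod_decode z) \<noteq> 0" and e: "c = snd (prod_decode (snd (prod_decode z) - 1))"
      using z(1) by (auto simp: hit_def)
    have "prod_encode (i, c) = snd (prod_decode z) - 1" unfolding i_def e by simp
    with nz have c: "snd (prod_decode z) = Suc (prod_encode (i, c))" by simp
    have "z = prod_encode (list_encode \<alpha>, Suc (prod_encode (i, c)))"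
      unfolding \<alpha>_def list_decode_inverse c[symmetric] by simp
    moreover have "D z = 0" using z(1) by (simp add: hit_def)
    ultimately have "D (prod_encode (list_encode (map A [0..<length \<alpha>]), Suc (prod_encode (i, c)))) = 0"
      by simp
    moreover have "D (prod_encode (list_encode (map A [0..<length \<alpha>]), Suc (prod_encode (i, c))))
       \<in> {2, of_bool (t (Suc (prod_encode (i, c))))}"
      using decidesD(1)[OF dec] .
    ultimately have "\<not> t (Suc (prod_encode (i, c)))" by (auto split: if_splits)
    then show ?r by blast
  next
    assume ?r
    then obtain i where i: "\<not> t (Suc (prod_encode (i, c)))" by blast
    define d where "d = Suc (prod_encode (i, c))"
    obtain N where N: "\<And>k. N \<le> k \<Longrightarrow> D (prod_encode (list_encode (map A [0..<k]), d)) \<noteq> 2"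
      using decidesD(2)[OF dec] by blast
    \<comment> \<open>Long enough to decide \<open>d\<close> and to extend the stem.\<close>
    define k where "k = max N (length (limit_stem D a c @ [a c]))"
    have "D (prod_encode (list_encode (map A [0..<k]), d)) \<in> {2, of_bool (t d)}"
      using decidesD(1)[OF dec] .
    then have 0: "D (prod_encode (list_encode (map A [0..<k]), d)) = 0"
      using N[of k] i by (auto simp: d_def k_def)
    have "limit_stem D a c @ [a c] = heads A (length (limit_stem D a c @ [a c]))"
    proof (rule nth_equalityI)
      fix i assume i: "i < length (limit_stem D a c @ [a c])"
      have "prefix (limit_stem D a c @ [a c]) (limit_stem D a (Suc c))" by (rule prefix_stem_Suc)
      then have "i < length (limit_stem D a (Suc c))" "(limit_stem D a c @ [a c]) ! i = limit_stem D a (Suc c) ! i"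
        using i by (auto simp: prefix_def nth_append simp del: stem.simps)
      then show "(limit_stem D a c @ [a c]) ! i = heads A (length (limit_stem D a c @ [a c])) ! i"
        using i limit_stem_nth[of i D a "Suc c"] by (simp add: a(1) del: stem.simps)
    qed simp
    then have "prefix (limit_stem D a c @ [a c]) (heads A k)"
      by (metis k_def max.cobounded2 prefix_heads)
    moreover have "legit D (list_encode (map A [0..<k]))" using A by (simp add: points_def)
    ultimately have "hit legit D (limit_stem D a c @ [a c]) c (prod_encode (list_encode (map A [0..<k]), d))"
      using 0 by (simp add: hit_def d_def fsts_def heads_def comp_def)
    then show ?l by blast
  qed
  \<comment> \<open>The assumption a 0 = 0 matches the 0 that \<open>next_table\<close> puts in
    front; this shift also gives c \<le> k rather than c < k.\<close>
  have *: "next_level D (prod_encode (list_encode (map (\<lambda>i. a (Suc i)) [0..<k]), c)) =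
      (if c \<le> k then of_bool (\<exists>i. \<not> t (Suc (prod_encode (i, c)))) else 2)" for c k
  proof -
    define as where "as = 0 # map (\<lambda>i. a (Suc i)) [0..<k]"
    have nth: "nth0 as i = a i" if "i \<le> k" for i
      using that a(2) by (cases i) (auto simp: as_def nth0_def)
    have "limit_stem D (nth0 as) c = limit_stem D a c" if "c \<le> k" by (rule stem_cong) (use nth that in auto)
    then show ?thesis
      unfolding next_table_def Let_def using nth[of c] by (auto simp: as_def[symmetric] hit) (auto simp: as_def)
  qed
  show ?thesis unfolding decides_def * by (auto intro: exI[of _ "_ :: nat"])
qed

text \<open>Alternation is expressed by negation, so a single recursion serves both kinds of
  quantifier prefixes. The number passed down is the code of the list i # c.\<close>

primrec truth :: "((nat \<Rightarrow> nat) \<Rightarrow> nat \<Rightarrow> bool) \<Rightarrow> (nat \<Rightarrow> nat) \<Rightarrow> nat \<Rightarrow> nat \<Rightarrow> bool" where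
  "truth b X 0 = b X"
| "truth b X (Suc n) = (\<lambda>c. \<exists>i. \<not> truth b X n (Suc (prod_encode (i, c))))"

lemma decides_tower:
  assumes "\<And>X. decides D X (b X)" "\<And>i. x i = 0 \<or> x i = 1" "\<And>i. i < n \<Longrightarrow> x i = 0"
  shows "decides (level D n) (tower D x n) (truth b (tower D x 0) n)"
  using assms(3)
proof (induction n)
  case (Suc n)
  have "tower D x (Suc n) = (\<lambda>i. bits D x n (Suc i))" using Suc.prems[of n] by (auto simp: bits_def)
  moreover have "bits D x n 0 = 0" using Suc.prems[of n] by (auto simp: bits_def)
  ultimately show ?case
    using decides_step[OF Suc.IH tower_points[OF assms(2)] tower_realize] Suc.prems by simp
qed (simp add: assms)

theorem not_isolated:
  assumes "\<And>X. decides D X (b X)"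
  shows "\<exists>m. truth b (tower D (marker m) 0) n c = truth b (tower D (\<lambda>_. 0) 0) n c"
proof -
  have d0: "decides (level D n) (tower D (\<lambda>_. 0) n) (truth b (tower D (\<lambda>_. 0) 0) n)"
    by (rule decides_tower) (auto simp: assms)
  then obtain k where k: "level D n (prod_encode (list_encode (map (tower D (\<lambda>_. 0) n) [0..<k]), c)) \<noteq> 2"
    unfolding decides_def by blast
  \<comment> \<open>Large enough twice: the bits below level n remain 0, and by
    \<open>tower_local\<close> the bit m does not affect the first k entries of level n.\<close>
  define m where "m = n + k"
  have dm: "decides (level D n) (tower D (marker m) n) (truth b (tower D (marker m) 0) n)"
    by (rule decides_tower) (auto simp: assms m_def marker_def)
  have "tower D (marker m) n i = tower D (\<lambda>_. 0) n i" if "i < k" for i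
    by (rule tower_local) (use that in \<open>auto simp: m_def marker_def\<close>)
  then have eq: "map (tower D (marker m) n) [0..<k] = map (tower D (\<lambda>_. 0) n) [0..<k]" by simp
  have "of_bool (truth b (tower D (marker m) 0) n c) = (of_bool (truth b (tower D (\<lambda>_. 0) 0) n c) :: nat)"
    using decidesD(1)[OF d0, of k c] decidesD(1)[OF dm, of k c] k unfolding eq by force
  then show ?thesis by (metis of_bool_eq_iff)
qed

section \<open>Register programs and computable functions\<close>

text \<open>The oracle commands only move forward. A prefix of the oracle is read once, and
  everything else is oracle-free computation on registers.\<close>

datatype com = CInc nat | CDec nat | CSeq com com | CWhile nat com | COracleRight | CWhileOracle com

inductive exec :: "(nat \<Rightarrow> nat) \<Rightarrow> com \<Rightarrow> (nat \<Rightarrow> nat) \<times> nat \<Rightarrow> (nat \<Rightarrow> nat) \<times> nat \<Rightarrow> bool" for X where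
  Inc: "exec X (CInc r) (s, p) (s(r := Suc (s r)), p)"
| Dec: "exec X (CDec r) (s, p) (s(r := s r - 1), p)"
| Seq: "exec X c\<^sub>1 (s, p) (s\<^sub>1, p\<^sub>1) \<Longrightarrow> exec X c\<^sub>2 (s\<^sub>1, p\<^sub>1) (s\<^sub>2, p\<^sub>2) \<Longrightarrow> exec X (CSeq c\<^sub>1 c\<^sub>2) (s, p) (s\<^sub>2, p\<^sub>2)"
| While0: "s r = 0 \<Longrightarrow> exec X (CWhile r c) (s, p) (s, p)"
| While1: "s r \<noteq> 0 \<Longrightarrow> exec X c (s, p) (s\<^sub>1, p\<^sub>1) \<Longrightarrow> exec X (CWhile r c) (s\<^sub>1, p\<^sub>1) (s\<^sub>2, p\<^sub>2) \<Longrightarrow>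
    exec X (CWhile r c) (s, p) (s\<^sub>2, p\<^sub>2)"
| OracleRight: "exec X COracleRight (s, p) (s, Suc p)"
| WhileOracle0: "oracle_tape X p \<noteq> 1 \<Longrightarrow> exec X (CWhileOracle c) (s, p) (s, p)"
| WhileOracle1: "oracle_tape X p = 1 \<Longrightarrow> exec X c (s, p) (s\<^sub>1, p\<^sub>1) \<Longrightarrow>
    exec X (CWhileOracle c) (s\<^sub>1, p\<^sub>1) (s\<^sub>2, p\<^sub>2) \<Longrightarrow> exec X (CWhileOracle c) (s, p) (s\<^sub>2, p\<^sub>2)"

definition runs :: "com \<Rightarrow> (nat \<Rightarrow> nat) \<Rightarrow> (nat \<Rightarrow> nat) \<Rightarrow> bool" where
  "runs c s s' \<longleftrightarrow> (\<forall>X p. exec X c (s, p) (s', p))"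

lemma runs_Inc: "runs (CInc r) s (s(r := Suc (s r)))"
  and runs_Dec: "runs (CDec r) s (s(r := s r - 1))"
  and runs_Seq: "runs c\<^sub>1 s s\<^sub>1 \<Longrightarrow> runs c\<^sub>2 s\<^sub>1 s\<^sub>2 \<Longrightarrow> runs (CSeq c\<^sub>1 c\<^sub>2) s s\<^sub>2"
  and runs_While0: "s r = 0 \<Longrightarrow> runs (CWhile r c) s s"
  and runs_While1: "s r \<noteq> 0 \<Longrightarrow> runs c s s\<^sub>1 \<Longrightarrow> runs (CWhile r c) s\<^sub>1 s\<^sub>2 \<Longrightarrow> runs (CWhile r c) s s\<^sub>2"
  unfolding runs_def by (blast intro: exec.intros)+

definition CZero :: "nat \<Rightarrow> com" where
  "CZero r = CWhile r (CDec r)"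

lemma runs_CZero: "runs (CZero r) s (s(r := 0))"
proof (induction "s r" arbitrary: s)
  case 0
  then have "s(r := 0) = s" by auto
  then show ?case using 0 runs_While0[of s r "CDec r"] by (simp add: CZero_def)
next
  case (Suc n)
  from Suc(1)[of "s(r := s r - 1)"] Suc(2) have "runs (CZero r) (s(r := s r - 1)) (s(r := 0))" by simp
  from runs_While1[OF _ runs_Dec this[unfolded CZero_def]] show ?case
    using Suc(2) by (simp add: CZero_def)
qed

text \<open>Transferring a register empties it; the second copy in \<open>t\<close> is there to
  restore the source.\<close>

definition CCopy :: "nat \<Rightarrow> nat \<Rightarrow> nat \<Rightarrow> com" where
  "CCopy a b t = CSeq (CZero b) (CSeq (CZero t)
     (CSeq (CWhile a (CSeq (CDec a) (CSeq (CInc b) (CInc t)))) (CWhile t (CSeq (CDec t) (CInc a)))))"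

lemma runs_transfer2:
  assumes "a \<noteq> b" "a \<noteq> t" "b \<noteq> t"
  shows "runs (CWhile a (CSeq (CDec a) (CSeq (CInc b) (CInc t)))) s
     (s(a := 0, b := s b + s a, t := s t + s a))"
proof (induction "s a" arbitrary: s)
  case 0
  then have e: "s(a := 0, b := s b + s a, t := s t + s a) = s" by auto
  show ?case unfolding e by (rule runs_While0) (use 0 in simp)
next
  case (Suc n)
  define s1 where "s1 = s(a := s a - 1, b := Suc (s b), t := Suc (s t))"
  have "runs (CSeq (CInc b) (CInc t)) (s(a := s a - 1)) s1"
    using runs_Seq[OF runs_Inc[of b "s(a := s a - 1)"] runs_Inc[of t]] assms by (simp add: s1_def)
  from runs_Seq[OF runs_Dec this] have 1: "runs (CSeq (CDec a) (CSeq (CInc b) (CInc t))) s s1" .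
  have "s1(a := 0, b := s1 b + s1 a, t := s1 t + s1 a) = s(a := 0, b := s b + s a, t := s t + s a)"
    using assms Suc(2) by (auto simp: s1_def fun_eq_iff)
  moreover have "n = s1 a" using Suc(2) assms by (simp add: s1_def)
  ultimately show ?case using Suc(1)[of s1] Suc(2) 1 by (metis runs_While1 nat.distinct(1))
qed

lemma runs_transfer:
  assumes "a \<noteq> t"
  shows "runs (CWhile t (CSeq (CDec t) (CInc a))) s (s(t := 0, a := s a + s t))"
proof (induction "s t" arbitrary: s)
  case 0
  then have e: "s(t := 0, a := s a + s t) = s" by auto
  show ?case unfolding e by (rule runs_While0) (use 0 in simp)
next
  case (Suc n)
  define s1 where "s1 = s(t := s t - 1, a := Suc (s a))"
  have 1: "runs (CSeq (CDec t) (CInc a)) s s1"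
    using runs_Seq[OF runs_Dec runs_Inc[of a "s(t := s t - 1)"]] assms by (simp add: s1_def)
  have "s1(t := 0, a := s1 a + s1 t) = s(t := 0, a := s a + s t)"
    using assms Suc(2) by (auto simp: s1_def fun_eq_iff)
  moreover have "n = s1 t" using Suc(2) assms by (simp add: s1_def)
  ultimately show ?case using Suc(1)[of s1] Suc(2) 1 by (metis runs_While1 nat.distinct(1))
qed

lemma runs_CCopy:
  assumes "a \<noteq> b" "a \<noteq> t" "b \<noteq> t"
  shows "runs (CCopy a b t) s (s(b := s a, t := 0))"
proof -
  define s1 where "s1 = s(b := 0, t := 0)"
  define s2 where "s2 = s1(a := 0, b := s1 b + s1 a, t := s1 t + s1 a)"
  have "s2(t := 0, a := s2 a + s2 t) = s(b := s a, t := 0)"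
    using assms by (auto simp: s1_def s2_def)
  then show ?thesis
    using runs_transfer[of a t s2] assms(2) unfolding CCopy_def
    by (intro runs_Seq[OF runs_CZero] runs_Seq[OF runs_CZero[of t]] runs_Seq[OF runs_transfer2[OF assms, folded s1_def]])
      (simp_all add: s1_def s2_def)
qed

text \<open>
  Variable \<open>k\<close> is kept in register \<open>loc k\<close>, the result goes to register \<open>r\<close>, and the registers from
  \<open>r\<close> on, whose initial contents are arbitrary, serve as scratch space.
\<close>

definition computable :: "((nat \<Rightarrow> nat) \<Rightarrow> nat) \<Rightarrow> bool" where
  "computable F \<longleftrightarrow> (\<exists>N. (\<forall>e e'. (\<forall>k<N. e k = e' k) \<longrightarrow> F e = F e') \<and>
     (\<forall>loc r. (\<forall>k<N. loc k < r) \<longrightarrow>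
       (\<exists>c. \<forall>s. \<exists>s'. runs c s s' \<and> s' r = F (\<lambda>k. s (loc k)) \<and> (\<forall>q<r. s' q = s q))))"

text \<open>The program is chosen as a function of the allocation, because composition runs it at
  allocations of its own.\<close>

lemma computableE:
  assumes "computable F"
  shows "\<exists>N c. (\<forall>e e'. (\<forall>k<N. e k = e' k) \<longrightarrow> F e = F e') \<and>
    (\<forall>loc r s. (\<forall>k<N. loc k < r) \<longrightarrow>
       (\<exists>s'. runs (c loc r) s s' \<and> s' r = F (\<lambda>k. s (loc k)) \<and> (\<forall>q<r. s' q = s q)))"
proof -
  define Q where "Q loc r c \<longleftrightarrow> (\<forall>s. \<exists>s'. runs c s s' \<and> s' r = F (\<lambda>k. s (loc k)) \<and> (\<forall>q<r. s' q = s q))"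
    for loc r c
  obtain N where N: "\<And>e e'. (\<forall>k<N. e k = e' k) \<longrightarrow> F e = F e'"
    "\<And>loc r. (\<forall>k<N. loc k < r) \<longrightarrow> (\<exists>c. Q loc r c)"
    using assms unfolding computable_def Q_def by blast
  have "Q loc r (SOME c. Q loc r c)" if "\<And>k. k < N \<Longrightarrow> loc k < r" for loc r
    by (rule someI_ex) (use N(2) that in blast)
  then show ?thesis
    using N(1) by (intro exI[of _ N] exI[of _ "\<lambda>loc r. SOME c. Q loc r c"]) (auto simp: Q_def)
qed

lemma computable_var [intro!]: "computable (\<lambda>e. e k)"
  unfolding computable_def
proof (rule exI[of _ "Suc k"], intro conjI allI impI)
  fix loc :: "nat \<Rightarrow> nat" and r assume *: "\<forall>i<Suc k. loc i < r"
  have ne: "loc k \<noteq> r" "loc k \<noteq> Suc r" using *[rule_format, of k] by auto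
  show "\<exists>c. \<forall>s. \<exists>s'. runs c s s' \<and> s' r = s (loc k) \<and> (\<forall>q<r. s' q = s q)"
    by (rule exI[of _ "CCopy (loc k) r (Suc r)"])
      (use runs_CCopy[OF ne] in fastforce)
qed simp

lemma computable_0: "computable (\<lambda>e. 0)"
  unfolding computable_def
  by (rule exI[of _ 0]) (auto intro!: exI[of _ "CZero _"] exI[of _ "_(_ := 0)"] runs_CZero)

lemma computable_Suc:
  assumes "computable F"
  shows "computable (\<lambda>e. Suc (F e))"
proof -
  obtain N c where "\<forall>e e'. (\<forall>k<N. e k = e' k) \<longrightarrow> F e = F e'"
    "\<forall>loc r s. (\<forall>k<N. loc k < r) \<longrightarrow>
       (\<exists>s'. runs (c loc r) s s' \<and> s' r = F (\<lambda>k. s (loc k)) \<and> (\<forall>q<r. s' q = s q))"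
    using computableE[OF assms] by blast
  note N = this[rule_format]
  show ?thesis
    unfolding computable_def
  proof (rule exI[of _ N], intro conjI allI impI)
    fix e e' :: "nat \<Rightarrow> nat" assume "\<forall>k<N. e k = e' k"
    then show "Suc (F e) = Suc (F e')" using N(1)[of e e'] by simp
  next
    fix loc :: "nat \<Rightarrow> nat" and r assume "\<forall>k<N. loc k < r"
    show "\<exists>c. \<forall>s. \<exists>s'. runs c s s' \<and> s' r = Suc (F (\<lambda>k. s (loc k))) \<and> (\<forall>q<r. s' q = s q)"
    proof (intro exI[of _ "CSeq (c loc r) (CInc r)"] allI)
      fix s
      obtain s' where "runs (c loc r) s s'" "s' r = F (\<lambda>k. s (loc k))" "\<forall>q<r. s' q = s q"
        using N(2)[of loc r s] \<open>\<forall>k<N. loc k < r\<close> by blast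
      then show "\<exists>s'. runs (CSeq (c loc r) (CInc r)) s s' \<and> s' r = Suc (F (\<lambda>k. s (loc k))) \<and> (\<forall>q<r. s' q = s q)"
        by (rule_tac x = "s'(r := Suc (s' r))" in exI) (intro conjI runs_Seq[OF _ runs_Inc]; simp)
    qed
  qed
qed

text \<open>Only the first M of the infinitely many substituted functions matter. Their values go to
  the registers from r on, \<open>F\<close> is evaluated beyond them, and its result is copied down
  to r.\<close>

lemma computable_subst:
  assumes F: "computable F" and t: "\<And>k. computable (t k)"
  shows "computable (\<lambda>e. F (\<lambda>k. t k e))"
proof -
  obtain M c where "\<forall>e e'. (\<forall>k<M. e k = e' k) \<longrightarrow> F e = F e'"
    "\<forall>loc r s. (\<forall>k<M. loc k < r) \<longrightarrow>
       (\<exists>s'. runs (c loc r) s s' \<and> s' r = F (\<lambda>k. s (loc k)) \<and> (\<forall>q<r. s' q = s q))"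
    using computableE[OF F] by blast
  note M = this[rule_format]
  define W where "W k N d \<longleftrightarrow> (\<forall>e e'. (\<forall>i<N. e i = e' i) \<longrightarrow> t k e = t k e') \<and>
    (\<forall>loc r s. (\<forall>i<N. loc i < r) \<longrightarrow>
       (\<exists>s'. runs (d loc r) s s' \<and> s' r = t k (\<lambda>i. s (loc i)) \<and> (\<forall>q<r. s' q = s q)))" for k N d
  have "\<exists>N d. W k N d" for k
    unfolding W_def by (rule computableE[OF t[of k]])
  then obtain N d where "\<And>k. W k (N k) (d k)" by metis
  then have N: "(\<forall>i<N k. e i = e' i) \<Longrightarrow> t k e = t k e'"
    "(\<forall>i<N k. loc i < r) \<Longrightarrow>
       \<exists>s'. runs (d k loc r) s s' \<and> s' r = t k (\<lambda>i. s (loc i)) \<and> (\<forall>q<r. s' q = s q)"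
    for k e e' loc r s
    unfolding W_def by blast+
  define N' where "N' = (\<Sum>k<M. N k)"
  have NN': "N k \<le> N'" if "k < M" for k
    unfolding N'_def by (rule member_le_sum) (use that in auto)
  show ?thesis
    unfolding computable_def
  proof (rule exI[of _ N'], intro conjI allI impI)
    fix e e' :: "nat \<Rightarrow> nat" assume "\<forall>k<N'. e k = e' k"
    then have "t k e = t k e'" if "k < M" for k using NN'[OF that] by (intro N(1)) auto
    then show "F (\<lambda>k. t k e) = F (\<lambda>k. t k e')" by (intro M(1)) auto
  next
    fix loc :: "nat \<Rightarrow> nat" and r assume loc: "\<forall>k<N'. loc k < r"
    have "\<exists>g. \<forall>s. \<exists>s'. runs g s s' \<and> (\<forall>k<m. s' (r + k) = t k (\<lambda>i. s (loc i))) \<and> (\<forall>q<r. s' q = s q)"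
      if "m \<le> M" for m
      using that
    proof (induction m)
      case 0
      have "\<exists>s'. runs (CZero r) s s' \<and> (\<forall>k<0. s' (r + k) = t k (\<lambda>i. s (loc i))) \<and> (\<forall>q<r. s' q = s q)" for s
        by (rule exI[of _ "s(r := 0)"]) (intro conjI runs_CZero; simp)
      then show ?case by blast
    next
      case (Suc m)
      then obtain g where g: "\<And>s. \<exists>s'. runs g s s' \<and> (\<forall>k<m. s' (r + k) = t k (\<lambda>i. s (loc i))) \<and> (\<forall>q<r. s' q = s q)"
        by auto
      have loc': "loc i < r" if "i < N m" for i using loc NN'[of m] Suc.prems that by auto
      show ?case
      proof (intro exI[of _ "CSeq g (d m loc (r + m))"] allI)
        fix s
        obtain s1 where s1: "runs g s s1" "\<forall>k<m. s1 (r + k) = t k (\<lambda>i. s (loc i))" "\<forall>q<r. s1 q = s q"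
          using g by blast
        obtain s2 where s2: "runs (d m loc (r + m)) s1 s2" "s2 (r + m) = t m (\<lambda>i. s1 (loc i))" "\<forall>q<r + m. s2 q = s1 q"
          using N(2)[of m loc "r + m" s1] loc' by (meson trans_less_add1)
        have "t m (\<lambda>i. s1 (loc i)) = t m (\<lambda>i. s (loc i))"
          by (rule N(1)) (use s1(3) loc' in auto)
        with s1 s2 show "\<exists>s'. runs (CSeq g (d m loc (r + m))) s s' \<and>
          (\<forall>k<Suc m. s' (r + k) = t k (\<lambda>i. s (loc i))) \<and> (\<forall>q<r. s' q = s q)"
          by (intro exI[of _ s2]) (auto intro: runs_Seq simp: less_Suc_eq)
      qed
    qed
    from this[of M] obtain g where g: "\<And>s. \<exists>s'. runs g s s' \<and> (\<forall>k<M. s' (r + k) = t k (\<lambda>i. s (loc i))) \<and> (\<forall>q<r. s' q = s q)"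
      by auto
    \<comment> \<open>The summand 2 keeps r and r + 1, used by the final copy, distinct from
      \<open>R\<close> even for M = 0.\<close>
    define R where "R = r + M + 2"
    show "\<exists>c. \<forall>s. \<exists>s'. runs c s s' \<and> s' r = F (\<lambda>k. t k (\<lambda>k. s (loc k))) \<and> (\<forall>q<r. s' q = s q)"
    proof (intro exI[of _ "CSeq g (CSeq (c (\<lambda>k. r + k) R) (CCopy R r (Suc r)))"] allI)
      fix s
      obtain s1 where s1: "runs g s s1" "\<forall>k<M. s1 (r + k) = t k (\<lambda>i. s (loc i))" "\<forall>q<r. s1 q = s q"
        using g by blast
      obtain s2 where s2: "runs (c (\<lambda>k. r + k) R) s1 s2" "s2 R = F (\<lambda>k. s1 (r + k))" "\<forall>q<R. s2 q = s1 q"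
        using M(2)[of "\<lambda>k. r + k" R s1] by (auto simp: R_def)
      have "F (\<lambda>k. s1 (r + k)) = F (\<lambda>k. t k (\<lambda>k. s (loc k)))" by (rule M(1)) (use s1 in auto)
      moreover have "runs (CCopy R r (Suc r)) s2 (s2(r := s2 R, Suc r := 0))"
        by (rule runs_CCopy) (auto simp: R_def)
      ultimately show "\<exists>s'. runs (CSeq g (CSeq (c (\<lambda>k. r + k) R) (CCopy R r (Suc r)))) s s' \<and>
          s' r = F (\<lambda>k. t k (\<lambda>k. s (loc k))) \<and> (\<forall>q<r. s' q = s q)"
        using s1 s2 by (intro exI[of _ "s2(r := s2 R, Suc r := 0)"]) (auto intro!: runs_Seq simp: R_def)
    qed
  qed
qed

text \<open>Register r holds the accumulator, r + 1 counts down the remaining rounds, r + 2 counts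
  up the index, and \<open>h\<close> is evaluated from r + 3 on. In the hypothesis on
  \<open>h\<close>, variable 0 is the index and variable 1 the accumulator.\<close>

lemma computable_rec_nat:
  assumes b: "computable b" and h: "computable (\<lambda>l. h (\<lambda>k. l (Suc (Suc k))) (l 0) (l 1))" and t: "computable t"
  shows "computable (\<lambda>e. rec_nat (b e) (h e) (t e))"
proof -
  obtain Nb cb where "\<forall>e e'. (\<forall>k<Nb. e k = e' k) \<longrightarrow> b e = b e'"
    "\<forall>loc r s. (\<forall>k<Nb. loc k < r) \<longrightarrow>
       (\<exists>s'. runs (cb loc r) s s' \<and> s' r = b (\<lambda>k. s (loc k)) \<and> (\<forall>q<r. s' q = s q))"
    using computableE[OF b] by blast
  note Nb = this[rule_format]
  obtain Nt ct where "\<forall>e e'. (\<forall>k<Nt. e k = e' k) \<longrightarrow> t e = t e'"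
    "\<forall>loc r s. (\<forall>k<Nt. loc k < r) \<longrightarrow>
       (\<exists>s'. runs (ct loc r) s s' \<and> s' r = t (\<lambda>k. s (loc k)) \<and> (\<forall>q<r. s' q = s q))"
    using computableE[OF t] by blast
  note Nt = this[rule_format]
  obtain Nh ch where "\<forall>e e'. (\<forall>k<Nh. e k = e' k) \<longrightarrow>
      h (\<lambda>k. e (Suc (Suc k))) (e 0) (e 1) = h (\<lambda>k. e' (Suc (Suc k))) (e' 0) (e' 1)"
    "\<forall>loc r s. (\<forall>k<Nh. loc k < r) \<longrightarrow>
       (\<exists>s'. runs (ch loc r) s s' \<and> s' r = h (\<lambda>k. s (loc (Suc (Suc k)))) (s (loc 0)) (s (loc 1)) \<and> (\<forall>q<r. s' q = s q))"
    using computableE[OF h] by blast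
  note Nh = this[rule_format]
  define N where "N = max Nb (max Nt Nh)"
  have hcong: "h e i a = h e' i a" if "\<And>k. k < N \<Longrightarrow> e k = e' k" for e e' i a
    using Nh(1)[of "case_nat i (case_nat a e)" "case_nat i (case_nat a e')"] that
    by (auto simp: N_def split: nat.splits)
  show ?thesis
    unfolding computable_def
  proof (rule exI[of _ N], intro conjI allI impI)
    fix e e' :: "nat \<Rightarrow> nat" assume *: "\<forall>k<N. e k = e' k"
    then have "h e = h e'" by (intro ext hcong) auto
    moreover have "b e = b e'" "t e = t e'" using * by (auto intro!: Nb(1) Nt(1) simp: N_def)
    ultimately show "rec_nat (b e) (h e) (t e) = rec_nat (b e') (h e') (t e')" by simp
  next
    fix loc :: "nat \<Rightarrow> nat" and r assume loc: "\<forall>k<N. loc k < r"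
    define hl where "hl = case_nat (r + 2) (case_nat r loc)"
    \<comment> \<open>A local name for the loop body, unrelated to the constant of this
      name.\<close>
    define legit_step where "legit_step = CSeq (CDec (r + 1)) (CSeq (ch hl (r + 3)) (CSeq (CCopy (r + 3) r (r + 4)) (CInc (r + 2))))"
    have loop: "\<exists>s'. runs (CWhile (r + 1) legit_step) s s' \<and> s' r = rec_nat a0 (h e) (i + n) \<and> (\<forall>q<r. s' q = s q)"
      if "s (r + 1) = n" "s (r + 2) = i" "s r = rec_nat a0 (h e) i" "\<forall>k<N. s (loc k) = e k" for s e n i a0
      using that
    proof (induction n arbitrary: s i)
      case 0
      then show ?case by (intro exI[of _ s]) (auto intro: runs_While0)
    next
      case (Suc n)
      define s1 where "s1 = s(r + 1 := s (r + 1) - 1)"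
      have hl: "hl k < r + 3" if "k < Nh" for k
      proof (cases "k < 2")
        case True
        then show ?thesis by (auto simp: hl_def numeral_2_eq_2 less_Suc_eq)
      next
        case False
        then have k: "k = Suc (Suc (k - 2))" by simp
        then have "loc (k - 2) < r" using loc that by (auto simp: N_def)
        then show ?thesis unfolding hl_def by (subst k) simp
      qed
      obtain s2 where s2: "runs (ch hl (r + 3)) s1 s2"
        "s2 (r + 3) = h (\<lambda>k. s1 (hl (Suc (Suc k)))) (s1 (hl 0)) (s1 (hl 1))" "\<forall>q<r + 3. s2 q = s1 q"
        using Nh(2)[of hl "r + 3" s1, OF hl] by blast
      define s3 where "s3 = s2(r := s2 (r + 3), r + 4 := 0)"
      have 3: "runs (CCopy (r + 3) r (r + 4)) s2 s3" unfolding s3_def by (rule runs_CCopy) auto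
      define s4 where "s4 = s3(r + 2 := Suc (s3 (r + 2)))"
      have step: "runs legit_step s s4"
        unfolding legit_step_def s4_def using s2(1) 3 by (auto intro!: runs_Seq runs_Dec runs_Inc simp: s1_def)
      have s1loc: "s1 (loc k) = e k" if "k < N" for k
      proof -
        have "loc k < r" using loc that by blast
        then show ?thesis using Suc.prems(4) that by (simp add: s1_def)
      qed
      have "s2 (r + 3) = h (\<lambda>k. s1 (loc k)) (s1 (r + 2)) (s1 r)" using s2(2) by (simp add: hl_def)
      also have "\<dots> = h e (s1 (r + 2)) (s1 r)" by (rule hcong) (rule s1loc)
      finally have "s2 (r + 3) = h e i (rec_nat a0 (h e) i)" using Suc.prems by (simp add: s1_def)
      then have r4: "s4 r = rec_nat a0 (h e) (Suc i)" by (simp add: s4_def s3_def)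
      have low: "\<forall>q<r. s4 q = s q" using s2(3) by (auto simp: s4_def s3_def s1_def)
      have "\<exists>s'. runs (CWhile (r + 1) legit_step) s4 s' \<and> s' r = rec_nat a0 (h e) (Suc i + n) \<and> (\<forall>q<r. s' q = s4 q)"
        by (rule Suc.IH) (use Suc.prems s2(3) low loc r4 in \<open>auto simp: s4_def s3_def s1_def\<close>)
      then show ?case using step Suc.prems(1) low by (metis runs_While1 add_Suc_shift nat.distinct(1))
    qed
    define prog where "prog = CSeq (cb loc r) (CSeq (ct loc (r + 1)) (CSeq (CZero (r + 2)) (CWhile (r + 1) legit_step)))"
    show "\<exists>c. \<forall>s. \<exists>s'. runs c s s' \<and> s' r = rec_nat (b (\<lambda>k. s (loc k))) (h (\<lambda>k. s (loc k))) (t (\<lambda>k. s (loc k))) \<and>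
       (\<forall>q<r. s' q = s q)"
    proof (intro exI[of _ prog] allI)
      fix s
      obtain s1 where s1: "runs (cb loc r) s s1" "s1 r = b (\<lambda>k. s (loc k))" "\<forall>q<r. s1 q = s q"
        using Nb(2)[of loc r s] loc by (auto simp: N_def)
      obtain s2 where s2: "runs (ct loc (r + 1)) s1 s2" "s2 (r + 1) = t (\<lambda>k. s1 (loc k))" "\<forall>q<r + 1. s2 q = s1 q"
        using Nt(2)[of loc "r + 1" s1] loc by (auto simp: N_def less_Suc_eq)
      have t: "t (\<lambda>k. s1 (loc k)) = t (\<lambda>k. s (loc k))"
        by (rule Nt(1)) (use s1(3) loc in \<open>auto simp: N_def\<close>)
      define s3 where "s3 = s2(r + 2 := 0)"
      have 3: "runs (CZero (r + 2)) s2 s3" unfolding s3_def by (rule runs_CZero)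
      have "\<exists>s'. runs (CWhile (r + 1) legit_step) s3 s' \<and>
          s' r = rec_nat (b (\<lambda>k. s (loc k))) (h (\<lambda>k. s (loc k))) (0 + t (\<lambda>k. s (loc k))) \<and> (\<forall>q<r. s' q = s3 q)"
      proof (rule loop)
        show "\<forall>k<N. s3 (loc k) = s (loc k)"
        proof (intro allI impI)
          fix k assume "k < N"
          then have "loc k < r" using loc by blast
          then show "s3 (loc k) = s (loc k)" using s1(3) s2(3) by (simp add: s3_def)
        qed
      qed (use s1 s2 t in \<open>auto simp: s3_def\<close>)
      then obtain s4 where s4: "runs (CWhile (r + 1) legit_step) s3 s4"
        "s4 r = rec_nat (b (\<lambda>k. s (loc k))) (h (\<lambda>k. s (loc k))) (t (\<lambda>k. s (loc k)))" "\<forall>q<r. s4 q = s3 q" by auto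
      show "\<exists>s'. runs prog s s' \<and> s' r = rec_nat (b (\<lambda>k. s (loc k))) (h (\<lambda>k. s (loc k))) (t (\<lambda>k. s (loc k))) \<and>
       (\<forall>q<r. s' q = s q)"
        unfolding prog_def
        by (intro exI[of _ s4] conjI runs_Seq[OF s1(1)] runs_Seq[OF s2(1)] runs_Seq[OF 3] s4(1) s4(2))
          (use s1(3) s2(3) s4(3) in \<open>auto simp: s3_def\<close>)
    qed
  qed
qed

text \<open>Unbounded search with the candidate in r and its test value in r + 1. The loop
  terminates by induction on the distance to the least zero.\<close>

lemma computable_LEAST_0:
  assumes P: "computable (\<lambda>l. P (\<lambda>k. l (Suc k)) (l 0))" and ex: "\<And>e. \<exists>i. P e i = 0"
  shows "computable (\<lambda>e. LEAST i. P e i = 0)"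
proof -
  obtain M c where "\<forall>e e'. (\<forall>k<M. e k = e' k) \<longrightarrow> P (\<lambda>k. e (Suc k)) (e 0) = P (\<lambda>k. e' (Suc k)) (e' 0)"
    "\<forall>loc r s. (\<forall>k<M. loc k < r) \<longrightarrow>
       (\<exists>s'. runs (c loc r) s s' \<and> s' r = P (\<lambda>k. s (loc (Suc k))) (s (loc 0)) \<and> (\<forall>q<r. s' q = s q))"
    using computableE[OF P] by blast
  note M = this[rule_format]
  have cong: "P e i = P e' i" if "\<And>k. k < M \<Longrightarrow> e k = e' k" for e e' i
    using M(1)[of "case_nat i e" "case_nat i e'"] that by (auto split: nat.splits)
  show ?thesis
    unfolding computable_def
  proof (rule exI[of _ M], intro conjI allI impI)
    fix e e' :: "nat \<Rightarrow> nat" assume *: "\<forall>k<M. e k = e' k"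
    then have "P e = P e'" by (intro ext cong) auto
    then show "(LEAST i. P e i = 0) = (LEAST i. P e' i = 0)" by simp
  next
    fix loc :: "nat \<Rightarrow> nat" and r assume loc: "\<forall>k<M. loc k < r"
    define pl where "pl = case_nat r loc"
    define test where "test = c pl (r + 1)"
    have test: "\<exists>s'. runs test s s' \<and> s' (r + 1) = P (\<lambda>k. s (loc k)) (s r) \<and> (\<forall>q<r + 1. s' q = s q)" for s
    proof -
      have "pl k < r + 1" if "k < M" for k
        using loc that by (auto simp: pl_def less_Suc_eq split: nat.split)
      from M(2)[of pl "r + 1" s, OF this] show ?thesis by (simp add: test_def pl_def)
    qed
    have loop: "\<exists>s'. runs (CWhile (r + 1) (CSeq (CInc r) test)) s s' \<and> s' r = (LEAST i. P e i = 0) \<and> (\<forall>q<r. s' q = s q)"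
      if "s (r + 1) = P e (s r)" "\<forall>k<M. s (loc k) = e k" "s r + n = (LEAST i. P e i = 0)" for s e n
      using that
    proof (induction n arbitrary: s)
      case 0
      have "P e (LEAST i. P e i = 0) = 0" using ex by (rule LeastI_ex)
      then show ?case using 0 by (intro exI[of _ s]) (auto intro: runs_While0)
    next
      case (Suc n)
      have "s r < (LEAST i. P e i = 0)" using Suc.prems(3) by linarith
      then have nz: "s (r + 1) \<noteq> 0" using not_less_Least Suc.prems(1) by fastforce
      define s1 where "s1 = s(r := Suc (s r))"
      obtain s2 where s2: "runs test s1 s2" "s2 (r + 1) = P (\<lambda>k. s1 (loc k)) (s1 r)" "\<forall>q<r + 1. s2 q = s1 q"
        using test by blast
      have step: "runs (CSeq (CInc r) test) s s2" using s2(1) by (auto intro: runs_Seq runs_Inc simp: s1_def)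
      have s1loc: "s1 (loc k) = e k" if "k < M" for k
      proof -
        have "loc k < r" using loc that by blast
        then show ?thesis using Suc.prems(2) that by (simp add: s1_def)
      qed
      then have "s2 (r + 1) = P e (s2 r)" using s2(2,3) cong[of "\<lambda>k. s1 (loc k)" e] by auto
      moreover have "\<forall>k<M. s2 (loc k) = e k" using s1loc s2(3) loc by (simp add: less_Suc_eq)
      moreover have "s2 r + n = (LEAST i. P e i = 0)" using s2(3) Suc.prems(3) by (simp add: s1_def)
      ultimately have "\<exists>s'. runs (CWhile (r + 1) (CSeq (CInc r) test)) s2 s' \<and> s' r = (LEAST i. P e i = 0) \<and> (\<forall>q<r. s' q = s2 q)"
        by (rule Suc.IH)
      moreover have "\<forall>q<r. s2 q = s q" using s2(3) by (auto simp: s1_def)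
      ultimately show ?case using step nz by (metis runs_While1)
    qed
    define prog where "prog = CSeq (CZero r) (CSeq test (CWhile (r + 1) (CSeq (CInc r) test)))"
    show "\<exists>c. \<forall>s. \<exists>s'. runs c s s' \<and> s' r = (LEAST i. P (\<lambda>k. s (loc k)) i = 0) \<and> (\<forall>q<r. s' q = s q)"
    proof (intro exI[of _ prog] allI)
      fix s :: "nat \<Rightarrow> nat"
      define e where "e = (\<lambda>k. s (loc k))"
      define s1 where "s1 = s(r := 0)"
      obtain s2 where s2: "runs test s1 s2" "s2 (r + 1) = P (\<lambda>k. s1 (loc k)) (s1 r)" "\<forall>q<r + 1. s2 q = s1 q"
        using test by blast
      have s1loc: "s1 (loc k) = e k" if "k < M" for k
      proof -
        have "loc k < r" using loc that by blast
        then show ?thesis by (simp add: s1_def e_def)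
      qed
      then have "s2 (r + 1) = P e (s2 r)" using s2(2,3) cong[of "\<lambda>k. s1 (loc k)" e] by auto
      moreover have "\<forall>k<M. s2 (loc k) = e k" using s1loc s2(3) loc by (simp add: less_Suc_eq)
      moreover have "s2 r + (LEAST i. P e i = 0) = (LEAST i. P e i = 0)" using s2(3) by (simp add: s1_def)
      ultimately obtain s3 where s3: "runs (CWhile (r + 1) (CSeq (CInc r) test)) s2 s3" "s3 r = (LEAST i. P e i = 0)" "\<forall>q<r. s3 q = s2 q"
        using loop[of s2 e "LEAST i. P e i = 0"] by blast
      have "runs prog s s3" unfolding prog_def
        by (intro runs_Seq[OF runs_CZero] runs_Seq[OF s2(1)[unfolded s1_def]] s3(1))
      then show "\<exists>s'. runs prog s s' \<and> s' r = (LEAST i. P (\<lambda>k. s (loc k)) i = 0) \<and> (\<forall>q<r. s' q = s q)"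
        unfolding e_def[symmetric] using s2(3) s3 by (intro exI[of _ s3]) (auto simp: s1_def)
    qed
  qed
qed

section \<open>Closure properties of computable functions\<close>

lemma computable_const: "computable (\<lambda>e. k)"
  by (induction k) (auto intro: computable_0 computable_Suc)

lemma computable1: "computable (\<lambda>e. f (e 0)) \<Longrightarrow> computable t \<Longrightarrow> computable (\<lambda>e. f (t e))"
  using computable_subst[of "\<lambda>e. f (e 0)" "\<lambda>k. t"] by simp

lemma computable2:
  "computable (\<lambda>e. f (e 0) (e 1)) \<Longrightarrow> computable t \<Longrightarrow> computable u \<Longrightarrow> computable (\<lambda>e. f (t e) (u e))"
  using computable_subst[of "\<lambda>e. f (e 0) (e 1)" "\<lambda>k. if k = 0 then t else u"] by simp

lemma computable4:
  "computable (\<lambda>e. f (e 0) (e 1) (e 2) (e 3)) \<Longrightarrow> computable t \<Longrightarrow> computable u \<Longrightarrow> computable v \<Longrightarrow>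
    computable w \<Longrightarrow> computable (\<lambda>e. f (t e) (u e) (v e) (w e))"
  using computable_subst[of "\<lambda>e. f (e 0) (e 1) (e 2) (e 3)"
      "\<lambda>k. if k = 0 then t else if k = 1 then u else if k = 2 then v else w"]
  by simp

lemma computable5:
  "computable (\<lambda>e. f (e 0) (e 1) (e 2) (e 3) (e 4)) \<Longrightarrow> computable t \<Longrightarrow> computable u \<Longrightarrow> computable v \<Longrightarrow>
    computable w \<Longrightarrow> computable x \<Longrightarrow> computable (\<lambda>e. f (t e) (u e) (v e) (w e) (x e))"
  using computable_subst[of "\<lambda>e. f (e 0) (e 1) (e 2) (e 3) (e 4)"
      "\<lambda>k. if k = 0 then t else if k = 1 then u else if k = 2 then v else if k = 3 then w else x"]
  by simp

named_theorems comp_intros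

lemmas [comp_intros] = computable_var computable_const computable_Suc

lemma computable_pred [comp_intros]:
  assumes "computable t" shows "computable (\<lambda>e. t e - 1)"
proof -
  have "n - 1 = rec_nat 0 (\<lambda>i a. i) n" for n :: nat by (cases n) auto
  then show ?thesis
    using computable_rec_nat[where h = "\<lambda>e i a. i" and b = "\<lambda>e. 0", OF _ _ assms]
    by (simp add: comp_intros)
qed

lemma computable_add [comp_intros]:
  assumes "computable t" "computable u" shows "computable (\<lambda>e. t e + u e)"
proof -
  have "x + y = rec_nat x (\<lambda>i a. Suc a) y" for x y :: nat by (induction y) auto
  then show ?thesis using computable_rec_nat[where h = "\<lambda>e i a. Suc a", OF assms(1) _ assms(2)]
    by (simp add: comp_intros)
qed

lemma computable_mult [comp_intros]:
  assumes "computable t" "computable u" shows "computable (\<lambda>e. t e * u e)"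
proof (rule computable2[OF _ assms])
  have "x * y = rec_nat 0 (\<lambda>i a. a + x) y" for x y :: nat by (induction y) auto
  then show "computable (\<lambda>e. e 0 * e 1)"
    using computable_rec_nat[where h = "\<lambda>e i a. a + e 0" and b = "\<lambda>e. 0" and t = "\<lambda>e. e 1"]
    by (simp add: comp_intros)
qed

lemma computable_diff [comp_intros]:
  assumes "computable t" "computable u" shows "computable (\<lambda>e. t e - u e)"
proof (rule computable2[OF _ assms])
  have *: "x - y = rec_nat x (\<lambda>i a. a - 1) y" for x y :: nat by (induction y) auto
  have "computable (\<lambda>e. rec_nat (e 0) (\<lambda>i a. a - 1) (e 1))"
    by (rule computable_rec_nat[where h = "\<lambda>e i a. a - 1"]) (intro comp_intros)+
  then show "computable (\<lambda>e. e 0 - e 1)" by (simp only: *[symmetric])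
qed

lemma computable_power [comp_intros]:
  assumes "computable t" "computable u" shows "computable (\<lambda>e. t e ^ u e)"
proof (rule computable2[OF _ assms])
  have "x ^ y = rec_nat 1 (\<lambda>i a. x * a) y" for x y :: nat by (induction y) auto
  then show "computable (\<lambda>e. e 0 ^ e 1)"
    using computable_rec_nat[where h = "\<lambda>e i a. e 0 * a" and b = "\<lambda>e. 1" and t = "\<lambda>e. e 1"]
    by (simp add: comp_intros del: One_nat_def)
qed

section \<open>Decidable predicates and bounded search\<close>

definition decidable :: "((nat \<Rightarrow> nat) \<Rightarrow> bool) \<Rightarrow> bool" where
  "decidable P \<longleftrightarrow> computable (\<lambda>e. of_bool (P e))"

lemma computable_of_bool [comp_intros]: "decidable P \<Longrightarrow> computable (\<lambda>e. of_bool (P e))"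
  by (simp add: decidable_def)

lemma decidable_const [comp_intros]: "decidable (\<lambda>e. b)"
  unfolding decidable_def by (rule computable_const)

lemma decidable_not [comp_intros]:
  assumes "decidable P" shows "decidable (\<lambda>e. \<not> P e)"
proof -
  have "computable (\<lambda>e. 1 - of_bool (P e))" by (intro comp_intros assms)
  moreover have "(of_bool (\<not> P e) :: nat) = 1 - of_bool (P e)" for e by (cases "P e") auto
  ultimately show ?thesis by (simp only: decidable_def)
qed

lemma decidable_conj [comp_intros]:
  assumes "decidable P" "decidable Q" shows "decidable (\<lambda>e. P e \<and> Q e)"
proof -
  have "computable (\<lambda>e. of_bool (P e) * of_bool (Q e))" by (intro comp_intros assms)
  then show ?thesis by (simp add: decidable_def of_bool_conj)
qed

lemma decidable_disj [comp_intros]: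
  assumes "decidable P" "decidable Q" shows "decidable (\<lambda>e. P e \<or> Q e)"
proof -
  have "decidable (\<lambda>e. \<not> (\<not> P e \<and> \<not> Q e))" by (intro comp_intros assms)
  then show ?thesis by simp
qed

lemma decidable_imp [comp_intros]:
  assumes "decidable P" "decidable Q" shows "decidable (\<lambda>e. P e \<longrightarrow> Q e)"
proof -
  have "decidable (\<lambda>e. \<not> P e \<or> Q e)" by (intro comp_intros assms)
  then show ?thesis by (simp only: imp_conv_disj)
qed

lemma decidable_le [comp_intros]:
  assumes "computable t" "computable u" shows "decidable (\<lambda>e. t e \<le> u e)"
proof -
  have "computable (\<lambda>e. 1 - (t e - u e))" by (intro comp_intros assms)
  moreover have "1 - (t e - u e) = of_bool (t e \<le> u e)" for e by simp
  ultimately show ?thesis by (simp add: decidable_def)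
qed

lemma decidable_less [comp_intros]:
  assumes "computable t" "computable u" shows "decidable (\<lambda>e. t e < u e)"
proof -
  have "decidable (\<lambda>e. \<not> u e \<le> t e)" by (intro comp_intros assms)
  then show ?thesis by (simp add: not_le)
qed

lemma decidable_eq [comp_intros]:
  assumes "computable t" "computable u" shows "decidable (\<lambda>e. t e = u e)"
proof -
  have "decidable (\<lambda>e. t e \<le> u e \<and> u e \<le> t e)" by (intro comp_intros assms)
  then show ?thesis by (simp add: eq_iff[symmetric])
qed

lemma decidable_iff [comp_intros]:
  assumes "decidable P" "decidable Q" shows "decidable (\<lambda>e. P e = Q e)"
proof -
  have "decidable (\<lambda>e. (P e \<longrightarrow> Q e) \<and> (Q e \<longrightarrow> P e))" by (intro comp_intros assms)
  moreover have "(\<lambda>e. (P e \<longrightarrow> Q e) \<and> (Q e \<longrightarrow> P e)) = (\<lambda>e. P e = Q e)" by auto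
  ultimately show ?thesis by simp
qed

lemma computable_if [comp_intros]:
  assumes "decidable P" "computable t" "computable u"
  shows "computable (\<lambda>e. if P e then t e else u e)"
proof -
  have "computable (\<lambda>e. of_bool (P e) * t e + (1 - of_bool (P e)) * u e)" by (intro comp_intros assms)
  moreover have "(\<lambda>e. of_bool (P e) * t e + (1 - of_bool (P e)) * u e) = (\<lambda>e. if P e then t e else u e)" by auto
  ultimately show ?thesis by simp
qed

text \<open>Binders are treated in de Bruijn style: the bound number becomes variable 0 and the
  other variables are shifted by one.\<close>

lemma decidable_ex_less [comp_intros]:
  assumes "computable t" and Q: "decidable (\<lambda>l. Q (\<lambda>k. l (Suc k)) (l 0))"
  shows "decidable (\<lambda>e. \<exists>i<t e. Q e i)"
proof -
  have *: "of_bool (\<exists>i<n. Q e i) = rec_nat 0 (\<lambda>i a. if Q e i then 1 else a) n" for e and n :: nat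
  proof (induction n)
    case (Suc n)
    show ?case by (auto simp: less_Suc_eq Suc[symmetric])
  qed simp
  \<comment> \<open>Primitive recursion has two extra variables; the accumulator, variable 1, is
    skipped.\<close>
  have "decidable (\<lambda>l. Q (\<lambda>k. l (Suc (Suc k))) (l 0))"
    using computable_subst[OF Q[unfolded decidable_def], of "\<lambda>k. if k = 0 then (\<lambda>e. e 0) else (\<lambda>e. e (Suc k))"]
    by (simp add: decidable_def computable_var)
  then have "computable (\<lambda>e. rec_nat 0 (\<lambda>i a. if Q e i then 1 else a) (t e))"
    using computable_rec_nat[where h = "\<lambda>e i a. if Q e i then 1 else a" and b = "\<lambda>e. 0" and t = t] assms(1)
    by (simp add: comp_intros del: One_nat_def)
  then show ?thesis unfolding decidable_def * .
qed

lemma decidable_ex_le [comp_intros]: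
  assumes "computable t" and Q: "decidable (\<lambda>l. Q (\<lambda>k. l (Suc k)) (l 0))"
  shows "decidable (\<lambda>e. \<exists>i\<le>t e. Q e i)"
  using decidable_ex_less[OF computable_Suc[OF assms(1)] Q] by (simp add: less_Suc_eq_le)

lemma decidable_all_less [comp_intros]:
  assumes "computable t" and Q: "decidable (\<lambda>l. Q (\<lambda>k. l (Suc k)) (l 0))"
  shows "decidable (\<lambda>e. \<forall>i<t e. Q e i)"
proof -
  have "decidable (\<lambda>e. \<not> (\<exists>i<t e. \<not> Q e i))" by (intro comp_intros assms)
  then show ?thesis by simp
qed

lemma computable_LEAST [comp_intros]:
  assumes Q: "decidable (\<lambda>l. Q (\<lambda>k. l (Suc k)) (l 0))" and ex: "\<And>e. \<exists>i. Q e i"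
  shows "computable (\<lambda>e. LEAST i. Q e i)"
proof -
  have "computable (\<lambda>e. LEAST i. 1 - (of_bool (Q e i) :: nat) = 0)"
    by (rule computable_LEAST_0) (use ex in \<open>auto intro!: comp_intros Q simp del: One_nat_def\<close>)
  moreover have "(1 - (of_bool (Q e i) :: nat) = 0) = Q e i" for e i by (cases "Q e i") auto
  ultimately show ?thesis by (simp only:)
qed

text \<open>Searching for the value helps where a result is easier to check than to build, as for
  lists given by their entries.\<close>

lemma computable_graph:
  assumes "decidable (\<lambda>l. l 0 = f (\<lambda>k. l (Suc k)))"
  shows "computable f"
proof -
  have "computable (\<lambda>e. LEAST i. i = f e)" by (rule computable_LEAST[OF assms]) auto
  then show ?thesis by (simp add: Least_equality)
qed

text \<open>\<open>computable_LEAST\<close> requires a search that always succeeds; admitting the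
  bound itself as a solution achieves this without affecting the least solution below it.\<close>

lemma computable_bounded_LEAST [comp_intros]:
  assumes t: "computable t" and Q: "decidable (\<lambda>l. Q (\<lambda>k. l (Suc k)) (l 0))"
  shows "computable (\<lambda>e. if \<exists>i<t e. Q e i then LEAST i. i < t e \<and> Q e i else 0)"
proof -
  have t': "computable (\<lambda>l. t (\<lambda>k. l (Suc k)))"
    using computable_subst[OF t, of "\<lambda>k e. e (Suc k)"] by (simp add: computable_var)
  have "computable (\<lambda>e. LEAST i. i < t e \<and> Q e i \<or> i = t e)"
    by (intro comp_intros t' Q) auto
  from computable_if[OF decidable_ex_less[OF t Q] this computable_const[of 0]]
  have "computable (\<lambda>e. if \<exists>i<t e. Q e i then LEAST i. i < t e \<and> Q e i \<or> i = t e else 0)" .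
  moreover have "(LEAST i. i < t e \<and> Q e i \<or> i = t e) = (LEAST i. i < t e \<and> Q e i)" if "\<exists>i<t e. Q e i" for e
  proof -
    from LeastI_ex[of "\<lambda>i. i < t e \<and> Q e i"] that
    have "(LEAST i. i < t e \<and> Q e i) < t e" "Q e (LEAST i. i < t e \<and> Q e i)" by auto
    then show ?thesis by (intro Least_equality) (auto intro: Least_le)
  qed
  ultimately show ?thesis by (simp cong: if_cong)
qed

lemma computable_triangle:
  assumes "computable t" shows "computable (\<lambda>e. triangle (t e))"
proof -
  have "triangle n = rec_nat 0 (\<lambda>i a. a + Suc i) n" for n by (induction n) auto
  then show ?thesis
    using computable_rec_nat[where h = "\<lambda>e i a. a + Suc i" and b = "\<lambda>e. 0", OF _ _ assms]
    by (simp add: comp_intros)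
qed

lemma computable_prod_encode [comp_intros]:
  "computable t \<Longrightarrow> computable u \<Longrightarrow> computable (\<lambda>e. prod_encode (t e, u e))"
  unfolding prod_encode_def by (simp add: comp_intros computable_triangle)

lemma computable_fst_prod_decode [comp_intros]:
  assumes "computable t" shows "computable (\<lambda>e. fst (prod_decode (t e)))"
proof (rule computable1[where f = "\<lambda>z. fst (prod_decode z)", OF _ assms])
  have *: "fst (prod_decode z) = (LEAST x. \<exists>y\<le>z. prod_encode (x, y) = z)" for z
    by (rule Least_equality[symmetric])
      (auto intro!: exI[of _ "snd (prod_decode z)"] snd_prod_decode_le)
  have ex: "\<exists>x. \<exists>y\<le>z. prod_encode (x, y) = z" for z
    by (rule exI[of _ "fst (prod_decode z)"]) (auto intro!: exI[of _ "snd (prod_decode z)"] snd_prod_decode_le)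
  show "computable (\<lambda>e. fst (prod_decode (e 0)))"
    unfolding * by (intro comp_intros ex)
qed

lemma computable_snd_prod_decode [comp_intros]:
  assumes "computable t" shows "computable (\<lambda>e. snd (prod_decode (t e)))"
proof (rule computable1[where f = "\<lambda>z. snd (prod_decode z)", OF _ assms])
  have *: "snd (prod_decode z) = (LEAST y. \<exists>x\<le>z. prod_encode (x, y) = z)" for z
    by (rule Least_equality[symmetric])
      (auto intro!: exI[of _ "fst (prod_decode z)"] fst_prod_decode_le)
  have ex: "\<exists>y. \<exists>x\<le>z. prod_encode (x, y) = z" for z
    by (rule exI[of _ "snd (prod_decode z)"]) (auto intro!: exI[of _ "fst (prod_decode z)"] fst_prod_decode_le)
  show "computable (\<lambda>e. snd (prod_decode (e 0)))"
    unfolding * by (intro comp_intros ex)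
qed

section \<open>Computable operations on coded lists\<close>

definition clist :: "((nat \<Rightarrow> nat) \<Rightarrow> nat list) \<Rightarrow> bool" where
  "clist F \<longleftrightarrow> computable (\<lambda>e. list_encode (F e))"

lemma computable_list_encode [comp_intros]: "clist F \<Longrightarrow> computable (\<lambda>e. list_encode (F e))"
  by (simp add: clist_def)

lemma clist_decode [comp_intros]: "computable t \<Longrightarrow> clist (\<lambda>e. list_decode (t e))"
  by (simp add: clist_def)

lemma clist_const [comp_intros]: "clist (\<lambda>e. xs)"
  unfolding clist_def by (rule computable_const)

lemma clist_Cons [comp_intros]: "computable t \<Longrightarrow> clist F \<Longrightarrow> clist (\<lambda>e. t e # F e)"
  unfolding clist_def by (simp add: comp_intros)

lemma clist_tl [comp_intros]:
  assumes "clist F" shows "clist (\<lambda>e. tl (F e))"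
proof -
  have "list_encode (tl xs) = snd (prod_decode (list_encode xs - 1)) * of_bool (list_encode xs \<noteq> 0)" for xs
    by (cases xs) auto
  note * = this
  have "computable (\<lambda>e. snd (prod_decode (list_encode (F e) - 1)) * of_bool (list_encode (F e) \<noteq> 0))"
    by (intro comp_intros assms)
  then show ?thesis unfolding clist_def * .
qed

lemma clist_drop [comp_intros]:
  assumes "clist F" "computable t" shows "clist (\<lambda>e. drop (t e) (F e))"
proof -
  have *: "list_encode (drop n xs) = rec_nat (list_encode xs) (\<lambda>i a. list_encode (tl (list_decode a))) n" for n xs
  proof (induction n)
    case (Suc n)
    show ?case by (simp add: Suc[symmetric] drop_Suc tl_drop)
  qed simp
  have "computable (\<lambda>e. rec_nat (list_encode (F e)) (\<lambda>i a. list_encode (tl (list_decode a))) (t e))"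
    by (rule computable_rec_nat[where h = "\<lambda>e i a. list_encode (tl (list_decode a))"])
      (intro comp_intros assms)+
  then show ?thesis unfolding clist_def * .
qed

lemma computable_length [comp_intros]:
  assumes "clist F" shows "computable (\<lambda>e. length (F e))"
proof -
  have *: "length xs = (LEAST n. list_encode (drop n xs) = 0)" for xs
  proof (rule Least_equality[symmetric])
    fix n assume "list_encode (drop n xs) = 0"
    then have "drop n xs = []" by (metis list_encode.simps(1) list_encode_inverse)
    then show "length xs \<le> n" by simp
  qed simp
  have ex: "\<exists>n. list_encode (drop n (list_decode z)) = 0" for z
    by (rule exI[of _ "length (list_decode z)"]) simp
  have "computable (\<lambda>e. (\<lambda>z. LEAST n. list_encode (drop n (list_decode z)) = 0) (list_encode (F e)))"
    by (rule computable1[where f = "\<lambda>z. LEAST n. list_encode (drop n (list_decode z)) = 0"])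
      (intro comp_intros assms ex)+
  then show ?thesis unfolding * by simp
qed

lemma computable_nth0 [comp_intros]:
  assumes "clist F" "computable t" shows "computable (\<lambda>e. nth0 (F e) (t e))"
proof -
  have *: "nth0 xs i = (if i < length xs then fst (prod_decode (list_encode (drop i xs) - 1)) else 0)" for xs i
    by (auto simp: nth0_def Cons_nth_drop_Suc[symmetric])
  show ?thesis unfolding * by (intro comp_intros assms)
qed

lemma decidable_list_eq [comp_intros]:
  assumes "clist F" "clist G" shows "decidable (\<lambda>e. F e = G e)"
proof -
  have "decidable (\<lambda>e. list_encode (F e) = list_encode (G e))" by (intro comp_intros assms)
  then show ?thesis by (simp only: list_encode_eq)
qed

lemma clist_shift: "clist F \<Longrightarrow> clist (\<lambda>l. F (\<lambda>k. l (Suc k)))"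
  unfolding clist_def
  using computable_subst[of "\<lambda>e. list_encode (F e)" "\<lambda>k e. e (Suc k)"] by (simp add: computable_var)

lemma computable_shift: "computable F \<Longrightarrow> computable (\<lambda>l. F (\<lambda>k. l (Suc k)))"
  using computable_subst[of F "\<lambda>k e. e (Suc k)"] by (simp add: computable_var)

lemma clist_map_upt [comp_intros]:
  assumes n: "computable n" and g: "computable (\<lambda>l. g (\<lambda>k. l (Suc k)) (l 0))"
  shows "clist (\<lambda>e. map (g e) [0..<n e])"
  unfolding clist_def
proof (rule computable_graph)
  have *: "(l 0 = list_encode (map (g (\<lambda>k. l (Suc k))) [0..<n (\<lambda>k. l (Suc k))])) \<longleftrightarrow>
     length (list_decode (l 0)) = n (\<lambda>k. l (Suc k)) \<and>
     (\<forall>i<length (list_decode (l 0)). nth0 (list_decode (l 0)) i = g (\<lambda>k. l (Suc k)) i)" for l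
  proof -
    have "(l 0 = list_encode (map (g (\<lambda>k. l (Suc k))) [0..<n (\<lambda>k. l (Suc k))])) \<longleftrightarrow>
      list_decode (l 0) = map (g (\<lambda>k. l (Suc k))) [0..<n (\<lambda>k. l (Suc k))]"
      by (metis list_decode_inverse list_encode_inverse)
    then show ?thesis by (auto simp: list_eq_iff_nth_eq nth0_def)
  qed
  have "computable (\<lambda>l. g (\<lambda>k. l (Suc (Suc k))) (l 0))"
    using computable_subst[OF g, of "\<lambda>k. if k = 0 then (\<lambda>e. e 0) else (\<lambda>e. e (Suc k))"]
    by (simp add: computable_var)
  then show "decidable (\<lambda>l. l 0 = list_encode (map (g (\<lambda>k. l (Suc k))) [0..<n (\<lambda>k. l (Suc k))]))"
    unfolding * by (intro comp_intros computable_shift[OF n])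
qed

section \<open>Legitimacy is decidable\<close>

lemma clist_if [comp_intros]:
  assumes "decidable P" "clist F" "clist G"
  shows "clist (\<lambda>e. if P e then F e else G e)"
proof -
  have "computable (\<lambda>e. if P e then list_encode (F e) else list_encode (G e))" by (intro comp_intros assms)
  then show ?thesis by (simp add: clist_def if_distrib)
qed

lemma computable_div [comp_intros]:
  assumes "computable t" "computable u" shows "computable (\<lambda>e. t e div u e)"
proof (rule computable2[OF _ assms])
  \<comment> \<open>The disjunct y = 0 makes the search total and gives 0, the value of
    \<open>x div 0\<close>.\<close>
  have *: "x div y = (LEAST q. y = 0 \<or> x < y * Suc q)" for x y :: nat
  proof (cases "y = 0")
    case False
    show ?thesis
    proof (rule Least_equality[symmetric])
      show "y = 0 \<or> x < y * Suc (x div y)"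
        using False by (simp add: dividend_less_times_div)
      show "x div y \<le> q" if "y = 0 \<or> x < y * Suc q" for q
        using that False by (simp add: less_mult_imp_div_less mult.commute flip: less_Suc_eq_le)
    qed
  qed simp
  have ex: "\<exists>q. y = 0 \<or> x < y * Suc q" for x y :: nat
    by (rule exI[of _ x]) (cases y; simp)
  show "computable (\<lambda>e. e 0 div e 1)"
    unfolding * by (intro comp_intros ex)
qed

lemma computable_mod [comp_intros]:
  assumes "computable t" "computable u" shows "computable (\<lambda>e. t e mod u e)"
  unfolding modulo_nat_def by (intro comp_intros assms)

lemma computable_sum [comp_intros]:
  assumes n: "computable n" and g: "computable (\<lambda>l. g (\<lambda>k. l (Suc k)) (l 0))"
  shows "computable (\<lambda>e. \<Sum>i<n e. g e i)"
proof -
  have *: "(\<Sum>i<m. g e i) = rec_nat 0 (\<lambda>i a. a + g e i) m" for m e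
    by (induction m) auto
  have "computable (\<lambda>l. g (\<lambda>k. l (Suc (Suc k))) (l 0))"
    using computable_subst[OF g, of "\<lambda>k. if k = 0 then (\<lambda>e. e 0) else (\<lambda>e. e (Suc k))"]
    by (simp add: computable_var)
  then show ?thesis
    unfolding * by (intro computable_rec_nat[where h = "\<lambda>e i a. a + g e i"] n comp_intros)
qed

lemma clist_take [comp_intros]:
  assumes "clist F" "computable t" shows "clist (\<lambda>e. take (t e) (F e))"
proof -
  have *: "take n xs = map (nth0 xs) [0..<if n \<le> length xs then n else length xs]" for n and xs :: "nat list"
    by (rule nth_equalityI) (auto simp: nth0_def)
  show ?thesis unfolding * by (intro clist_map_upt comp_intros clist_shift assms)
qed

lemma clist_snoc [comp_intros]:
  assumes "clist F" "computable t" shows "clist (\<lambda>e. F e @ [t e])"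
proof -
  have *: "xs @ [a] = map (\<lambda>i. if i < length xs then nth0 xs i else a) [0..<Suc (length xs)]"
    for a and xs :: "nat list"
    by (rule nth_equalityI) (auto simp: nth0_def nth_append simp del: upt_Suc)
  show ?thesis unfolding *
    by (intro clist_map_upt comp_intros clist_shift computable_shift assms)
qed

lemma clist_fsts [comp_intros]:
  assumes "clist F" shows "clist (\<lambda>e. fsts (F e))"
proof -
  have *: "fsts xs = map (\<lambda>i. fst (prod_decode (nth0 xs i))) [0..<length xs]" for xs
    by (rule nth_equalityI) (auto simp: nth0_def fsts_def)
  show ?thesis unfolding *
    by (intro clist_map_upt comp_intros clist_shift computable_shift assms)
qed

lemma decidable_prefix [comp_intros]:
  assumes "clist F" "clist G" shows "decidable (\<lambda>e. prefix (F e) (G e))"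
proof -
  have *: "prefix xs ys \<longleftrightarrow> xs = take (length xs) ys" for xs ys :: "nat list"
    by (metis append_eq_conv_conj prefix_def take_is_prefix)
  show ?thesis unfolding * by (intro comp_intros assms)
qed

text \<open>Strings over \<open>{0, 1, 2}\<close> as base 4 numbers without the digit 0; shorter strings get smaller codes.\<close>

definition enc :: "nat list \<Rightarrow> nat" where
  "enc xs = (\<Sum>i<length xs. Suc (nth0 xs i) * 4 ^ i)"

definition dec :: "nat \<Rightarrow> nat list" where
  "dec x = map (\<lambda>i. x div 4 ^ i mod 4 - 1) [0..<LEAST n. x < 4 ^ n]"

lemma enc_Cons: "enc (d # xs) = Suc d + 4 * enc xs"
proof -
  have "nth0 (d # xs) (Suc i) = nth0 xs i" "nth0 (d # xs) 0 = d" for i by (auto simp: nth0_def)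
  then show ?thesis
    by (simp add: enc_def sum.lessThan_Suc_shift sum_distrib_left algebra_simps del: sum.lessThan_Suc)
qed

lemma enc_bounds: "set xs \<subseteq> {..2} \<Longrightarrow> enc xs < 4 ^ length xs \<and> (xs \<noteq> [] \<longrightarrow> 4 ^ (length xs - 1) \<le> enc xs)"
proof (induction xs)
  case (Cons d xs)
  then show ?case by (cases xs) (auto simp: enc_Cons)
qed (simp add: enc_def)

lemma enc_digit: "set xs \<subseteq> {..2} \<Longrightarrow> i < length xs \<Longrightarrow> enc xs div 4 ^ i mod 4 = Suc (xs ! i)"
proof (induction xs arbitrary: i)
  case (Cons d xs)
  have d: "(Suc d + 4 * enc xs) div 4 = enc xs" "(Suc d + 4 * enc xs) mod 4 = Suc d"
    using Cons.prems by auto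
  show ?case
  proof (cases i)
    case 0
    then show ?thesis using d by (simp add: enc_Cons)
  next
    case (Suc j)
    have "(Suc d + 4 * enc xs) div 4 ^ i = enc xs div 4 ^ j"
      unfolding Suc power_Suc div_mult2_eq d ..
    then show ?thesis using Cons Suc by (simp add: enc_Cons)
  qed
qed simp

lemma dec_enc: "set xs \<subseteq> {..2} \<Longrightarrow> dec (enc xs) = xs"
proof -
  assume xs: "set xs \<subseteq> {..2}"
  have "(LEAST n. enc xs < 4 ^ n) = length xs"
  proof (rule Least_equality)
    fix n assume n: "enc xs < 4 ^ n"
    show "length xs \<le> n"
    proof (rule ccontr)
      assume "\<not> length xs \<le> n"
      then have "(4::nat) ^ n \<le> 4 ^ (length xs - 1)" "xs \<noteq> []" by (auto intro: power_increasing)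
      then have "4 ^ n \<le> enc xs" using enc_bounds[OF xs] order_trans by blast
      then show False using n by simp
    qed
  qed (use enc_bounds[OF xs] in simp)
  then show ?thesis
    unfolding dec_def by (intro nth_equalityI) (auto simp: enc_digit[OF xs])
qed

text \<open>These bounds hold for every number, also for those outside the range of
  \<open>enc\<close>, over all of which the course-of-values recursion runs.\<close>

lemma dec_bounds: "set (dec x) \<subseteq> {..2}" "dec x \<noteq> [] \<Longrightarrow> 4 ^ (length (dec x) - 1) \<le> x"
proof -
  have "n mod 4 - 1 \<le> 2" for n :: nat using mod_less_divisor[of 4 n] by linarith
  then show "set (dec x) \<subseteq> {..2}" by (auto simp: dec_def)
  assume "dec x \<noteq> []"
  then have "(LEAST n. x < 4 ^ n) - 1 < (LEAST n. x < 4 ^ n)" by (simp add: dec_def)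
  from not_less_Least[OF this] show "4 ^ (length (dec x) - 1) \<le> x" by (simp add: dec_def)
qed

lemma computable_enc [comp_intros]:
  assumes "clist F" shows "computable (\<lambda>e. enc (F e))"
  unfolding enc_def by (intro comp_intros assms clist_shift)

lemma less_power4: "x < 4 ^ x" for x :: nat
  by (induction x) auto

lemma clist_dec [comp_intros]:
  assumes "computable t" shows "clist (\<lambda>e. dec (t e))"
proof -
  have ex: "\<exists>n. x < 4 ^ n" for x :: nat using less_power4 by blast
  show ?thesis unfolding dec_def by (intro clist_map_upt comp_intros computable_shift assms ex)
qed

section \<open>Course-of-values recursion over coded tables\<close>

text \<open>Stands in for a recursive call: \<open>T\<close> lists the earlier values, and the
  argument is the code of the relevant part of the table, whose length is the string code
  \<open>a\<close>.\<close>

definition table_lookup :: "nat list \<Rightarrow> (nat \<Rightarrow> nat) \<Rightarrow> nat \<Rightarrow> bool" where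
  "table_lookup T D a \<longleftrightarrow> nth0 T (enc (map D [0..<a])) = 1"

lemma decidable_table_lookup [comp_intros]:
  assumes "clist T" "computable (\<lambda>l. D (\<lambda>k. l (Suc k)) (l 0))" "computable a"
  shows "decidable (\<lambda>e. table_lookup (T e) (D e) (a e))"
  unfolding table_lookup_def by (intro comp_intros assms)

lemma decidable_hit [comp_intros]:
  assumes "clist T" "clist B" "clist R" "computable c" "computable y"
  shows "decidable (\<lambda>e. hit (table_lookup (T e)) (nth0 (B e)) (R e) (c e) (y e))"
  unfolding hit_def by (intro comp_intros clist_shift assms)

lemma clist_extend_to_hit [comp_intros]:
  assumes "clist T" "clist B" "computable j" "clist R" "computable c"
  shows "clist (\<lambda>e. extend_to_hit (table_lookup (T e)) (nth0 (B e)) {..<j e} (R e) (c e))"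
proof -
  have *: "extend_to_hit L D {..<j} \<rho> c = (if \<exists>y<j. hit L D \<rho> c y
      then fsts (list_decode (fst (prod_decode
        (if \<exists>y<j. hit L D \<rho> c y then LEAST y. y < j \<and> hit L D \<rho> c y else 0)))) else \<rho>)" for L D j \<rho> c
    by (auto simp: extend_to_hit_def)
  show ?thesis unfolding *
    by (intro clist_if clist_fsts clist_decode computable_fst_prod_decode computable_bounded_LEAST
        decidable_ex_less decidable_hit clist_shift computable_shift computable_var assms)
qed

lemma clist_stem [comp_intros]:
  assumes "clist T" "clist B" "computable j" "clist A" "computable n"
  shows "clist (\<lambda>e. stem (table_lookup (T e)) (nth0 (B e)) {..<j e} (nth0 (A e)) (n e))"
proof -
  have *: "list_encode (stem L D S a n) =
      rec_nat 0 (\<lambda>i z. list_encode (extend_to_hit L D S (list_decode z @ [a i]) i)) n" for L D S a n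
  proof (induction n)
    case (Suc n)
    show ?case by (simp add: Suc[symmetric])
  qed simp
  have sh: "clist F \<Longrightarrow> clist (\<lambda>l. F (\<lambda>k. l (Suc (Suc k))))" for F
    by (rule clist_shift[of "\<lambda>l. F (\<lambda>k. l (Suc k))"]) (rule clist_shift)
  have sh': "computable F \<Longrightarrow> computable (\<lambda>l. F (\<lambda>k. l (Suc (Suc k))))" for F
    by (rule computable_shift[of "\<lambda>l. F (\<lambda>k. l (Suc k))"]) (rule computable_shift)
  show ?thesis unfolding clist_def *
    by (rule computable_rec_nat[where h = "\<lambda>e i z. list_encode (extend_to_hit (table_lookup (T e)) (nth0 (B e)) {..<j e}
          (list_decode z @ [nth0 (A e) i]) i)"])
      (intro comp_intros sh sh' assms)+
qed

lemma decidable_bex_hit [comp_intros]: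
  assumes "clist T" "clist B" "computable j" "clist R" "computable c"
  shows "decidable (\<lambda>e. \<exists>z\<in>{..<j e}. hit (table_lookup (T e)) (nth0 (B e)) (R e) (c e) z)"
  unfolding Bex_def lessThan_iff
  by (intro decidable_ex_less[unfolded Bex_def] decidable_hit clist_shift computable_shift computable_var assms)

lemma computable_next_table [comp_intros]:
  assumes "clist T" "clist B" "computable j" "computable y"
  shows "computable (\<lambda>e. next_table (table_lookup (T e)) (nth0 (B e)) {..<j e} (y e))"
  unfolding next_table_def Let_def by (intro comp_intros assms)

lemma decidable_consistent [comp_intros]:
  assumes "clist T" "clist B" "computable j" "clist G"
  shows "decidable (\<lambda>e. consistent (table_lookup (T e)) (nth0 (B e)) {..<j e} (G e))"
  unfolding consistent_def Let_def
  by (intro comp_intros clist_shift computable_shift assms)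

lemma decidable_legit_step [comp_intros]:
  assumes "clist T" "clist B" "computable a"
  shows "decidable (\<lambda>e. legit_step (table_lookup (T e)) (nth0 (B e)) (a e))"
  unfolding legit_step_def Let_def
  by (intro comp_intros clist_shift computable_shift assms)

lemma computable_course_of_values:
  assumes "computable (\<lambda>e. \<Phi> (list_decode (e 0)) (e 1))" and f: "\<And>x. f x = \<Phi> (map f [0..<x]) x"
  shows "computable (\<lambda>e. f (e 0))"
proof -
  have *: "list_encode (map f [0..<n]) =
      rec_nat 0 (\<lambda>i z. list_encode (list_decode z @ [\<Phi> (list_decode z) i])) n" for n
  proof (induction n)
    case (Suc n)
    show ?case by (simp add: Suc[symmetric] f[of n, symmetric])
  qed simp
  have \<Phi>: "computable (\<lambda>l. \<Phi> (list_decode (l 1)) (l 0))"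
    using computable2[OF assms(1), of "\<lambda>l. l 1" "\<lambda>l. l 0"] by (simp add: computable_var)
  have "computable (\<lambda>e. rec_nat 0 (\<lambda>i z. list_encode (list_decode z @ [\<Phi> (list_decode z) i])) (e 0))"
    by (rule computable_rec_nat[where h = "\<lambda>e i z. list_encode (list_decode z @ [\<Phi> (list_decode z) i])"])
      (intro comp_intros \<Phi>)+
  then have "clist (\<lambda>e. map f [0..<e 0])" unfolding clist_def * .
  then have "computable (\<lambda>e. list_encode (map f [0..<e 0]))" by (rule computable_list_encode)
  from computable2[OF assms(1) this computable_var[of 0]] show ?thesis by (simp add: f[symmetric])
qed

lemma next_table_le_2: "next_table L D S y \<le> 2"
  by (simp add: next_table_def Let_def)

text \<open>Every shorter table has a smaller code whatever its entries. So a call for a smaller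
  string refers to an earlier value even when it is made for a different table.\<close>

lemma enc_map_less:
  assumes "a < length (dec x)" "\<And>y. D y \<le> 2"
  shows "enc (map D [0..<a]) < x"
proof -
  have "enc (map D [0..<a]) < 4 ^ a" using enc_bounds[of "map D [0..<a]"] assms(2) by auto
  also have "\<dots> \<le> 4 ^ (length (dec x) - 1)" using assms(1) by (auto intro: power_increasing)
  also have "\<dots> \<le> x" using assms(1) by (intro dec_bounds) auto
  finally show ?thesis .
qed

lemma legit_dec_enc:
  assumes "\<And>y. D y \<le> 2"
  shows "legit (nth0 (dec (enc (map D [0..<a])))) (length (dec (enc (map D [0..<a])))) = legit D a"
proof -
  have "dec (enc (map D [0..<a])) = map D [0..<a]" by (rule dec_enc) (use assms in auto)
  moreover have "legit (nth0 (map D [0..<a])) a = legit D a"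
    by (rule legit_cong) (simp add: nth0_def)
  ultimately show ?thesis by simp
qed

text \<open>The table and the string code are merged into one number, and \<open>legit_step\<close>
  is evaluated with lookups for its calls. By \<open>legit_step_cong\<close> only lookups at smaller
  string codes have to be correct.\<close>

lemma decidable_legit_dec: "decidable (\<lambda>e. legit (nth0 (dec (e 0))) (length (dec (e 0))))"
  unfolding decidable_def
proof (rule computable_course_of_values[where f = "\<lambda>x. of_bool (legit (nth0 (dec x)) (length (dec x)))"])
  define f :: "nat \<Rightarrow> nat" where "f x = of_bool (legit (nth0 (dec x)) (length (dec x)))" for x
  have f_enc: "f (enc (map D [0..<a])) = of_bool (legit D a)" if "\<And>y. D y \<le> 2" for D a
    using legit_dec_enc[OF that] by (simp add: f_def)
  show "computable (\<lambda>e. of_bool (legit_step (table_lookup (list_decode (e 0))) (nth0 (dec (e 1))) (length (dec (e 1)))))"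
    by (intro comp_intros)
  fix x
  have table_lookup: "table_lookup (map f [0..<x]) D a = legit D a" if "a < length (dec x)" "\<And>y. D y \<le> 2" for D a
    using enc_map_less[OF that] f_enc[OF that(2)] by (auto simp: table_lookup_def nth0_def)
  have D: "nth0 (dec x) y \<le> 2" for y
    using dec_bounds(1)[of x] nth_mem[of y "dec x"] by (auto simp: nth0_def simp del: nth_mem)
  have "legit (nth0 (dec x)) (length (dec x)) = legit_step (table_lookup (map f [0..<x])) (nth0 (dec x)) (length (dec x))"
    unfolding legit_legit_step[of "nth0 (dec x)"]
  proof (rule legit_step_cong)
    fix j a' assume "a' < length (dec x)"
      "next_table legit (nth0 (dec x)) {..<j} = next_table (table_lookup (map f [0..<x])) (nth0 (dec x)) {..<j}"
    then show "legit (next_table legit (nth0 (dec x)) {..<j}) a' =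
      table_lookup (map f [0..<x]) (next_table (table_lookup (map f [0..<x])) (nth0 (dec x)) {..<j}) a'"
      by (simp add: table_lookup next_table_le_2)
  qed (simp_all add: table_lookup D)
  then show "of_bool (legit (nth0 (dec x)) (length (dec x))) =
     (of_bool (legit_step (table_lookup (map (\<lambda>x. of_bool (legit (nth0 (dec x)) (length (dec x)))) [0..<x]))
        (nth0 (dec x)) (length (dec x))) :: nat)"
    unfolding f_def by simp
qed

lemma decidable_legit:
  assumes "computable (\<lambda>e. D (e 0))" "\<And>y. D y \<le> 2" "computable a"
  shows "decidable (\<lambda>e. legit D (a e))"
proof -
  have D: "computable t \<Longrightarrow> computable (\<lambda>e. D (t e))" for t by (rule computable1[OF assms(1)])
  have "computable (\<lambda>e. enc (map D [0..<a e]))"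
    by (intro comp_intros D assms)
  from computable1[OF decidable_legit_dec[unfolded decidable_def] this] show ?thesis
    by (simp add: decidable_def legit_dec_enc[OF assms(2)])
qed

section \<open>Compilation to oracle Turing machines\<close>

text \<open>
  Register \<open>j\<close> is the head position on tape \<open>j\<close>. Cell 0 is recognized by a mark: \<open>IMark\<close> turns a blank
  into 3 and the symbol 1 into 2, so that an empty input can still be told from a nonempty one.
\<close>

datatype instr = IMove nat move | IOracle | IJmp nat | IJz nat nat | IJo nat | ISym nat nat nat | IMark

fun instr_act :: "instr \<Rightarrow> nat \<Rightarrow> nat \<Rightarrow> nat list \<Rightarrow> nat \<times> move \<times> (nat \<times> move) list" where
  "instr_act (IMove r d) q b syms =
     (Suc q, Stay, map (\<lambda>j. (syms ! j, if j = r then d else Stay)) [0..<length syms])"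
| "instr_act IOracle q b syms = (Suc q, Right, map (\<lambda>a. (a, Stay)) syms)"
| "instr_act (IJmp l) q b syms = (l, Stay, map (\<lambda>a. (a, Stay)) syms)"
| "instr_act (IJz r l) q b syms = (if syms ! r \<ge> 2 then l else Suc q, Stay, map (\<lambda>a. (a, Stay)) syms)"
| "instr_act (IJo l) q b syms = (if b \<noteq> 1 then l else Suc q, Stay, map (\<lambda>a. (a, Stay)) syms)"
| "instr_act (ISym r x l) q b syms = (if syms ! r \<noteq> x then l else Suc q, Stay, map (\<lambda>a. (a, Stay)) syms)"
| "instr_act IMark q b syms = (Suc q, Stay, map (\<lambda>a. (if a = 0 then 3 else 2, Stay)) syms)"

text \<open>Bounding the scanned symbols makes the transition table finite. On such symbols every
  state below the program length has a transition, so a run stops only by leaving the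
  program.\<close>

definition machine :: "nat \<Rightarrow> instr list \<Rightarrow> nat \<Rightarrow> oracle_tm" where
  "machine K P acc = \<lparr>num_tapes = K, start_state = 0, accept_state = acc,
     transition = (\<lambda>(q, b, syms).
       if q < length P \<and> b \<le> 2 \<and> length syms = K \<and> set syms \<subseteq> {..3}
       then Some (instr_act (P ! q) q b syms) else None)\<rparr>"

lemma length_instr_act: "length (snd (snd (instr_act i q b syms))) = length syms"
  by (cases i) auto

lemma wf_machine: "wf_oracle_tm (machine K P acc)"
  unfolding wf_oracle_tm_def
proof
  have "dom (transition (machine K P acc)) \<subseteq>
      {..<length P} \<times> {..2} \<times> {syms. set syms \<subseteq> {..3} \<and> length syms = K}"
    by (auto simp: machine_def split: if_splits)
  moreover have "finite ({..<length P} \<times> {..2 :: nat} \<times> {syms :: nat list. set syms \<subseteq> {..3} \<and> length syms = K})"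
    by (intro finite_cartesian_product finite_lists_length_eq) auto
  ultimately show "finite (dom (transition (machine K P acc)))"
    using finite_subset by fastforce
  have "length (snd (snd x)) = K" if x: "x \<in> ran (transition (machine K P acc))" for x
  proof -
    obtain y where "transition (machine K P acc) y = Some x" using x by (auto simp: ran_def)
    moreover obtain q b syms where "y = (q, b, syms)" by (cases y)
    ultimately have "transition (machine K P acc) (q, b, syms) = Some x" by simp
    then show ?thesis using length_instr_act by (auto simp: machine_def split: if_splits)
  qed
  then show "\<forall>(q, d, acts)\<in>ran (transition (machine K P acc)). length acts = num_tapes (machine K P acc)"
    by (auto simp: machine_def)
qed

section \<open>Simulation of register programs\<close>

text \<open>After the initial marking the tapes are never changed, since all information sits in the
  head positions; therefore \<open>tp\<close> is a fixed parameter of the simulation.\<close>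

definition marked :: "(nat \<Rightarrow> nat \<Rightarrow> nat) \<Rightarrow> bool" where
  "marked tp \<longleftrightarrow> (\<forall>j. 2 \<le> tp j 0 \<and> tp j 0 \<le> 3 \<and> (\<forall>p>0. tp j p \<le> 1))"

definition conf :: "nat \<Rightarrow> (nat \<Rightarrow> nat \<Rightarrow> nat) \<Rightarrow> nat \<Rightarrow> (nat \<Rightarrow> nat) \<times> nat \<Rightarrow> config" where
  "conf K tp q sp = \<lparr>state = q, oracle_pos = snd sp, work_tapes = map (\<lambda>j. (tp j, fst sp j)) [0..<K]\<rparr>"

lemma oracle_tape_le: "oracle_tape X p \<le> 2"
  by (simp add: oracle_tape_def)

lemma marked_ge2: "marked tp \<Longrightarrow> 2 \<le> tp j p \<longleftrightarrow> p = 0"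
  unfolding marked_def by (metis neq0_conv not_less_eq_eq numeral_2_eq_2 One_nat_def)

lemma marked_le3: "marked tp \<Longrightarrow> tp j p \<le> 3"
  unfolding marked_def by (metis One_nat_def le_trans neq0_conv one_le_numeral)

lemma step_machine:
  assumes "q < length P" "\<And>j. j < K \<Longrightarrow> tp j (s j) \<le> 3"
  shows "step (machine K P acc) X (conf K tp q (s, p)) =
    (case instr_act (P ! q) q (oracle_tape X p) (map (\<lambda>j. tp j (s j)) [0..<K]) of
       (q', d, acts) \<Rightarrow> Some \<lparr>state = q', oracle_pos = move_head d p,
         work_tapes = map2 act_on_tape acts (map (\<lambda>j. (tp j, s j)) [0..<K])\<rparr>)"
proof -
  have 1: "map scan (work_tapes (conf K tp q (s, p))) = map (\<lambda>j. tp j (s j)) [0..<K]"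
    by (simp add: conf_def comp_def)
  have 2: "set (map (\<lambda>j. tp j (s j)) [0..<K]) \<subseteq> {..3}" using assms(2) by auto
  show ?thesis unfolding step_def 1 using assms(1) 2 oracle_tape_le[of X p]
    by (simp add: machine_def conf_def)
qed

lemma map2_stay: "map2 act_on_tape (map (\<lambda>a. (a, Stay)) (map (\<lambda>j. tp j (s j)) [0..<K]))
   (map (\<lambda>j. (tp j, s j)) [0..<K]) = map (\<lambda>j. (tp j, s j)) [0..<K]"
  by (rule nth_equalityI) auto

lemma step_instr:
  assumes "q < length P" "\<And>j. j < K \<Longrightarrow> tp j (s j) \<le> 3"
  shows "P ! q = IMove r d \<Longrightarrow> step (machine K P acc) X (conf K tp q (s, p)) =
      Some (conf K tp (Suc q) (s(r := move_head d (s r)), p))"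
    and "P ! q = IOracle \<Longrightarrow> step (machine K P acc) X (conf K tp q (s, p)) = Some (conf K tp (Suc q) (s, Suc p))"
    and "P ! q = IJmp l \<Longrightarrow> step (machine K P acc) X (conf K tp q (s, p)) = Some (conf K tp l (s, p))"
    and "r < K \<Longrightarrow> P ! q = IJz r l \<Longrightarrow> step (machine K P acc) X (conf K tp q (s, p)) =
      Some (conf K tp (if tp r (s r) \<ge> 2 then l else Suc q) (s, p))"
    and "P ! q = IJo l \<Longrightarrow> step (machine K P acc) X (conf K tp q (s, p)) =
      Some (conf K tp (if oracle_tape X p \<noteq> 1 then l else Suc q) (s, p))"
    and "r < K \<Longrightarrow> P ! q = ISym r x l \<Longrightarrow> step (machine K P acc) X (conf K tp q (s, p)) =
      Some (conf K tp (if tp r (s r) \<noteq> x then l else Suc q) (s, p))"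
    and "P ! q = IMark \<Longrightarrow> step (machine K P acc) X (conf K tp q (s, p)) =
      Some (conf K (\<lambda>j. (tp j)(s j := if tp j (s j) = 0 then 3 else 2)) (Suc q) (s, p))"
proof -
  have st: "step (machine K P acc) X (conf K tp q (s, p)) =
    (case instr_act (P ! q) q (oracle_tape X p) (map (\<lambda>j. tp j (s j)) [0..<K]) of
       (q', d, acts) \<Rightarrow> Some \<lparr>state = q', oracle_pos = move_head d p,
         work_tapes = map2 act_on_tape acts (map (\<lambda>j. (tp j, s j)) [0..<K])\<rparr>)"
    by (rule step_machine[of q P K tp s, OF assms])
  have move: "map2 act_on_tape (map (\<lambda>j. (map (\<lambda>j. tp j (s j)) [0..<K] ! j, if j = r then d else Stay)) [0..<K])
      (map (\<lambda>j. (tp j, s j)) [0..<K]) = map (\<lambda>j. (tp j, (s(r := move_head d (s r))) j)) [0..<K]"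
    by (rule nth_equalityI) auto
  have mark: "map2 act_on_tape (map (\<lambda>a. (if a = 0 then 3 else 2, Stay)) (map (\<lambda>j. tp j (s j)) [0..<K]))
      (map (\<lambda>j. (tp j, s j)) [0..<K]) =
      map (\<lambda>j. ((tp j)(s j := if tp j (s j) = 0 then 3 else 2), s j)) [0..<K]"
    by (rule nth_equalityI) auto
  show "P ! q = IMove r d \<Longrightarrow> step (machine K P acc) X (conf K tp q (s, p)) =
      Some (conf K tp (Suc q) (s(r := move_head d (s r)), p))"
    unfolding st by (simp only: instr_act.simps prod.case length_map length_upt diff_zero move)
      (simp add: conf_def)
  show "P ! q = IMark \<Longrightarrow> step (machine K P acc) X (conf K tp q (s, p)) =
      Some (conf K (\<lambda>j. (tp j)(s j := if tp j (s j) = 0 then 3 else 2)) (Suc q) (s, p))"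
    unfolding st by (simp only: instr_act.simps prod.case mark) (simp add: conf_def)
  show "P ! q = IOracle \<Longrightarrow> step (machine K P acc) X (conf K tp q (s, p)) = Some (conf K tp (Suc q) (s, Suc p))"
    "P ! q = IJmp l \<Longrightarrow> step (machine K P acc) X (conf K tp q (s, p)) = Some (conf K tp l (s, p))"
    "P ! q = IJo l \<Longrightarrow> step (machine K P acc) X (conf K tp q (s, p)) =
      Some (conf K tp (if oracle_tape X p \<noteq> 1 then l else Suc q) (s, p))"
    unfolding st by (simp_all only: instr_act.simps prod.case map2_stay) (simp_all add: conf_def)
  show "P ! q = IJz r l \<Longrightarrow> step (machine K P acc) X (conf K tp q (s, p)) =
      Some (conf K tp (if tp r (s r) \<ge> 2 then l else Suc q) (s, p))" if "r < K"
    unfolding st by (simp only: instr_act.simps prod.case map2_stay) (use that in \<open>simp add: conf_def\<close>)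
  show "P ! q = ISym r x l \<Longrightarrow> step (machine K P acc) X (conf K tp q (s, p)) =
      Some (conf K tp (if tp r (s r) \<noteq> x then l else Suc q) (s, p))" if "r < K"
    unfolding st by (simp only: instr_act.simps prod.case map2_stay) (use that in \<open>simp add: conf_def\<close>)
qed

fun csize :: "com \<Rightarrow> nat" where
  "csize (CSeq c\<^sub>1 c\<^sub>2) = csize c\<^sub>1 + csize c\<^sub>2"
| "csize (CWhile r c) = csize c + 2"
| "csize (CWhileOracle c) = csize c + 2"
| "csize _ = 1"

fun compile :: "com \<Rightarrow> nat \<Rightarrow> instr list" where
  "compile (CInc r) a = [IMove r Right]"
| "compile (CDec r) a = [IMove r Left]"
| "compile (CSeq c\<^sub>1 c\<^sub>2) a = compile c\<^sub>1 a @ compile c\<^sub>2 (a + csize c\<^sub>1)"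
| "compile (CWhile r c) a = IJz r (a + csize c + 2) # compile c (Suc a) @ [IJmp a]"
| "compile COracleRight a = [IOracle]"
| "compile (CWhileOracle c) a = IJo (a + csize c + 2) # compile c (Suc a) @ [IJmp a]"

fun regs :: "com \<Rightarrow> nat set" where
  "regs (CInc r) = {r}"
| "regs (CDec r) = {r}"
| "regs (CSeq c\<^sub>1 c\<^sub>2) = regs c\<^sub>1 \<union> regs c\<^sub>2"
| "regs (CWhile r c) = insert r (regs c)"
| "regs COracleRight = {}"
| "regs (CWhileOracle c) = regs c"

lemma finite_regs: "finite (regs c)"
  by (induction c) auto

lemma length_compile [simp]: "length (compile c a) = csize c"
  by (induction c arbitrary: a) auto

definition code_at :: "instr list \<Rightarrow> nat \<Rightarrow> instr list \<Rightarrow> bool" where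
  "code_at P a Q \<longleftrightarrow> (\<exists>us vs. P = us @ Q @ vs \<and> length us = a)"

lemma code_at_append: "code_at P a (Q @ R) \<longleftrightarrow> code_at P a Q \<and> code_at P (a + length Q) R"
proof
  assume "code_at P a (Q @ R)"
  then obtain us vs where "P = us @ (Q @ R) @ vs" "length us = a" by (auto simp: code_at_def)
  then show "code_at P a Q \<and> code_at P (a + length Q) R"
    unfolding code_at_def by (metis append.assoc length_append)
next
  assume "code_at P a Q \<and> code_at P (a + length Q) R"
  then obtain us vs us' vs' where "P = us @ Q @ vs" "length us = a"
    "P = us' @ R @ vs'" "length us' = a + length Q" unfolding code_at_def by blast
  then have "us' = us @ Q" by (metis append.assoc append_eq_append_conv length_append)
  then show "code_at P a (Q @ R)" unfolding code_at_def
    using \<open>P = us' @ R @ vs'\<close> \<open>length us = a\<close> by (metis append.assoc)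
qed

lemma code_at_Cons: "code_at P a (i # Q) \<longleftrightarrow> a < length P \<and> P ! a = i \<and> code_at P (Suc a) Q"
proof -
  have "code_at P a [i] \<longleftrightarrow> a < length P \<and> P ! a = i"
  proof
    assume "a < length P \<and> P ! a = i"
    then have "P = take a P @ [i] @ drop (Suc a) P" "length (take a P) = a" by (auto simp: id_take_nth_drop)
    then show "code_at P a [i]" unfolding code_at_def by blast
  qed (auto simp: code_at_def nth_append)
  then show ?thesis using code_at_append[of P a "[i]" Q] by simp
qed

abbreviation steps :: "oracle_tm \<Rightarrow> (nat \<Rightarrow> nat) \<Rightarrow> config \<Rightarrow> config \<Rightarrow> bool" where
  "steps M X \<equiv> (\<lambda>c c'. step M X c = Some c')\<^sup>*\<^sup>*"

text \<open>One direction suffices: the register programs in question are shown to have an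
  execution, which then yields the run of the machine.\<close>

lemma steps_compile:
  assumes "exec X c sp sp'" "code_at P a (compile c a)" "regs c \<subseteq> {..<K}" "marked tp"
  shows "steps (machine K P acc) X (conf K tp a sp) (conf K tp (a + csize c) sp')"
  using assms(1-3)
proof (induction arbitrary: a rule: exec.induct)
  case (Inc r s p)
  then show ?case using step_instr(1)[of a P K tp s r Right acc X p] marked_le3[OF assms(4)]
    by (auto simp: code_at_Cons)
next
  case (Dec r s p)
  then show ?case using step_instr(1)[of a P K tp s r Left acc X p] marked_le3[OF assms(4)]
    by (auto simp: code_at_Cons)
next
  case (Seq c1 s p s1 p1 c2 s2 p2)
  have "steps (machine K P acc) X (conf K tp a (s, p)) (conf K tp (a + csize c1) (s1, p1))"
    by (rule Seq.IH(1)) (use Seq.prems in \<open>auto simp: code_at_append\<close>)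
  also have "steps (machine K P acc) X \<dots> (conf K tp (a + csize c1 + csize c2) (s2, p2))"
    by (rule Seq.IH(2)) (use Seq.prems in \<open>auto simp: code_at_append\<close>)
  finally show ?case by (simp add: add.assoc)
next
  case (While0 s r c p)
  then show ?case using step_instr(4)[of a P K tp s r "a + csize c + 2" acc X p] marked_le3[OF assms(4)]
    by (auto simp: code_at_Cons marked_ge2[OF assms(4)])
next
  case (While1 s r c p s1 p1 s2 p2)
  have code: "code_at P (Suc a) (compile c (Suc a))" "a < length P" "P ! a = IJz r (a + csize c + 2)"
    "Suc a + csize c < length P" "P ! (Suc a + csize c) = IJmp a"
    using While1.prems by (auto simp: code_at_append code_at_Cons)
  have "step (machine K P acc) X (conf K tp a (s, p)) = Some (conf K tp (Suc a) (s, p))"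
    using step_instr(4)[of a P K tp s r "a + csize c + 2" acc X p] marked_le3[OF assms(4)] While1 code
    by (auto simp: marked_ge2[OF assms(4)])
  then have "steps (machine K P acc) X (conf K tp a (s, p)) (conf K tp (Suc a) (s, p))" by auto
  also have "steps (machine K P acc) X \<dots> (conf K tp (Suc a + csize c) (s1, p1))"
    by (rule While1.IH(1)) (use While1.prems code in auto)
  also have "step (machine K P acc) X \<dots> = Some (conf K tp a (s1, p1))"
    using step_instr(3)[of "Suc a + csize c" P K tp s1 a acc X p1] marked_le3[OF assms(4)] code by auto
  then have "steps (machine K P acc) X (conf K tp (Suc a + csize c) (s1, p1)) (conf K tp a (s1, p1))" by auto
  also have "steps (machine K P acc) X \<dots> (conf K tp (a + csize (CWhile r c)) (s2, p2))"
    by (rule While1.IH(2)) (use While1.prems in auto)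
  finally show ?case .
next
  case (OracleRight s p)
  then show ?case using step_instr(2)[of a P K tp s acc X p] marked_le3[OF assms(4)]
    by (auto simp: code_at_Cons)
next
  case (WhileOracle0 p c s)
  then show ?case using step_instr(5)[of a P K tp s "a + csize c + 2" acc X p] marked_le3[OF assms(4)]
    by (auto simp: code_at_Cons)
next
  case (WhileOracle1 p c s s1 p1 s2 p2)
  have code: "code_at P (Suc a) (compile c (Suc a))" "a < length P" "P ! a = IJo (a + csize c + 2)"
    "Suc a + csize c < length P" "P ! (Suc a + csize c) = IJmp a"
    using WhileOracle1.prems by (auto simp: code_at_append code_at_Cons)
  have "step (machine K P acc) X (conf K tp a (s, p)) = Some (conf K tp (Suc a) (s, p))"
    using step_instr(5)[of a P K tp s "a + csize c + 2" acc X p] marked_le3[OF assms(4)] WhileOracle1 code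
    by auto
  then have "steps (machine K P acc) X (conf K tp a (s, p)) (conf K tp (Suc a) (s, p))" by auto
  also have "steps (machine K P acc) X \<dots> (conf K tp (Suc a + csize c) (s1, p1))"
    by (rule WhileOracle1.IH(1)) (use WhileOracle1.prems code in auto)
  also have "step (machine K P acc) X \<dots> = Some (conf K tp a (s1, p1))"
    using step_instr(3)[of "Suc a + csize c" P K tp s1 a acc X p1] marked_le3[OF assms(4)] code by auto
  then have "steps (machine K P acc) X (conf K tp (Suc a + csize c) (s1, p1)) (conf K tp a (s1, p1))" by auto
  also have "steps (machine K P acc) X \<dots> (conf K tp (a + csize (CWhileOracle c)) (s2, p2))"
    by (rule WhileOracle1.IH(2)) (use WhileOracle1.prems in auto)
  finally show ?case .
qed

text \<open>A unary input is tape content, whereas a register is a head position. A preamble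
  converts the one into the other by moving head 0 to the end of the input.\<close>

lemma recursive_pred_com:
  assumes run: "\<And>X i. \<exists>s p. exec X c (\<lambda>j. if j = 0 then i else 0, 0) (s, p) \<and> (s r \<noteq> 0 \<longleftrightarrow> R X [i])"
  shows "recursive_pred 1 R"
proof -
  obtain K where K: "regs c \<subseteq> {..<K}" "r < K" "0 < K"
  proof -
    define K where "K = Suc (Max (insert r (regs c)))"
    have "x < K" if "x \<in> insert r (regs c)" for x
      using Max_ge[OF finite.insertI[OF finite_regs] that] by (simp only: K_def less_Suc_eq_le)
    then show ?thesis using that[of K] by (auto simp: K_def)
  qed
  define E where "E = 5 + csize c"
  \<comment> \<open>A mark other than 2 in cell 0 means empty input, and the scan is skipped. The
    compiled program starts at 5; the last instruction falls through to E + 1 to accept or jumps to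
    E + 2 to reject, both outside the program.\<close>
  define P where "P = [IMark, ISym 0 2 5, IMove 0 Right, ISym 0 1 5, IJmp 2] @ compile c 5 @ [IJz r (E + 2)]"
  define M where "M = machine K P (E + 1)"
  have len: "length P = E + 1" by (simp add: P_def E_def)
  have P_nth: "P ! 0 = IMark" "P ! 1 = ISym 0 2 5" "P ! 2 = IMove 0 Right" "P ! 3 = ISym 0 1 5"
    "P ! 4 = IJmp 2" "P ! E = IJz r (E + 2)"
    by (auto simp: P_def E_def nth_append)
  have code: "code_at P 5 (compile c 5)"
    unfolding code_at_def P_def
    by (intro exI[of _ "[IMark, ISym 0 2 5, IMove 0 Right, ISym 0 1 5, IJmp 2]"] exI[of _ "[IJz r (E + 2)]"]) simp
  have "\<exists>d. halts_at M X [i] d \<and> (state d = accept_state M \<longleftrightarrow> R X [i])" for X i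
  proof -
    define s0 :: "nat \<Rightarrow> nat" where "s0 = (\<lambda>j. 0)"
    define t0 where "t0 j = (if j = 0 then unary i else (\<lambda>_. 0))" for j :: nat
    define tp where "tp j = (t0 j)(0 := if t0 j 0 = 0 then 3 else 2)" for j
    have tp: "marked tp" by (auto simp: marked_def tp_def t0_def unary_def)
    have le3: "tp j p \<le> 3" for j p using marked_le3[OF tp] .
    have init: "init_config M [i] = conf K t0 0 (s0, 0)"
      by (auto simp: init_config_def conf_def M_def machine_def t0_def s0_def)
    have 0: "step M X (conf K t0 0 (s0, 0)) = Some (conf K tp 1 (s0, 0))"
    proof -
      have "(\<lambda>j. (t0 j)(s0 j := if t0 j (s0 j) = 0 then 3 else 2)) = tp" by (auto simp: tp_def s0_def)
      then show ?thesis
        unfolding M_def using step_instr(7)[of 0 P K t0 s0] len P_nth by (auto simp: t0_def s0_def unary_def)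
    qed
    have loop: "steps M X (conf K tp 3 (s0(0 := k), 0)) (conf K tp 5 (s0(0 := i), 0))" if "0 < k" "k \<le> i" for k
      using that
    proof (induction "i - k" arbitrary: k)
      case 0
      then have "k = i" by simp
      have "tp 0 i \<noteq> 1" using 0 by (auto simp: tp_def t0_def unary_def)
      then have "step M X (conf K tp 3 (s0(0 := k), 0)) = Some (conf K tp 5 (s0(0 := i), 0))"
        unfolding M_def \<open>k = i\<close>
        using step_instr(6)[of 3 P K tp "s0(0 := i)" 0 1 5 "E + 1" X 0] K len P_nth le3 by (auto simp: E_def)
      then show ?case by (rule r_into_rtranclp)
    next
      case (Suc m)
      have "tp 0 k = 1" using Suc by (auto simp: tp_def t0_def unary_def)
      then have "step M X (conf K tp 3 (s0(0 := k), 0)) = Some (conf K tp 4 (s0(0 := k), 0))"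
        unfolding M_def
        using step_instr(6)[of 3 P K tp "s0(0 := k)" 0 1 5 "E + 1" X 0] K len P_nth le3 by (auto simp: E_def)
      moreover have "step M X (conf K tp 4 (s0(0 := k), 0)) = Some (conf K tp 2 (s0(0 := k), 0))"
        unfolding M_def using step_instr(3)[of 4 P K tp "s0(0 := k)" 2 "E + 1" X 0] len P_nth le3 by (auto simp: E_def)
      moreover have "step M X (conf K tp 2 (s0(0 := k), 0)) = Some (conf K tp 3 (s0(0 := Suc k), 0))"
        unfolding M_def using step_instr(1)[of 2 P K tp "s0(0 := k)" 0 Right "E + 1" X 0] len P_nth le3
        by (auto simp: E_def)
      moreover have "steps M X (conf K tp 3 (s0(0 := Suc k), 0)) (conf K tp 5 (s0(0 := i), 0))"
        by (rule Suc.hyps(1)) (use Suc in auto)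
      ultimately show ?case by (blast intro: converse_rtranclp_into_rtranclp)
    qed
    have pre: "steps M X (conf K tp 1 (s0, 0)) (conf K tp 5 (s0(0 := i), 0))"
    proof (cases "i = 0")
      case True
      then have "s0(0 := i) = s0" "tp 0 0 \<noteq> 2" by (auto simp: s0_def tp_def t0_def unary_def)
      then have "step M X (conf K tp 1 (s0, 0)) = Some (conf K tp 5 (s0(0 := i), 0))"
        unfolding M_def
        using step_instr(6)[of 1 P K tp s0 0 2 5 "E + 1" X 0] K len P_nth le3 by (auto simp: E_def s0_def)
      then show ?thesis by auto
    next
      case False
      then have "tp 0 0 = 2" by (auto simp: tp_def t0_def unary_def)
      then have "step M X (conf K tp 1 (s0, 0)) = Some (conf K tp 2 (s0, 0))"
        unfolding M_def
        using step_instr(6)[of 1 P K tp s0 0 2 5 "E + 1" X 0] K len P_nth le3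
        by (auto simp: E_def s0_def numeral_2_eq_2)
      moreover have "step M X (conf K tp 2 (s0, 0)) = Some (conf K tp 3 (s0(0 := 1), 0))"
        unfolding M_def using step_instr(1)[of 2 P K tp s0 0 Right "E + 1" X 0] len P_nth le3
        by (auto simp: E_def s0_def)
      moreover have "steps M X (conf K tp 3 (s0(0 := 1), 0)) (conf K tp 5 (s0(0 := i), 0))"
        by (rule loop) (use False in auto)
      ultimately show ?thesis by (blast intro: converse_rtranclp_into_rtranclp)
    qed
    have s0i: "s0(0 := i) = (\<lambda>j. if j = 0 then i else 0)" by (auto simp: s0_def)
    obtain s p where sp: "exec X c (s0(0 := i), 0) (s, p)" "s r \<noteq> 0 \<longleftrightarrow> R X [i]"
      using run[of X i] unfolding s0i by blast
    have main: "steps M X (conf K tp 5 (s0(0 := i), 0)) (conf K tp E (s, p))"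
      unfolding M_def E_def by (rule steps_compile[OF sp(1) code K(1) tp])
    have fin: "step M X (conf K tp E (s, p)) = Some (conf K tp (if s r = 0 then E + 2 else E + 1) (s, p))"
      unfolding M_def using step_instr(4)[of E P K tp s r "E + 2" "E + 1" X p] K len P_nth le3
      by (auto simp: marked_ge2[OF tp])
    define d where "d = conf K tp (if s r = 0 then E + 2 else E + 1) (s, p)"
    have first: "steps M X (init_config M [i]) (conf K tp 1 (s0, 0))"
      unfolding init using 0 by (rule r_into_rtranclp)
    have last: "steps M X (conf K tp E (s, p)) d"
      unfolding d_def using fin by (rule r_into_rtranclp)
    have "steps M X (init_config M [i]) d"
      by (rule rtranclp_trans[OF rtranclp_trans[OF rtranclp_trans[OF first pre] main] last])
    moreover have "step M X d = None"
      unfolding step_def by (simp add: M_def machine_def d_def conf_def len)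
    moreover have "state d = accept_state M \<longleftrightarrow> R X [i]"
      using sp(2) by (auto simp: d_def conf_def M_def machine_def)
    ultimately show ?thesis by (auto simp: halts_at_def)
  qed
  moreover have "1 \<le> num_tapes M" using K by (simp add: M_def machine_def)
  moreover have "wf_oracle_tm M" unfolding M_def by (rule wf_machine)
  ultimately show ?thesis
    unfolding recursive_pred_def by (intro exI[of _ M]) (auto simp: length_Suc_conv)
qed

lemma exec_runs: "runs c s s' \<Longrightarrow> exec X c (s, p) (s', p)"
  by (simp add: runs_def)

section \<open>Reading a prefix of the oracle\<close>

text \<open>The cell before block m: the left end for m = 0, and otherwise the 0 closing block m -
  1.\<close>

definition blocks :: "(nat \<Rightarrow> nat) \<Rightarrow> nat \<Rightarrow> nat" where
  "blocks X m = (\<Sum>j<m. X j + 1)"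

lemma strict_mono_blocks: "strict_mono (blocks X)"
  by (simp add: strict_mono_Suc_iff blocks_def)

lemma oracle_tape_block:
  assumes "i \<le> X m"
  shows "oracle_tape X (Suc (blocks X m) + i) = of_bool (i < X m)"
proof -
  have sum: "(\<Sum>j\<le>k. X j + 1) = blocks X (Suc k)" for k by (simp add: blocks_def lessThan_Suc_atMost)
  have Suc: "blocks X (Suc m) = blocks X m + X m + 1" by (simp add: blocks_def)
  show ?thesis
  proof (cases "i = X m")
    case True
    then have "\<exists>k. Suc (blocks X m) + i = (\<Sum>j\<le>k. X j + 1)" unfolding sum by (intro exI[of _ m]) (simp add: Suc)
    then show ?thesis using True by (simp add: oracle_tape_def)
  next
    case False
    have "Suc (blocks X m) + i \<noteq> blocks X (Suc k)" for k
    proof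
      assume eq: "Suc (blocks X m) + i = blocks X (Suc k)"
      then have "blocks X m < blocks X (Suc k)" "blocks X (Suc k) < blocks X (Suc m)"
        using False assms Suc by auto
      then show False using strict_mono_less[OF strict_mono_blocks[of X]] by auto
    qed
    then have "\<not> (\<exists>k. Suc (blocks X m) + i = (\<Sum>j\<le>k. X j + 1))" unfolding sum by blast
    then show ?thesis using False assms by (simp add: oracle_tape_def)
  qed
qed

lemma exec_read_block:
  assumes "\<And>i. i < n \<Longrightarrow> oracle_tape X (p + i) = 1" "oracle_tape X (p + n) \<noteq> 1"
  shows "exec X (CWhileOracle (CSeq COracleRight (CInc r))) (s, p) (s(r := s r + n), p + n)"
  using assms
proof (induction n arbitrary: s p)
  case 0
  then show ?case by (auto intro: exec.intros)
next
  case (Suc n)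
  have one: "exec X (CSeq COracleRight (CInc r)) (s, p) (s(r := Suc (s r)), Suc p)"
    by (rule exec.Seq) (rule exec.intros)+
  have "oracle_tape X (Suc p + i) = 1" if "i < n" for i
    using Suc.prems(1)[of "Suc i"] that by simp
  moreover have "(s(r := Suc (s r)))(r := (s(r := Suc (s r))) r + n) = s(r := s r + Suc n)" by auto
  moreover have "Suc p + n = p + Suc n" by simp
  ultimately have "exec X (CWhileOracle (CSeq COracleRight (CInc r))) (s(r := Suc (s r)), Suc p) (s(r := s r + Suc n), p + Suc n)"
    using Suc.IH[of "Suc p" "s(r := Suc (s r))"] Suc.prems(2) by (simp del: fun_upd_upd fun_upd_apply)
  from exec.WhileOracle1[OF _ one this] Suc.prems(1)[of 0] show ?case by (simp del: fun_upd_apply)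
qed

text \<open>Register 0 counts the blocks still to be read, 1 holds the code of the values read so
  far, 2 the length of the current block, and the registers from 3 on are scratch space.\<close>

lemma recursive_pred_prefix:
  assumes "decidable (\<lambda>e. Q (e 0))"
  shows "recursive_pred 1 (\<lambda>X is. Q (list_encode (map X [0..<is ! 0])))"
proof -
  obtain N c where c: "\<forall>loc r s. (\<forall>k<N. loc k < r) \<longrightarrow>
       (\<exists>s'. runs (c loc r) s s' \<and> s' r = of_bool (Q (s (loc (0::nat)))) \<and> (\<forall>q<r. s' q = s q))"
    using computableE[OF assms[unfolded decidable_def]] by blast
  have test: "\<exists>s'. runs (c (\<lambda>_. 1) 3) s s' \<and> s' 3 = of_bool (Q (s 1))" for s
    using c[rule_format, of "\<lambda>_. 1" 3 s] by auto
  have "clist (\<lambda>e. list_decode (e 0) @ [e 1])" by (intro comp_intros)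
  from computableE[OF this[unfolded clist_def]] obtain N' d where
    d: "\<And>loc r s. (\<forall>k<N'. loc k < r) \<longrightarrow>
       (\<exists>s'. runs (d loc r) s s' \<and> s' r = list_encode (list_decode (s (loc (0::nat))) @ [s (loc 1)]) \<and> (\<forall>q<r. s' q = s q))"
    by blast
  define sn where "sn = d (\<lambda>k. if k = 0 then 1 else 2) 3"
  have sn: "\<exists>s'. runs sn s s' \<and> s' 3 = list_encode (list_decode (s 1) @ [s 2]) \<and> (\<forall>q<3. s' q = s q)" for s
    using d[of "\<lambda>k. if k = 0 then 1 else 2" 3 s] by (simp add: sn_def)
  define rd where "rd = CWhileOracle (CSeq COracleRight (CInc 2))"
  define blk where "blk = CSeq (CDec 0) (CSeq (CZero 2) (CSeq rd (CSeq COracleRight (CSeq sn (CCopy 3 1 4)))))"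
  have blk: "\<exists>s'. exec X blk (s, Suc (blocks X m)) (s', Suc (blocks X (Suc m))) \<and> s' 0 = s 0 - 1 \<and>
      s' 1 = list_encode (list_decode (s 1) @ [X m])" for X s m
  proof -
    define s1 where "s1 = s(0 := s 0 - 1, 2 := 0)"
    define s2 where "s2 = s1(2 := s1 2 + X m)"
    obtain s3 where s3: "runs sn s2 s3" "s3 3 = list_encode (list_decode (s2 1) @ [s2 2])" "\<forall>q<3. s3 q = s2 q"
      using sn by blast
    have rd: "exec X rd (s1, Suc (blocks X m)) (s2, Suc (blocks X m) + X m)"
      unfolding rd_def s2_def
      by (rule exec_read_block) (use oracle_tape_block[of _ X m] in auto)
    have "exec X blk (s, Suc (blocks X m)) (s3(1 := s3 3, 4 := 0), Suc (Suc (blocks X m) + X m))"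
      unfolding blk_def
    proof (intro exec.Seq)
      show "exec X (CDec 0) (s, Suc (blocks X m)) (s(0 := s 0 - 1), Suc (blocks X m))" by (rule exec.Dec)
      show "exec X (CZero 2) (s(0 := s 0 - 1), Suc (blocks X m)) (s1, Suc (blocks X m))"
        unfolding s1_def by (rule exec_runs[OF runs_CZero])
      show "exec X rd (s1, Suc (blocks X m)) (s2, Suc (blocks X m) + X m)" by (rule rd)
      show "exec X COracleRight (s2, Suc (blocks X m) + X m) (s2, Suc (Suc (blocks X m) + X m))"
        by (rule exec.OracleRight)
      show "exec X sn (s2, Suc (Suc (blocks X m) + X m)) (s3, Suc (Suc (blocks X m) + X m))"
        by (rule exec_runs[OF s3(1)])
      show "exec X (CCopy 3 1 4) (s3, Suc (Suc (blocks X m) + X m)) (s3(1 := s3 3, 4 := 0), Suc (Suc (blocks X m) + X m))"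
        by (rule exec_runs[OF runs_CCopy]) auto
    qed
    then show ?thesis
      using s3 by (intro exI[of _ "s3(1 := s3 3, 4 := 0)"]) (auto simp: s2_def s1_def blocks_def)
  qed
  have loop: "\<exists>s' p. exec X (CWhile 0 blk) (s, Suc (blocks X m)) (s', p) \<and> s' 1 = list_encode (map X [0..<m + n])"
    if "s 0 = n" "s 1 = list_encode (map X [0..<m])" for X s m n
    using that
  proof (induction n arbitrary: s m)
    case 0
    then show ?case by (auto intro: exec.While0)
  next
    case (Suc n)
    obtain s1 where s1: "exec X blk (s, Suc (blocks X m)) (s1, Suc (blocks X (Suc m)))" "s1 0 = n"
      "s1 1 = list_encode (map X [0..<Suc m])"
      using blk[of X s m] Suc.prems by auto
    obtain s' p where "exec X (CWhile 0 blk) (s1, Suc (blocks X (Suc m))) (s', p)"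
      "s' 1 = list_encode (map X [0..<Suc m + n])"
      using Suc.IH[OF s1(2,3)] by blast
    with exec.While1[OF _ s1(1) this(1)] Suc.prems(1) show ?case by auto
  qed
  show ?thesis
  proof (rule recursive_pred_com[where c = "CSeq COracleRight (CSeq (CWhile 0 blk) (c (\<lambda>_. 1) 3))" and r = 3])
    fix X i
    define s0 :: "nat \<Rightarrow> nat" where "s0 = (\<lambda>j. if j = 0 then i else 0)"
    have "exec X COracleRight (s0, 0) (s0, Suc (blocks X 0))"
      using exec.OracleRight[of X s0 0] by (simp add: blocks_def)
    moreover obtain s1 p where s1: "exec X (CWhile 0 blk) (s0, Suc (blocks X 0)) (s1, p)"
      "s1 1 = list_encode (map X [0..<i])"
      using loop[of s0 i X 0] by (auto simp: s0_def)
    moreover obtain s2 where s2: "runs (c (\<lambda>_. 1) 3) s1 s2" "s2 3 = of_bool (Q (s1 1))"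
      using test by blast
    ultimately have "exec X (CSeq COracleRight (CSeq (CWhile 0 blk) (c (\<lambda>_. 1) 3))) (s0, 0) (s2, p)"
      by (blast intro: exec.Seq exec_runs)
    with s1 s2 show "\<exists>s p. exec X (CSeq COracleRight (CSeq (CWhile 0 blk) (c (\<lambda>_. 1) 3)))
        (\<lambda>j. if j = 0 then i else 0, 0) (s, p) \<and> (s 3 \<noteq> 0 \<longleftrightarrow> Q (list_encode (map X [0..<[i] ! 0])))"
      unfolding s0_def by (intro exI[of _ s2] exI[of _ p]) auto
  qed
qed

section \<open>Halting histories as decision table of level 0\<close>

definition nthc :: "nat \<Rightarrow> nat \<Rightarrow> nat" where "nthc z i = nth0 (list_decode z) i"
definition lenc :: "nat \<Rightarrow> nat" where "lenc z = length (list_decode z)"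
definition pf :: "nat \<Rightarrow> nat" where "pf z = fst (prod_decode z)"
definition ps :: "nat \<Rightarrow> nat" where "ps z = snd (prod_decode z)"

definition mv :: "nat \<Rightarrow> nat \<Rightarrow> nat" where
  "mv d p = (if d = 0 then p - 1 else if d = 1 then p else p + 1)"

text \<open>The bound m < p is harmless because each block takes at least its closing cell; for the
  same reason only entries of \<open>\<alpha>\<close> below p are consulted.\<close>

definition otape :: "nat list \<Rightarrow> nat \<Rightarrow> nat" where
  "otape \<alpha> p = (if p = 0 then 2 else if \<exists>m<p. p = (\<Sum>j<Suc m. nth0 \<alpha> j + 1) then 0 else 1)"

text \<open>Here \<open>z\<close> codes a configuration as [state, oracle position, tapes], a tape
  being a pair of contents and head position. Since \<open>c\<close> lists the inputs backwards
  after the history, the input on tape j stands at position n - j.\<close>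

definition sim_init :: "nat \<Rightarrow> nat \<Rightarrow> nat \<Rightarrow> nat \<Rightarrow> nat \<Rightarrow> bool" where
  "sim_init q K n c z \<longleftrightarrow> nthc z 0 = q \<and> nthc z 1 = 0 \<and> lenc (nthc z 2) = K \<and>
     (\<forall>j<K. ps (nthc (nthc z 2) j) = 0 \<and>
       (\<forall>p<c. nthc (pf (nthc (nthc z 2) j)) p = (if j < n \<and> p < nthc c (n - j) then 1 else 0)))"

text \<open>The number \<open>x\<close> codes a transition as [state, oracle symbol, symbols, new
  state, move, actions], in the format of \<open>ecode\<close>.\<close>

definition sim_match :: "nat list \<Rightarrow> nat \<Rightarrow> nat \<Rightarrow> bool" where
  "sim_match \<alpha> x z \<longleftrightarrow> nthc x 0 = nthc z 0 \<and> nthc x 1 = otape \<alpha> (nthc z 1) \<and>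
     lenc (nthc x 2) = lenc (nthc z 2) \<and>
     (\<forall>j<lenc (nthc z 2). nthc (nthc x 2) j = nthc (pf (nthc (nthc z 2) j)) (ps (nthc (nthc z 2) j)))"

definition sim_result :: "nat \<Rightarrow> nat \<Rightarrow> nat \<Rightarrow> nat \<Rightarrow> bool" where
  "sim_result c x z z' \<longleftrightarrow> nthc z' 0 = nthc x 3 \<and> nthc z' 1 = mv (nthc x 4) (nthc z 1) \<and>
     lenc (nthc z' 2) = lenc (nthc z 2) \<and>
     (\<forall>j<lenc (nthc z 2).
       ps (nthc (nthc z' 2) j) = mv (ps (nthc (nthc x 5) j)) (ps (nthc (nthc z 2) j)) \<and>
       (\<forall>p<c. nthc (pf (nthc (nthc z' 2) j)) p =
          (if p = ps (nthc (nthc z 2) j) then pf (nthc (nthc x 5) j)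
           else nthc (pf (nthc (nthc z 2) j)) p)))"

text \<open>
  \<open>c\<close> codes the list \<open>[H, i\<^sub>n, \<dots>, i\<^sub>1, e]\<close>, where \<open>H\<close> codes a list of configurations and
  \<open>e\<close> the list \<open>[f, K, q, a, t]\<close> of a flag, the number of tapes, the start state, the accepting state
  and the transition table of a machine. The code \<open>c\<close> itself bounds all numbers occurring in \<open>H\<close>.
\<close>

definition valid :: "nat \<Rightarrow> nat list \<Rightarrow> bool" where
  "valid c \<alpha> \<longleftrightarrow>
     sim_init (nthc (nthc c (lenc c - 1)) 2) (nthc (nthc c (lenc c - 1)) 1) (lenc c - 2) c (nthc (nthc c 0) 0) \<and>
     0 < lenc (nthc c 0) \<and>
     (\<forall>s<lenc (nthc c 0) - 1. \<exists>k<lenc (nthc (nthc c (lenc c - 1)) 4).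
        sim_match \<alpha> (nthc (nthc (nthc c (lenc c - 1)) 4) k) (nthc (nthc c 0) s) \<and>
        sim_result c (nthc (nthc (nthc c (lenc c - 1)) 4) k) (nthc (nthc c 0) s) (nthc (nthc c 0) (Suc s))) \<and>
     (\<forall>k<lenc (nthc (nthc c (lenc c - 1)) 4).
        \<not> sim_match \<alpha> (nthc (nthc (nthc c (lenc c - 1)) 4) k) (nthc (nthc c 0) (lenc (nthc c 0) - 1))) \<and>
     (nthc (nthc (nthc c 0) (lenc (nthc c 0) - 1)) 0 = nthc (nthc c (lenc c - 1)) 3 \<longleftrightarrow>
        nthc (nthc c (lenc c - 1)) 0 = 1)"

text \<open>Cutting the string at the length \<open>ps y\<close> makes the answer independent of
  longer strings, and no history coded in that number reaches further. The negation is cancelled by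
  the one in the next level, whose statements thus assert that a valid history exists.\<close>

definition base_table :: "nat \<Rightarrow> nat" where
  "base_table y = (if lenc (pf y) < ps y then 2 else of_bool (\<not> valid (ps y) (take (ps y) (list_decode (pf y)))))"

lemma computable_nthc [comp_intros]: "computable t \<Longrightarrow> computable u \<Longrightarrow> computable (\<lambda>e. nthc (t e) (u e))"
  unfolding nthc_def by (intro comp_intros)

lemma computable_lenc [comp_intros]: "computable t \<Longrightarrow> computable (\<lambda>e. lenc (t e))"
  unfolding lenc_def by (intro comp_intros)

lemma computable_pf [comp_intros]: "computable t \<Longrightarrow> computable (\<lambda>e. pf (t e))"
  unfolding pf_def by (intro comp_intros)

lemma computable_ps [comp_intros]: "computable t \<Longrightarrow> computable (\<lambda>e. ps (t e))"
  unfolding ps_def by (intro comp_intros)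

lemma computable_mv [comp_intros]: "computable t \<Longrightarrow> computable u \<Longrightarrow> computable (\<lambda>e. mv (t e) (u e))"
  unfolding mv_def by (intro comp_intros)

lemma computable_otape [comp_intros]:
  assumes "clist F" "computable t" shows "computable (\<lambda>e. otape (F e) (t e))"
  unfolding otape_def
  by (intro comp_intros computable_sum assms clist_shift[OF clist_shift[OF assms(1)]] computable_shift)

lemma decidable_sim_init [comp_intros]:
  assumes "computable q" "computable K" "computable n" "computable c" "computable z"
  shows "decidable (\<lambda>e. sim_init (q e) (K e) (n e) (c e) (z e))"
  unfolding decidable_def
  by (rule computable5[where f = "\<lambda>q K n c z. of_bool (sim_init q K n c z)", OF _ assms])
    (unfold sim_init_def, intro comp_intros)

lemma decidable_sim_match [comp_intros]:
  assumes "clist F" "computable x" "computable z"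
  shows "decidable (\<lambda>e. sim_match (F e) (x e) (z e))"
  unfolding sim_match_def by (intro comp_intros computable_shift assms)

lemma decidable_sim_result [comp_intros]:
  assumes "computable c" "computable x" "computable z" "computable z'"
  shows "decidable (\<lambda>e. sim_result (c e) (x e) (z e) (z' e))"
  unfolding decidable_def
  by (rule computable4[where f = "\<lambda>c x z z'. of_bool (sim_result c x z z')", OF _ assms])
    (unfold sim_result_def, intro comp_intros)

lemma decidable_valid [comp_intros]:
  assumes "computable c" "clist F"
  shows "decidable (\<lambda>e. valid (c e) (F e))"
proof -
  have "computable (\<lambda>e. of_bool (valid (e 0) (list_decode (e 1))))"
    unfolding valid_def by (intro comp_intros)
  from computable2[OF this assms(1) computable_list_encode[OF assms(2)]]
  show ?thesis by (simp add: decidable_def)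
qed

lemma computable_base_table: "computable (\<lambda>e. base_table (e 0))"
  unfolding base_table_def by (intro comp_intros)

lemma base_table_le_2: "base_table y \<le> 2"
  by (simp add: base_table_def)

definition base_truth :: "(nat \<Rightarrow> nat) \<Rightarrow> nat \<Rightarrow> bool" where
  "base_truth X c \<longleftrightarrow> \<not> valid c (map X [0..<c])"

lemma decides_base_table: "decides base_table X (base_truth X)"
proof -
  have "base_table (prod_encode (list_encode (map X [0..<k]), c)) = (if k < c then 2 else of_bool (base_truth X c))" for k c
  proof (cases "k < c")
    case False
    then have "take c (map X [0..<k]) = map X [0..<c]" by (simp add: take_map)
    then show ?thesis using False by (simp add: base_table_def base_truth_def lenc_def pf_def ps_def)
  qed (simp add: base_table_def lenc_def pf_def ps_def)
  note * = this
  show ?thesis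
    unfolding decides_def *
  proof (intro allI conjI)
    fix c show "\<exists>N. \<forall>k\<ge>N. (if k < c then 2 else of_bool (base_truth X c)) \<noteq> (2 :: nat)"
      by (rule exI[of _ c]) auto
  qed auto
qed

section \<open>Coded histories and actual computations\<close>

lemma nthc_le: "nthc z i \<le> z"
proof (cases "i < length (list_decode z)")
  case True
  then have "list_decode z ! i < list_encode (list_decode z)" by (rule nth_less_list_encode)
  then show ?thesis by (simp add: nthc_def nth0_def)
qed (simp add: nthc_def nth0_def)

lemma lenc_le: "lenc z \<le> z"
  using length_le_list_encode[of "list_decode z"] by (simp add: lenc_def)

lemma nthc_ge: "z \<le> p \<Longrightarrow> nthc z p = 0"
  using lenc_le[of z] by (simp add: nthc_def nth0_def lenc_def)

lemma nthc_encode [simp]: "i < length xs \<Longrightarrow> nthc (list_encode xs) i = xs ! i"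
  by (simp add: nthc_def nth0_def)

lemma lenc_encode [simp]: "lenc (list_encode xs) = length xs"
  by (simp add: lenc_def)

lemma pf_encode [simp]: "pf (prod_encode (a, b)) = a" and ps_encode [simp]: "ps (prod_encode (a, b)) = b"
  by (simp_all add: pf_def ps_def)

lemma pf_le: "pf z \<le> z" and ps_le: "ps z \<le> z"
  by (simp_all add: pf_def ps_def fst_prod_decode_le snd_prod_decode_le)

lemma otape_eq:
  assumes "p \<le> k"
  shows "otape (map X [0..<k]) p = oracle_tape X p"
proof -
  have "(\<exists>m<p. p = (\<Sum>j<Suc m. nth0 (map X [0..<k]) j + 1)) = (\<exists>m. p = (\<Sum>j\<le>m. X j + 1))"
  proof
    assume "\<exists>m<p. p = (\<Sum>j<Suc m. nth0 (map X [0..<k]) j + 1)"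
    then obtain m where m: "m < p" "p = (\<Sum>j<Suc m. nth0 (map X [0..<k]) j + 1)" by blast
    have "(\<Sum>j<Suc m. nth0 (map X [0..<k]) j + 1) = (\<Sum>j<Suc m. X j + 1)"
      by (rule sum.cong) (use m assms in \<open>auto simp: nth0_def\<close>)
    then show "\<exists>m. p = (\<Sum>j\<le>m. X j + 1)" using m(2) by (metis lessThan_Suc_atMost)
  next
    assume "\<exists>m. p = (\<Sum>j\<le>m. X j + 1)"
    then obtain m where m: "p = (\<Sum>j<Suc m. X j + 1)" by (metis lessThan_Suc_atMost)
    have "(\<Sum>j<Suc m. 1) \<le> (\<Sum>j<Suc m. X j + 1)" by (rule sum_mono) simp
    then have mp: "m < p" using m by simp
    have "(\<Sum>j<Suc m. nth0 (map X [0..<k]) j + 1) = (\<Sum>j<Suc m. X j + 1)"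
      by (rule sum.cong) (use mp assms in \<open>auto simp: nth0_def\<close>)
    with m mp show "\<exists>m<p. p = (\<Sum>j<Suc m. nth0 (map X [0..<k]) j + 1)" by metis
  qed
  then show ?thesis by (simp add: otape_def oracle_tape_def)
qed

text \<open>Trailing zeros make the coding of tapes ambiguous, so codes are compared through
  \<open>cfg_of\<close> and never directly.\<close>

definition cfg_of :: "nat \<Rightarrow> config" where
  "cfg_of z = \<lparr>state = nthc z 0, oracle_pos = nthc z 1,
     work_tapes = map (\<lambda>T. (nthc (pf T), ps T)) (list_decode (nthc z 2))\<rparr>"

lemma cfg_of_simps [simp]: "state (cfg_of z) = nthc z 0" "oracle_pos (cfg_of z) = nthc z 1"
  "length (work_tapes (cfg_of z)) = lenc (nthc z 2)"
  "j < lenc (nthc z 2) \<Longrightarrow> work_tapes (cfg_of z) ! j = (nthc (pf (nthc (nthc z 2) j)), ps (nthc (nthc z 2) j))"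
  by (simp_all add: cfg_of_def lenc_def nthc_def[of "nthc z 2"] nth0_def)

lemma tape_code_le: "pf (nthc (nthc z 2) j) \<le> z" "ps (nthc (nthc z 2) j) \<le> z"
  using pf_le ps_le nthc_le by (meson order_trans)+

text \<open>A tape coded by t is blank from cell t on, so comparing the cells below \<open>c\<close>
  is enough.\<close>

lemma tape_ext:
  assumes "\<And>p. p < c \<Longrightarrow> nthc t p = f p" "\<And>p. c \<le> p \<Longrightarrow> f p = 0" "t \<le> c"
  shows "nthc t = f"
proof
  fix p show "nthc t p = f p"
    using assms nthc_ge[of t p] by (cases "p < c") auto
qed

lemma sim_init_iff:
  assumes c: "c = list_encode (H # rev is @ [e])" and z: "z \<le> c" and M: "num_tapes M = K" "start_state M = q"
  shows "sim_init q K (length is) c z \<longleftrightarrow> cfg_of z = init_config M is"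
proof -
  have inp: "nthc c (length is - j) = is ! j" if "j < length is" for j
  proof -
    have "length is - Suc j < length is" using that by simp
    then show ?thesis using that by (simp add: c nth_append rev_nth nth_Cons' del: list_encode.simps)
  qed
  have bound: "is ! j \<le> c" if "j < length is" for j using inp[OF that] nthc_le by metis
  define f where "f j = (if j < length is then unary (is ! j) else (\<lambda>_. 0))" for j
  have f: "f j p = (if j < length is \<and> p < nthc c (length is - j) then 1 else 0)" for j p
    using inp by (auto simp: f_def unary_def)
  have f0: "f j p = 0" if "c \<le> p" for j p
    using bound[of j] that by (auto simp: f_def unary_def)
  have tape: "(\<forall>p<c. nthc (pf (nthc (nthc z 2) j)) p = f j p) \<longleftrightarrow> nthc (pf (nthc (nthc z 2) j)) = f j" for j
  proof
    assume "\<forall>p<c. nthc (pf (nthc (nthc z 2) j)) p = f j p"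
    moreover have "pf (nthc (nthc z 2) j) \<le> c" using tape_code_le(1)[of z j] z by simp
    ultimately show "nthc (pf (nthc (nthc z 2) j)) = f j"
      using f0 by (intro tape_ext[of c]) auto
  qed simp
  have "cfg_of z = init_config M is \<longleftrightarrow> nthc z 0 = q \<and> nthc z 1 = 0 \<and>
      work_tapes (cfg_of z) = map (\<lambda>j. (f j, 0)) [0..<K]"
    by (auto simp: init_config_def M cfg_of_def f_def)
  also have "work_tapes (cfg_of z) = map (\<lambda>j. (f j, 0)) [0..<K] \<longleftrightarrow>
      lenc (nthc z 2) = K \<and> (\<forall>j<K. ps (nthc (nthc z 2) j) = 0 \<and> nthc (pf (nthc (nthc z 2) j)) = f j)"
    by (auto simp: list_eq_iff_nth_eq)
  finally show ?thesis unfolding sim_init_def f[symmetric] tape by auto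
qed

fun mcode :: "move \<Rightarrow> nat" where
  "mcode Left = 0" | "mcode Stay = 1" | "mcode Right = 2"

lemma mv_mcode [simp]: "mv (mcode d) p = move_head d p"
  by (cases d) (auto simp: mv_def)

fun ecode :: "(nat \<times> nat \<times> nat list) \<times> (nat \<times> move \<times> (nat \<times> move) list) \<Rightarrow> nat" where
  "ecode ((q, b, syms), (q', d, acts)) =
     list_encode [q, b, list_encode syms, q', mcode d,
       list_encode (map (\<lambda>(a, d). prod_encode (a, mcode d)) acts)]"

lemma sim_match_iff:
  assumes "z \<le> c"
  shows "sim_match (map X [0..<c]) (ecode (k, v)) z \<longleftrightarrow>
    k = (state (cfg_of z), oracle_tape X (oracle_pos (cfg_of z)), map scan (work_tapes (cfg_of z)))"
proof -
  obtain q b syms where k: "k = (q, b, syms)" by (cases k)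
  obtain q' d acts where v: "v = (q', d, acts)" by (cases v)
  have "nthc z 1 \<le> c" using nthc_le[of z 1] assms by simp
  then have o: "otape (map X [0..<c]) (nthc z 1) = oracle_tape X (nthc z 1)" by (rule otape_eq)
  have "syms = map scan (work_tapes (cfg_of z)) \<longleftrightarrow> length syms = lenc (nthc z 2) \<and>
    (\<forall>j<lenc (nthc z 2). syms ! j = nthc (pf (nthc (nthc z 2) j)) (ps (nthc (nthc z 2) j)))"
    by (auto simp: list_eq_iff_nth_eq)
  then show ?thesis
    unfolding sim_match_def k v by (auto simp: o[unfolded One_nat_def] simp del: list_encode.simps)
qed

lemma sim_result_iff:
  assumes "z \<le> c" "z' \<le> c" "length acts = lenc (nthc z 2)"
  shows "sim_result c (ecode (k, (q', d, acts))) z z' \<longleftrightarrow>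
    cfg_of z' = \<lparr>state = q', oracle_pos = move_head d (oracle_pos (cfg_of z)),
      work_tapes = map2 act_on_tape acts (work_tapes (cfg_of z))\<rparr>"
proof -
  obtain q b syms where k: "k = (q, b, syms)" by (cases k)
  define n where "n = lenc (nthc z 2)"
  have act: "nthc (nthc (ecode (k, (q', d, acts))) 5) j = prod_encode (fst (acts ! j), mcode (snd (acts ! j)))"
    if "j < n" for j
    using that assms(3) by (simp add: k n_def split_beta del: list_encode.simps)
  have sim: "nthc (ecode (k, (q', d, acts))) 3 = q'" "nthc (ecode (k, (q', d, acts))) 4 = mcode d"
    by (simp_all add: k del: list_encode.simps)
  have tape: "(\<forall>p<c. nthc (pf (nthc (nthc z' 2) j)) p =
      (if p = ps (nthc (nthc z 2) j) then a else nthc (pf (nthc (nthc z 2) j)) p)) \<longleftrightarrow>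
    nthc (pf (nthc (nthc z' 2) j)) = (nthc (pf (nthc (nthc z 2) j)))(ps (nthc (nthc z 2) j) := a)"
    (is "?l \<longleftrightarrow> ?r") if j: "j < n" for j a
  proof
    assume ?l
    then show ?r
    proof (intro tape_ext[of c])
      fix p assume p: "c \<le> p"
      \<comment> \<open>The written cell must be among those compared. The head position is below
        \<open>c\<close> strictly, as it occurs inside a coded list.\<close>
      have "ps (nthc (nthc z 2) j) < p"
      proof -
        have "ps (nthc (nthc z 2) j) \<le> nthc (nthc z 2) j" by (rule ps_le)
        also have "\<dots> < nthc z 2"
          using nth_less_list_encode[of j "list_decode (nthc z 2)"] j
          by (simp add: n_def lenc_def nthc_def[of "nthc z 2"] nth0_def)
        also have "\<dots> \<le> z" by (rule nthc_le)
        finally show ?thesis using assms(1) p by simp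
      qed
      moreover have "nthc (pf (nthc (nthc z 2) j)) p = 0"
        using tape_code_le(1)[of z j] assms(1) p by (intro nthc_ge) simp
      ultimately show "((nthc (pf (nthc (nthc z 2) j)))(ps (nthc (nthc z 2) j) := a)) p = 0" by simp
    next
      show "pf (nthc (nthc z' 2) j) \<le> c" using tape_code_le(1)[of z' j] assms(2) by simp
    qed auto
  qed auto
  have "cfg_of z' = \<lparr>state = q', oracle_pos = move_head d (oracle_pos (cfg_of z)),
      work_tapes = map2 act_on_tape acts (work_tapes (cfg_of z))\<rparr> \<longleftrightarrow>
    nthc z' 0 = q' \<and> nthc z' 1 = move_head d (nthc z 1) \<and>
    work_tapes (cfg_of z') = map2 act_on_tape acts (work_tapes (cfg_of z))"
    by (auto simp: cfg_of_def)
  also have "work_tapes (cfg_of z') = map2 act_on_tape acts (work_tapes (cfg_of z)) \<longleftrightarrow>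
    lenc (nthc z' 2) = n \<and> (\<forall>j<n. work_tapes (cfg_of z') ! j = act_on_tape (acts ! j) (work_tapes (cfg_of z) ! j))"
    using assms(3) by (auto simp: list_eq_iff_nth_eq n_def)
  also have "\<dots> \<longleftrightarrow> lenc (nthc z' 2) = n \<and> (\<forall>j<n.
      ps (nthc (nthc z' 2) j) = move_head (snd (acts ! j)) (ps (nthc (nthc z 2) j)) \<and>
      nthc (pf (nthc (nthc z' 2) j)) = (nthc (pf (nthc (nthc z 2) j)))(ps (nthc (nthc z 2) j) := fst (acts ! j)))"
  proof (intro conj_cong refl all_cong imp_cong)
    fix j assume "lenc (nthc z' 2) = n" "j < n"
    then show "(work_tapes (cfg_of z') ! j = act_on_tape (acts ! j) (work_tapes (cfg_of z) ! j)) =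
      (ps (nthc (nthc z' 2) j) = move_head (snd (acts ! j)) (ps (nthc (nthc z 2) j)) \<and>
      nthc (pf (nthc (nthc z' 2) j)) = (nthc (pf (nthc (nthc z 2) j)))(ps (nthc (nthc z 2) j) := fst (acts ! j)))"
      by (cases "acts ! j") (auto simp: n_def)
  qed
  finally show ?thesis
    unfolding sim_result_def sim n_def[symmetric] using act tape by auto
qed

lemma obtain_table:
  assumes "wf_oracle_tm M"
  obtains ts where "\<And>k v. (k, v) \<in> set ts \<longleftrightarrow> transition M k = Some v"
proof -
  have "finite ((\<lambda>k. (k, the (transition M k))) ` dom (transition M))"
    using assms by (simp add: wf_oracle_tm_def)
  from finite_list[OF this] obtain ts
    where ts: "set ts = (\<lambda>k. (k, the (transition M k))) ` dom (transition M)" ..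
  have "(k, v) \<in> set ts \<longleftrightarrow> transition M k = Some v" for k v
  proof
    assume "transition M k = Some v"
    then show "(k, v) \<in> set ts" unfolding ts by (intro image_eqI[of _ _ k]) (simp_all add: domI)
  next
    assume "(k, v) \<in> set ts"
    then show "transition M k = Some v" unfolding ts by (clarsimp simp del: split_paired_Ex)
  qed
  then show ?thesis by (rule that)
qed

context
  fixes M :: oracle_tm and ts and X :: "nat \<Rightarrow> nat" and c :: nat
  assumes wf: "wf_oracle_tm M" and ts: "\<And>k v. (k, v) \<in> set ts \<longleftrightarrow> transition M k = Some v"
begin

lemma table_ex:
  "(\<exists>k<lenc (list_encode (map ecode ts)). P (nthc (list_encode (map ecode ts)) k)) \<longleftrightarrow>
     (\<exists>x v. transition M x = Some v \<and> P (ecode (x, v)))"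
proof -
  have "(\<exists>k<lenc (list_encode (map ecode ts)). P (nthc (list_encode (map ecode ts)) k)) \<longleftrightarrow> (\<exists>k<length ts. P (ecode (ts ! k)))"
    by (auto simp del: list_encode.simps)
  also have "\<dots> \<longleftrightarrow> (\<exists>y\<in>set ts. P (ecode y))" by (metis in_set_conv_nth)
  also have "\<dots> \<longleftrightarrow> (\<exists>x v. (x, v) \<in> set ts \<and> P (ecode (x, v)))" by fast
  finally show ?thesis unfolding ts .
qed

text \<open>The right number of tapes is assumed because \<open>map2\<close> in \<open>step\<close>
  would truncate silently; \<open>sim_result\<close> compares all tapes.\<close>

lemma step_Some_iff:
  assumes "z \<le> c" "z' \<le> c" "lenc (nthc z 2) = num_tapes M"
  shows "(\<exists>k<lenc (list_encode (map ecode ts)).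
      sim_match (map X [0..<c]) (nthc (list_encode (map ecode ts)) k) z \<and>
      sim_result c (nthc (list_encode (map ecode ts)) k) z z') \<longleftrightarrow> step M X (cfg_of z) = Some (cfg_of z')"
proof -
  have len: "length acts = num_tapes M" if "transition M k = Some (q, d, acts)" for k q d acts
    using wf that unfolding wf_oracle_tm_def ran_def by fastforce
  define key where "key = (state (cfg_of z), oracle_tape X (oracle_pos (cfg_of z)), map scan (work_tapes (cfg_of z)))"
  have "(\<exists>k<lenc (list_encode (map ecode ts)).
      sim_match (map X [0..<c]) (nthc (list_encode (map ecode ts)) k) z \<and>
      sim_result c (nthc (list_encode (map ecode ts)) k) z z') \<longleftrightarrow>
    (\<exists>v. transition M key = Some v \<and> sim_result c (ecode (key, v)) z z')"
    unfolding table_ex[where P = "\<lambda>x. sim_match (map X [0..<c]) x z \<and> sim_result c x z z'"]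
      sim_match_iff[OF assms(1)] key_def[symmetric] by blast
  also have "\<dots> \<longleftrightarrow> step M X (cfg_of z) = Some (cfg_of z')"
  proof (cases "transition M key")
    case None
    then show ?thesis by (simp add: step_def key_def)
  next
    case (Some v)
    obtain q d acts where v: "v = (q, d, acts)" by (cases v)
    have "length acts = lenc (nthc z 2)" using len Some v assms(3) by simp
    from sim_result_iff[OF assms(1,2) this, of key q d] show ?thesis
      using Some v unfolding step_def key_def[symmetric] by auto
  qed
  finally show ?thesis .
qed

lemma step_None_iff:
  assumes "z \<le> c"
  shows "(\<forall>k<lenc (list_encode (map ecode ts)).
      \<not> sim_match (map X [0..<c]) (nthc (list_encode (map ecode ts)) k) z) \<longleftrightarrow> step M X (cfg_of z) = None"
proof -
  define key where "key = (state (cfg_of z), oracle_tape X (oracle_pos (cfg_of z)), map scan (work_tapes (cfg_of z)))"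
  have "(\<forall>k<lenc (list_encode (map ecode ts)).
      \<not> sim_match (map X [0..<c]) (nthc (list_encode (map ecode ts)) k) z) \<longleftrightarrow>
    \<not> (\<exists>k<lenc (list_encode (map ecode ts)). sim_match (map X [0..<c]) (nthc (list_encode (map ecode ts)) k) z)"
    by blast
  also have "\<dots> \<longleftrightarrow> \<not> (\<exists>x v. transition M x = Some v \<and> x = key)"
    unfolding table_ex[where P = "\<lambda>x. sim_match (map X [0..<c]) x z"]
      sim_match_iff[OF assms(1)] key_def[symmetric] ..
  also have "\<dots> \<longleftrightarrow> transition M key = None"
    by (metis not_Some_eq)
  also have "\<dots> \<longleftrightarrow> step M X (cfg_of z) = None"
    unfolding step_def key_def[symmetric] by (cases "transition M key") auto
  finally show ?thesis .
qed

end

definition run_codes :: "oracle_tm \<Rightarrow> (nat \<Rightarrow> nat) \<Rightarrow> config \<Rightarrow> nat list \<Rightarrow> bool" where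
  "run_codes M X d hs \<longleftrightarrow> hs \<noteq> [] \<and> cfg_of (hs ! 0) = d \<and>
     (\<forall>s<length hs - 1. step M X (cfg_of (hs ! s)) = Some (cfg_of (hs ! Suc s)))"

lemma length_work_tapes_step:
  assumes "wf_oracle_tm M" "step M X d = Some d'" "length (work_tapes d) = num_tapes M"
  shows "length (work_tapes d') = num_tapes M"
proof -
  have len: "length acts = num_tapes M" if "transition M k = Some (q, d, acts)" for k q d acts
    using assms(1) that unfolding wf_oracle_tm_def ran_def by fastforce
  show ?thesis using assms(2,3) by (auto simp: step_def len split: option.splits prod.splits)
qed

lemma run_codes_tapes:
  assumes "wf_oracle_tm M" "run_codes M X (init_config M is) hs" "s < length hs"
  shows "lenc (nthc (hs ! s) 2) = num_tapes M"
  using assms(3)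
proof (induction s)
  case 0
  have "length (work_tapes (cfg_of (hs ! 0))) = num_tapes M"
    using assms(2) by (simp add: run_codes_def init_config_def)
  then show ?case by simp
next
  case (Suc s)
  then have "step M X (cfg_of (hs ! s)) = Some (cfg_of (hs ! Suc s))"
    using assms(2) by (simp add: run_codes_def)
  from length_work_tapes_step[OF assms(1) this] Suc show ?case by simp
qed

lemma valid_iff:
  assumes M: "wf_oracle_tm M" and ts: "\<And>k v. (k, v) \<in> set ts \<longleftrightarrow> transition M k = Some v"
    and e: "e = list_encode [f, num_tapes M, start_state M, accept_state M, list_encode (map ecode ts)]"
    and c: "c = list_encode (list_encode hs # rev is @ [e])"
  shows "valid c (map X [0..<c]) \<longleftrightarrow>
    run_codes M X (init_config M is) hs \<and> step M X (cfg_of (last hs)) = None \<and>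
    (state (cfg_of (last hs)) = accept_state M \<longleftrightarrow> f = 1)"
proof -
  have ce: "nthc c (lenc c - 1) = e" "lenc c - 2 = length is" "nthc c 0 = list_encode hs"
    by (simp_all add: c nth_append del: list_encode.simps)
  have e_nth: "nthc e 0 = f" "nthc e 1 = num_tapes M" "nthc e 2 = start_state M" "nthc e 3 = accept_state M"
    "nthc e 4 = list_encode (map ecode ts)"
    by (simp_all add: e del: list_encode.simps)
  have le: "nthc (list_encode hs) s \<le> c" for s
    using nthc_le[of "list_encode hs" s] nthc_le[of c 0] ce by simp
  have nth: "nthc (list_encode hs) s = hs ! s" if "s < length hs" for s using that by simp
  show ?thesis
  proof (cases "hs = []")
    case True
    then show ?thesis unfolding valid_def ce run_codes_def by (simp add: lenc_def)
  next
    case False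
    define t where "t = length hs - 1"
    have t: "length hs = Suc t" using False by (simp add: t_def)
    have last: "last hs = hs ! t" using False by (simp add: last_conv_nth t_def)
    have valid: "valid c (map X [0..<c]) \<longleftrightarrow> cfg_of (hs ! 0) = init_config M is \<and>
       (\<forall>s<t. \<exists>k<lenc (list_encode (map ecode ts)).
          sim_match (map X [0..<c]) (nthc (list_encode (map ecode ts)) k) (hs ! s) \<and>
          sim_result c (nthc (list_encode (map ecode ts)) k) (hs ! s) (hs ! Suc s)) \<and>
       step M X (cfg_of (hs ! t)) = None \<and> (nthc (hs ! t) 0 = accept_state M \<longleftrightarrow> f = 1)"
      unfolding valid_def ce e_nth lenc_encode t
      using sim_init_iff[OF c le[of 0] refl refl] step_None_iff[OF M ts le[of t], where X = X]
      by (simp add: t cong: conj_cong del: list_encode.simps)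
    show ?thesis
    proof (cases "run_codes M X (init_config M is) hs")
      case True
      have "\<exists>k<lenc (list_encode (map ecode ts)).
          sim_match (map X [0..<c]) (nthc (list_encode (map ecode ts)) k) (hs ! s) \<and>
          sim_result c (nthc (list_encode (map ecode ts)) k) (hs ! s) (hs ! Suc s)" if "s < t" for s
        using step_Some_iff[OF M ts le[of s] le[of "Suc s"], where X = X] run_codes_tapes[OF M True, of s]
          nth[of s] nth[of "Suc s"] True that t by (simp add: run_codes_def)
      then show ?thesis using True unfolding valid last by (auto simp: run_codes_def)
    next
      case nrun: False
      have "\<not> valid c (map X [0..<c])"
      proof
        assume v: "valid c (map X [0..<c])"
        \<comment> \<open>The number of tapes is proved along with the steps, each fact being needed
          for the next instance of the other.\<close>
        have "lenc (nthc (hs ! s) 2) = num_tapes M \<and>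
          (s < t \<longrightarrow> step M X (cfg_of (hs ! s)) = Some (cfg_of (hs ! Suc s)))" if "s \<le> t" for s
          using that
        proof (induction s)
          case 0
          have "length (work_tapes (cfg_of (hs ! 0))) = num_tapes M"
            using v valid by (simp add: init_config_def)
          then show ?case
            using step_Some_iff[OF M ts le[of 0] le[of "Suc 0"], where X = X] v valid t nth[of 0] nth[of "Suc 0"] by auto
        next
          case (Suc s)
          then have "lenc (nthc (hs ! Suc s) 2) = num_tapes M"
            using length_work_tapes_step[OF M, of X "cfg_of (hs ! s)" "cfg_of (hs ! Suc s)"] by simp
          then show ?case
            using step_Some_iff[OF M ts le[of "Suc s"] le[of "Suc (Suc s)"], where X = X] v valid t
              nth[of "Suc s"] nth[of "Suc (Suc s)"] by auto
        qed
        then have "run_codes M X (init_config M is) hs"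
          using v valid False t by (auto simp: run_codes_def)
        with nrun show False ..
      qed
      then show ?thesis using nrun by simp
    qed
  qed
qed

text \<open>Only tapes that are blank from some cell on have codes. Initial configurations have such
  tapes and steps preserve them, so every reachable configuration is coded.\<close>

definition finite_tapes :: "config \<Rightarrow> bool" where
  "finite_tapes d \<longleftrightarrow> (\<forall>x\<in>set (work_tapes d). \<exists>W. \<forall>p\<ge>W. fst x p = 0)"

lemma finite_tapes_coded:
  assumes "finite_tapes d"
  shows "\<exists>z. cfg_of z = d"
proof -
  have "\<exists>T. (nthc (pf T), ps T) = x" if x: "x \<in> set (work_tapes d)" for x
  proof -
    obtain W where W: "\<forall>p\<ge>W. fst x p = 0" using x assms by (auto simp: finite_tapes_def)
    have "nthc (list_encode (map (fst x) [0..<W])) p = fst x p" for p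
      using W by (auto simp: nthc_def nth0_def)
    then have "nthc (list_encode (map (fst x) [0..<W])) = fst x" by blast
    then show ?thesis by (intro exI[of _ "prod_encode (list_encode (map (fst x) [0..<W]), snd x)"]) simp
  qed
  then obtain g where g: "\<And>x. x \<in> set (work_tapes d) \<Longrightarrow> (nthc (pf (g x)), ps (g x)) = x" by metis
  have "cfg_of (list_encode [state d, oracle_pos d, list_encode (map g (work_tapes d))]) = d"
    using g by (simp add: cfg_of_def map_idI comp_def del: list_encode.simps)
  then show ?thesis ..
qed

lemma finite_tapes_init: "finite_tapes (init_config M is)"
proof -
  have "\<exists>W. \<forall>p\<ge>W. (if j < length is then unary (is ! j) else (\<lambda>_. 0)) p = 0" for j
    by (rule exI[of _ "is ! j"]) (auto simp: unary_def)
  then show ?thesis by (auto simp: finite_tapes_def init_config_def)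
qed

lemma finite_tapes_step:
  assumes "finite_tapes d" "step M X d = Some d'"
  shows "finite_tapes d'"
proof -
  obtain q m acts where d': "d' = \<lparr>state = q, oracle_pos = move_head m (oracle_pos d),
      work_tapes = map2 act_on_tape acts (work_tapes d)\<rparr>"
    using assms(2) by (auto simp: step_def split: option.splits prod.splits)
  show ?thesis
    unfolding finite_tapes_def
  proof
    fix x assume "x \<in> set (work_tapes d')"
    then obtain a b t p where x: "x = act_on_tape (a, b) (t, p)" "(t, p) \<in> set (work_tapes d)"
      by (auto simp: d' dest: set_zip_rightD)
    obtain W where "\<forall>i\<ge>W. t i = 0" using x(2) assms(1) by (force simp: finite_tapes_def)
    then show "\<exists>W. \<forall>i\<ge>W. fst x i = 0" unfolding x(1) by (intro exI[of _ "max W (Suc p)"]) auto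
  qed
qed

lemma run_codes_exists:
  assumes "(\<lambda>c c'. step M X c = Some c')\<^sup>*\<^sup>* (init_config M is) d"
  shows "\<exists>hs. run_codes M X (init_config M is) hs \<and> cfg_of (last hs) = d"
proof -
  have "(\<exists>hs. run_codes M X (init_config M is) hs \<and> cfg_of (last hs) = d) \<and> finite_tapes d"
    using assms
  proof (induction rule: rtranclp_induct)
    case base
    obtain z where "cfg_of z = init_config M is" using finite_tapes_coded[OF finite_tapes_init] by blast
    then show ?case using finite_tapes_init by (auto simp: run_codes_def intro!: exI[of _ "[z]"])
  next
    case (step d d')
    then obtain hs where hs: "run_codes M X (init_config M is) hs" "cfg_of (last hs) = d" by blast
    have fin: "finite_tapes d'" using finite_tapes_step step by blast
    then obtain z where z: "cfg_of z = d'" using finite_tapes_coded by blast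
    have "run_codes M X (init_config M is) (hs @ [z])"
      unfolding run_codes_def
    proof (intro conjI allI impI)
      fix s assume "s < length (hs @ [z]) - 1"
      then consider "s < length hs - 1" | "s = length hs - 1" "hs \<noteq> []" using hs(1) by (force simp: run_codes_def)
      then show "step M X (cfg_of ((hs @ [z]) ! s)) = Some (cfg_of ((hs @ [z]) ! Suc s))"
      proof cases
        case 1
        then have "s < length hs" "Suc s < length hs" by auto
        then show ?thesis using 1 hs(1) by (simp add: run_codes_def nth_append)
      next
        case 2
        then have "(hs @ [z]) ! s = last hs" "(hs @ [z]) ! Suc s = z"
          by (auto simp: nth_append last_conv_nth)
        then show ?thesis using hs(2) z step.hyps(2) by simp
      qed
    qed (use hs in \<open>auto simp: run_codes_def nth_append\<close>)
    with z fin show ?case by (intro conjI exI[of _ "hs @ [z]"]) auto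
  qed
  then show ?thesis by blast
qed

lemma run_codes_steps:
  assumes "run_codes M X d hs"
  shows "(\<lambda>c c'. step M X c = Some c')\<^sup>*\<^sup>* d (cfg_of (last hs))"
proof -
  have "(\<lambda>c c'. step M X c = Some c')\<^sup>*\<^sup>* d (cfg_of (hs ! s))" if "s < length hs" for s
    using that
  proof (induction s)
    case (Suc s)
    then have "step M X (cfg_of (hs ! s)) = Some (cfg_of (hs ! Suc s))"
      using assms by (simp add: run_codes_def)
    then show ?case using Suc by (simp add: rtranclp.rtrancl_into_rtrancl)
  qed (use assms in \<open>simp add: run_codes_def\<close>)
  moreover have "last hs = hs ! (length hs - 1)" "length hs - 1 < length hs"
    using assms by (auto simp: run_codes_def last_conv_nth)
  ultimately show ?thesis by simp
qed

lemma halts_at_unique: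
  assumes "halts_at M X is d" "halts_at M X is d'"
  shows "d = d'"
proof -
  have "d = d'" if "(\<lambda>c c'. step M X c = Some c')\<^sup>*\<^sup>* s d" "(\<lambda>c c'. step M X c = Some c')\<^sup>*\<^sup>* s d'"
    "step M X d = None" "step M X d' = None" for s
    using that(1,2)
  proof (induction rule: converse_rtranclp_induct)
    case base
    then show ?case using that(3) by (auto elim: converse_rtranclpE)
  next
    case (step y z)
    from step.prems show ?case
    proof (cases rule: converse_rtranclpE)
      case base
      then show ?thesis using step.hyps(1) that(4) by simp
    next
      case (step w)
      then show ?thesis using step.IH step.hyps(1) by simp
    qed
  qed
  then show ?thesis using assms unfolding halts_at_def by blast
qed

section \<open>Arithmetical predicates as statements of the levels\<close>

text \<open>Arguments are stored in reverse, so that the next quantified number is added in front,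
  as the recursion of \<open>truth\<close> does it.\<close>

definition inst :: "nat \<Rightarrow> nat list \<Rightarrow> nat" where
  "inst e is = list_encode (rev is @ [e])"

lemma inst_snoc: "inst e (is @ [i]) = Suc (prod_encode (i, inst e is))"
  by (simp add: inst_def)

text \<open>Asserting a halting history costs one quantifier, hence level 1. The machine always
  halts and its final configuration is unique, so the flag \<open>b\<close> selects between the
  predicate and its complement at no further cost.\<close>

lemma recursive_pred_truth:
  assumes "recursive_pred n R"
  shows "\<exists>e. \<forall>X is. length is = n \<longrightarrow> (truth base_truth X 1 (inst e is) \<longleftrightarrow> (R X is \<longleftrightarrow> b))"
proof -
  obtain M where M: "wf_oracle_tm M"
    "\<And>X is. length is = n \<Longrightarrow> \<exists>c. halts_at M X is c \<and> (state c = accept_state M \<longleftrightarrow> R X is)"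
    using assms by (auto simp: recursive_pred_def)
  obtain ts where ts: "\<And>k v. (k, v) \<in> set ts \<longleftrightarrow> transition M k = Some v" using obtain_table[OF M(1)] by blast
  define e where "e = list_encode [of_bool b, num_tapes M, start_state M, accept_state M, list_encode (map ecode ts)]"
  have "truth base_truth X 1 (inst e is) \<longleftrightarrow> (R X is \<longleftrightarrow> b)" if len: "length is = n" for X "is"
  proof -
    define C where "C hs = list_encode (list_encode hs # rev is @ [e])" for hs
    have "truth base_truth X 1 (inst e is) \<longleftrightarrow> (\<exists>H. valid (Suc (prod_encode (H, inst e is))) (map X [0..<Suc (prod_encode (H, inst e is))]))"
      by (simp add: base_truth_def del: upt_Suc)
    also have "\<dots> \<longleftrightarrow> (\<exists>hs. valid (C hs) (map X [0..<C hs]))"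
      unfolding C_def inst_def list_encode.simps by (metis list_decode_inverse)
    also have "\<dots> \<longleftrightarrow> (\<exists>hs. run_codes M X (init_config M is) hs \<and> step M X (cfg_of (last hs)) = None \<and>
      (state (cfg_of (last hs)) = accept_state M \<longleftrightarrow> b))"
      using valid_iff[OF M(1) ts e_def C_def] by (auto split: if_splits)
    also have "\<dots> \<longleftrightarrow> (\<exists>d. halts_at M X is d \<and> (state d = accept_state M \<longleftrightarrow> b))"
      unfolding halts_at_def using run_codes_exists run_codes_steps by blast
    also have "\<dots> \<longleftrightarrow> (R X is \<longleftrightarrow> b)"
      using M(2)[OF len, of X] halts_at_unique by metis
    finally show ?thesis .
  qed
  then show ?thesis by blast
qed

text \<open>Each quantifier step negates, so the two kinds of prefixes need a simultaneous
  induction; the indices stay the same and exchange their roles.\<close>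

lemma quantifiers_truth:
  assumes "recursive_pred n R"
  shows "k \<le> n \<Longrightarrow>
    (\<exists>e. \<forall>X is. length is + k = n \<longrightarrow> (truth base_truth X (Suc k) (inst e is) \<longleftrightarrow> exists_forall k (\<lambda>js. R X (is @ js)))) \<and>
    (\<exists>e. \<forall>X is. length is + k = n \<longrightarrow> (truth base_truth X (Suc k) (inst e is) \<longleftrightarrow> \<not> forall_exists k (\<lambda>js. R X (is @ js))))"
proof (induction k)
  case 0
  show ?case
    using recursive_pred_truth[OF assms, of True] recursive_pred_truth[OF assms, of False] by (simp del: truth.simps)
next
  case (Suc k)
  then obtain e e' where
    e: "\<And>X is. length is + k = n \<Longrightarrow> (truth base_truth X (Suc k) (inst e is) \<longleftrightarrow> exists_forall k (\<lambda>js. R X (is @ js)))" and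
    e': "\<And>X is. length is + k = n \<Longrightarrow> (truth base_truth X (Suc k) (inst e' is) \<longleftrightarrow> \<not> forall_exists k (\<lambda>js. R X (is @ js)))"
    by auto
  have truth: "truth base_truth X (Suc (Suc k)) (inst e is) \<longleftrightarrow> (\<exists>i. \<not> truth base_truth X (Suc k) (inst e (is @ [i])))" for X e "is"
    unfolding inst_snoc by (simp only: truth.simps(2)[of base_truth X "Suc k"])
  show ?case
  proof (intro conjI exI allI impI)
    fix X and "is" :: "nat list" assume "length is + Suc k = n"
    then have len: "length (is @ [i]) + k = n" for i by simp
    show "truth base_truth X (Suc (Suc k)) (inst e' is) \<longleftrightarrow> exists_forall (Suc k) (\<lambda>js. R X (is @ js))"
      unfolding truth e'[OF len] by simp
    show "truth base_truth X (Suc (Suc k)) (inst e is) \<longleftrightarrow> \<not> forall_exists (Suc k) (\<lambda>js. R X (is @ js))"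
      unfolding truth e[OF len] by simp
  qed
qed

lemma Pi0_truth:
  assumes "Pi0 n P"
  shows "\<exists>e. \<forall>X. X \<in> P \<longleftrightarrow> \<not> truth base_truth X (Suc n) (inst e [])"
proof -
  obtain R where R: "recursive_pred n R" "P = {X. forall_exists n (R X)}" using assms by (auto simp: Pi0_def)
  obtain e where "\<And>X is. length is + n = n \<Longrightarrow> (truth base_truth X (Suc n) (inst e is) \<longleftrightarrow> \<not> forall_exists n (\<lambda>js. R X (is @ js)))"
    using quantifiers_truth[OF R(1), of n] by blast
  from this[of "[]"] show ?thesis using R(2) by (intro exI[of _ e]) simp
qed

section \<open>The theorem\<close>

theorem theorem3p5:
  "\<exists>(P :: (nat \<Rightarrow> nat) set) Z.
     countable P \<and> Pi0 1 P \<and> Z \<in> P \<and> \<not> arithmetical_singleton Z"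
proof (intro exI conjI)
  show "countable (points base_table)" by (rule countable_points)
  have "decidable (\<lambda>e. legit base_table (e 0))"
    by (rule decidable_legit[OF computable_base_table base_table_le_2 computable_var])
  then have "recursive_pred 1 (\<lambda>X is. legit base_table (list_encode (map X [0..<is ! 0])))"
    by (rule recursive_pred_prefix)
  moreover have "points base_table = {X. forall_exists 1 (\<lambda>is. legit base_table (list_encode (map X [0..<is ! 0])))}"
    by (simp add: points_def)
  ultimately show "Pi0 1 (points base_table)" unfolding Pi0_def by blast
  show "tower base_table (\<lambda>_. 0) 0 \<in> points base_table"
    using tower_points[of "\<lambda>_. 0" base_table 0] by simp
  show "\<not> arithmetical_singleton (tower base_table (\<lambda>_. 0) 0)"
  proof
    assume "arithmetical_singleton (tower base_table (\<lambda>_. 0) 0)"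
    then obtain n where "Pi0 n {tower base_table (\<lambda>_. 0) 0}"
      by (auto simp: arithmetical_singleton_def arithmetical_def)
    from Pi0_truth[OF this] obtain e where
      e: "\<And>X. X \<in> {tower base_table (\<lambda>_. 0) 0} \<longleftrightarrow> \<not> truth base_truth X (Suc n) (inst e [])" by blast
    obtain m where "truth base_truth (tower base_table (marker m) 0) (Suc n) (inst e []) = truth base_truth (tower base_table (\<lambda>_. 0) 0) (Suc n) (inst e [])"
      using not_isolated[OF decides_base_table] by blast
    then have "tower base_table (marker m) 0 \<in> {tower base_table (\<lambda>_. 0) 0}" using e by blast
    then show False using tower_marker_neq by blast
  qed
qed

end
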